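(* Let $M:\mathbb{U}\to\mathbb{C}$ be a (symmetric) mixed unitary category, and suppose $D:\mathbb{C}\to\mathbb{D}$ with discard maps $(d_U)_{U\in\mathbb{U}}$ is an environment structure with purification for $M$. Then $\mathbb{D}\simeq\mathsf{CP}^\infty(M:\mathbb{U}\to\mathbb{C})$, i.e. $\mathbb{D}$ and $\mathsf{CP}^\infty(M:\mathbb{U}\to\mathbb{C})$ are isomorphic (as isomix categories).
   Context: Composition is written in diagrammatic order, $f;g$ meaning first $f$ then $g$. LDC: a linearly distributive category (Cockett–Seely) has two monoidal structures, tensor $(\otimes,\top,a_\otimes,u_\otimes^L,u_\otimes^R)$ and par $(\oplus,\bot,a_\oplus,u_\oplus^L,u_\oplus^R)$, with associators oriented as $X(YZ)\to(XY)Z$ and unitors oriented towards the object, linked by natural transformations $\partial^L:A\otimes(B\oplus C)\to(A\otimes B)\oplus C$ and $\partial^R:(A\oplus B)\otimes C\to A\oplus(B\otimes C)$ satisfying the usual Cockett–Seely coherence conditions. It is symmetric if both monoidal structures are symmetric (symmetries $c_\otimes,c_\oplus$), compatibly with the distributors. An isomix category is an LDC with an isomorphism $\mathsf{m}:\bot\to\top$; then $\mathrm{mx}_{A,B}:A\otimes B\to A\oplus B$ is the natural map $(1\otimes(u_\oplus^L)^{-1});(1\otimes(\mathsf{m}\oplus1));\partial^L;(u_\otimes^R\oplus1)$. The core consists of the objects $U$ such that $\mathrm{mx}_{U,X}$ and $\mathrm{mx}_{X,U}$ are isomorphisms for all $X$. $\dagger$-LDC: an LDC with a functor $(\_)^\dagger:\mathbb{X}^{\mathrm{op}}\to\mathbb{X}$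 and natural isomorphisms $\lambda_\otimes:A^\dagger\otimes B^\dagger\to(A\oplus B)^\dagger$, $\lambda_\oplus:A^\dagger\oplus B^\dagger\to(A\otimes B)^\dagger$, $\lambda_\top:\top\to\bot^\dagger$, $\lambda_\bot:\bot\to\top^\dagger$, $\iota:A\to A^{\dagger\dagger}$ such that: (1) $a_\otimes;(\lambda_\otimes\otimes 1);\lambda_\otimes=(1\otimes\lambda_\otimes);\lambda_\otimes;(a_\oplus^{-1})^\dagger$ and the same with $\otimes,\oplus$ exchanged; (2) $(\lambda_\top\otimes1);\lambda_\otimes=u_\otimes^L;(u_\oplus^L)^\dagger$, $(\lambda_\bot\oplus1);\lambda_\oplus=u_\oplus^L;(u_\otimes^L)^\dagger$ and the right-handed versions; (3) $\partial^L;(\lambda_\otimes\oplus1);\lambda_\oplus=(1\otimes\lambda_\oplus);\lambda_\otimes;(\partial^R)^\dagger$ and $\partial^R;(1\oplus\lambda_\otimes);\lambda_\oplus=(\lambda_\oplus\otimes1);\lambda_\otimes;(\partial^L)^\dagger$; (4) $\iota_{A\oplus B};\lambda_\otimes^\dagger=(\iota_A\oplus\iota_B);\lambda_\oplus$ and $\iota_{A\otimes B};\lambda_\oplus^\dagger=(\iota_A\otimes\iota_B);\lambda_\otimes$; (5) $\iota_\bot;\lambda_\top^\dagger=\lambda_\bot$ and $\iota_\top;\lambda_\bot^\dagger=\lambda_\top$; (6) $\iota_{A^\dagger}=(\iota_A^{-1})^\dagger$. A $\dagger$-isomix category is a $\dagger$-LDC that is isomix with $\mathsf{m};\lambda_\top=\lambda_\bot;\mathsf{m}^\dagger$.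 In the symmetric case one also requires $\lambda_\otimes;c_\oplus^\dagger=c_\otimes;\lambda_\otimes$ and $\lambda_\oplus;c_\otimes^\dagger=c_\oplus;\lambda_\oplus$. Unitary category: a $\dagger$-isomix category $\mathbb{U}$ in which every object $A$ lies in the core and is equipped with an isomorphism $\varphi_A:A\to A^\dagger$ such that $\varphi_{A^\dagger}=(\varphi_A^{-1})^\dagger$; $\varphi_A;\varphi_{A^\dagger}=\iota_A$; $\varphi_\bot;\lambda_\top^{-1}=\mathsf{m}=\lambda_\bot;\varphi_\top^{-1}$; $(\varphi_A\otimes\varphi_B);\lambda_\otimes;\varphi_{A\oplus B}^{-1}=\mathrm{mx}_{A,B}=\varphi_{A\otimes B};\lambda_\oplus^{-1};(\varphi_A^{-1}\oplus\varphi_B^{-1})$. Isomix functor $F$ between isomix categories: a functor that is monoidal for $\otimes$ ($m_\otimes:F(A)\otimes F(B)\to F(A\otimes B)$, $m_\top:\top\to F(\top)$) and comonoidal for $\oplus$ ($n_\oplus:F(A\oplus B)\to F(A)\oplus F(B)$, $n_\bot:F(\bot)\to\bot$), satisfying the Frobenius conditions $m_\otimes;F(\partial^L);n_\oplus=(1\otimes n_\oplus);\partial^L;(m_\otimes\oplus1)$ and $m_\otimes;F(\partial^R);n_\oplus=(n_\oplus\otimes1);\partial^R;(1\oplus m_\otimes)$, with $F(\mathsf{m})=n_\bot;\mathsf{m};m_\top$ and $\mathsf{m}^{-1}=m_\top;F(\mathsf{m}^{-1});n_\bot$. It is strong (strict) if $m_\otimes,m_\top,n_\oplus,n_\bot$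 are isomorphisms (identities), and symmetric if it is symmetric (co)monoidal. A $\dagger$-isomix functor between $\dagger$-isomix categories is an isomix functor with a natural isomorphism $\rho_A:F(A^\dagger)\to F(A)^\dagger$ (the preservator) such that $m_\otimes;F(\lambda_\otimes);\rho=(\rho\otimes\rho);\lambda_\otimes;n_\oplus^\dagger$, $m_\top;F(\lambda_\top);\rho=\lambda_\top;n_\bot^\dagger$, $F(\lambda_\oplus);\rho;m_\otimes^\dagger=n_\oplus;(\rho\oplus\rho);\lambda_\oplus$, $F(\lambda_\bot);\rho;m_\top^\dagger=n_\bot;\lambda_\bot$, and $\iota_{F(X)};(\rho_X)^\dagger=F(\iota_X);\rho_{X^\dagger}$. Mixed unitary category (MUC) $M:\mathbb{U}\to\mathbb{C}$: a $\dagger$-isomix category $\mathbb{C}$ with a strong $\dagger$-isomix functor $M$ from a unitary category $\mathbb{U}$, such that $\mathrm{mx}_{M(U),X}$ and $\mathrm{mx}_{X,M(U)}$ are natural isomorphisms for all $U\in\mathbb{U}$, $X\in\mathbb{C}$. It is symmetric if $\mathbb{U}$, $\mathbb{C}$ and $M$ are symmetric. Kraus maps: a Kraus map $(f,U):A\to B$ is a map $f:A\to M(U)\oplus B$ in $\mathbb{C}$ with $U\in\mathbb{U}$. Kraus maps $(f,U),(g,V):A\to B$ are equivalent, $(f,U)\sim(g,V)$, if for all $C\in\mathbb{C}$, $W\in\mathbb{U}$ and all $h:B\otimes C\to M(W)$ in $\mathbb{C}$ one has $T_h(f,U)=T_h(g,V)$, where $T_h(f,U):A\otimes C\to(A\otimes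 C)^\dagger$ is $$(f\otimes1);\partial^R;(1\oplus h);\mathrm{mx}^{-1};(M(\varphi_U)\otimes M(\varphi_W));(\rho\otimes\rho);(1\otimes(h^\dagger;\lambda_\oplus^{-1}));\partial^L;(\lambda_\otimes\oplus1);(f^\dagger\oplus1);\lambda_\oplus,$$ passing through $(M(U)\oplus B)\otimes C$, $M(U)\oplus(B\otimes C)$, $M(U)\oplus M(W)$, $M(U)\otimes M(W)$, $M(U^\dagger)\otimes M(W^\dagger)$, $M(U)^\dagger\otimes M(W)^\dagger$, $M(U)^\dagger\otimes(B^\dagger\oplus C^\dagger)$, $(M(U)^\dagger\otimes B^\dagger)\oplus C^\dagger$, $(M(U)\oplus B)^\dagger\oplus C^\dagger$, $A^\dagger\oplus C^\dagger$. $\mathsf{CP}^\infty(M:\mathbb{U}\to\mathbb{C})$ is the category whose objects are those of $\mathbb{C}$; maps $A\to B$ are $\sim$-classes $[(f,U)]$ of Kraus maps; the composite of $[(f,U)]:A\to B$ and $[(g,V)]:B\to C$ is the class of $\big(f;(1\oplus g);a_\oplus;(n_\oplus^{-1}\oplus1),\,U\oplus V\big)$, where $n_\oplus^{-1}:M(U)\oplus M(V)\to M(U\oplus V)$; the identity on $A$ is the class of $\big((u_\oplus^L)^{-1};(n_\bot^{-1}\oplus1),\,\bot\big)$ (with $n_\oplus,n_\bot$ those of $M$). The identity-on-objects functor $Q:\mathbb{C}\to\mathsf{CP}^\infty(M)$ sends $f:A\to B$ to the class of $\big(f;(u_\oplus^L)^{-1};(n_\bot^{-1}\oplus1),\bot\big)$.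 Its isomix structure: tensor and par $\widehat\otimes,\widehat\oplus$ are $\otimes,\oplus$ of $\mathbb{C}$ on objects, with units $\top,\bot$. For $(f,U):A\to A'$ and $(g,V):B\to B'$, $f\,\widehat\otimes\,g$ is the class with ancilla $U\oplus V$ of $(f\otimes g)$ followed by the canonical map $(M(U)\oplus A')\otimes(M(V)\oplus B')\to(M(U)\oplus M(V))\oplus(A'\otimes B')$ (namely $\partial^R$, then $A'\otimes(M(V)\oplus B')\to M(V)\oplus(A'\otimes B')$ given by $(1\otimes c_\oplus);\partial^L;c_\oplus$, then $a_\oplus$) and by $n_\oplus^{-1}\oplus1$; $f\,\widehat\oplus\,g$ is the class with ancilla $U\oplus V$ of $(f\oplus g)$ followed by the canonical rearrangement $(M(U)\oplus A')\oplus(M(V)\oplus B')\to(M(U)\oplus M(V))\oplus(A'\oplus B')$ and $n_\oplus^{-1}\oplus1$. All structure isomorphisms, distributors and the mix map are the images under $Q$ of those of $\mathbb{C}$. Environment structure for $M:\mathbb{U}\to\mathbb{C}$: a strict isomix functor $F:\mathbb{C}\to\mathbb{D}$ to an isomix category $\mathbb{D}$ (symmetric in the symmetric setting), with a family of maps $d_U:F(M(U))\to\bot$ in $\mathbb{D}$, $U\in\mathbb{U}$ (discard maps), such that: [Env.1] for $U,V\in\mathbb{U}$: (a) $\mathrm{mx};(d_U\oplus d_V);u_\oplus=m_\otimes;d_{U\otimes V}:F(M(U))\otimes F(M(V))\to\bot$, and (b) $n_\oplus;(d_U\oplus d_V);u_\oplus=d_{U\oplus V}:F(M(U\oplus V))\to\bot$,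 where $m_\otimes,n_\oplus$ are those of the composite functor $M;F$ and $u_\oplus:\bot\oplus\bot\to\bot$; [Env.2] for all Kraus maps $(f,U),(g,V):A\to B$: $(f,U)\sim(g,V)$ if and only if $F(f);n_\oplus;(d_U\oplus1)=F(g);n_\oplus;(d_V\oplus1):F(A)\to\bot\oplus F(B)$, where $n_\oplus$ is that of $F$. It has purification if $F$ is bijective on objects and for every $f:F(A)\to F(B)$ in $\mathbb{D}$ there is a Kraus map $(f',U):A\to B$ with $f=F(f');n_\oplus;(d_U\oplus1);u_\oplus^L$.
   Formalization: The isomorphism as isomix categories is stated in the symmetric setting, since the tensor and par of maps in CP^∞ are defined using the symmetry of par; for a MUC without symmetry, D and CP^∞ are shown isomorphic as categories. *)

theory Defs
  imports Main
begin

text \<open>Composition is written in diagrammatic order. On objects, binary operations and the dagger are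
  written with bold symbols; the plain symbols are reserved for arrows.\<close>

record ('o, 'a) cat =
  Obj :: "'o set"
  Arr :: "'a set"
  Dom :: "'a \<Rightarrow> 'o"
  Cod :: "'a \<Rightarrow> 'o"
  Ident :: "'o \<Rightarrow> 'a" ("\<one>\<index>")
  Comp :: "'a \<Rightarrow> 'a \<Rightarrow> 'a" (infixl "\<Zcomp>\<index>" 60)

definition hom :: "('o, 'a, 'x) cat_scheme \<Rightarrow> 'o \<Rightarrow> 'o \<Rightarrow> 'a set" where
  "hom \<C> A B = {f \<in> Arr \<C>. Dom \<C> f = A \<and> Cod \<C> f = B}"

definition isos :: "('o, 'a, 'x) cat_scheme \<Rightarrow> 'o \<Rightarrow> 'o \<Rightarrow> 'a set" where
  "isos \<C> A B =
     {f \<in> hom \<C> A B. \<exists>g \<in> hom \<C> B A. f \<Zcomp>\<^bsub>\<C>\<^esub> g = \<one>\<^bsub>\<C>\<^esub> A \<and> g \<Zcomp>\<^bsub>\<C>\<^esub> f = \<one>\<^bsub>\<C>\<^esub> B}"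

definition inv_arr :: "('o, 'a, 'x) cat_scheme \<Rightarrow> 'a \<Rightarrow> 'a" ("inv\<index> _" [81] 80) where
  "inv\<^bsub>\<C>\<^esub> f =
     (THE g. g \<in> hom \<C> (Cod \<C> f) (Dom \<C> f) \<and>
        f \<Zcomp>\<^bsub>\<C>\<^esub> g = \<one>\<^bsub>\<C>\<^esub> (Dom \<C> f) \<and> g \<Zcomp>\<^bsub>\<C>\<^esub> f = \<one>\<^bsub>\<C>\<^esub> (Cod \<C> f))"

locale category =
  fixes \<C> :: "('o, 'a, 'x) cat_scheme" (structure)
  assumes Dom_Obj: "f \<in> Arr \<C> \<Longrightarrow> Dom \<C> f \<in> Obj \<C>"
    and Cod_Obj: "f \<in> Arr \<C> \<Longrightarrow> Cod \<C> f \<in> Obj \<C>"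
    and Ident_hom: "A \<in> Obj \<C> \<Longrightarrow> \<one> A \<in> hom \<C> A A"
    and Comp_hom: "\<lbrakk>f \<in> hom \<C> A B; g \<in> hom \<C> B C\<rbrakk> \<Longrightarrow> f \<Zcomp> g \<in> hom \<C> A C"
    and Ident_Comp: "f \<in> hom \<C> A B \<Longrightarrow> \<one> A \<Zcomp> f = f"
    and Comp_Ident: "f \<in> hom \<C> A B \<Longrightarrow> f \<Zcomp> \<one> B = f"
    and Comp_assoc:
      "\<lbrakk>f \<in> hom \<C> A B; g \<in> hom \<C> B C; h \<in> hom \<C> C E\<rbrakk> \<Longrightarrow> (f \<Zcomp> g) \<Zcomp> h = f \<Zcomp> (g \<Zcomp> h)"

locale monoidal = category \<C> for \<C> :: "('o, 'a, 'x) cat_scheme" (structure) +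
  fixes ob :: "'o \<Rightarrow> 'o \<Rightarrow> 'o" (infixr "\<^bold>\<box>" 70)
    and ar :: "'a \<Rightarrow> 'a \<Rightarrow> 'a" (infixr "\<box>" 70)
    and I :: 'o
    and a :: "'o \<Rightarrow> 'o \<Rightarrow> 'o \<Rightarrow> 'a"
    and uL :: "'o \<Rightarrow> 'a"
    and uR :: "'o \<Rightarrow> 'a"
  assumes unit_Obj: "I \<in> Obj \<C>"
    and ob_Obj: "\<lbrakk>A \<in> Obj \<C>; B \<in> Obj \<C>\<rbrakk> \<Longrightarrow> A \<^bold>\<box> B \<in> Obj \<C>"
    and ar_hom: "\<lbrakk>f \<in> hom \<C> A A'; g \<in> hom \<C> B B'\<rbrakk> \<Longrightarrow> f \<box> g \<in> hom \<C> (A \<^bold>\<box> B) (A' \<^bold>\<box> B')"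
    and ar_Ident: "\<lbrakk>A \<in> Obj \<C>; B \<in> Obj \<C>\<rbrakk> \<Longrightarrow> \<one> A \<box> \<one> B = \<one> (A \<^bold>\<box> B)"
    and ar_Comp:
      "\<lbrakk>f \<in> hom \<C> A A'; f' \<in> hom \<C> A' A''; g \<in> hom \<C> B B'; g' \<in> hom \<C> B' B''\<rbrakk> \<Longrightarrow>
        (f \<Zcomp> f') \<box> (g \<Zcomp> g') = (f \<box> g) \<Zcomp> (f' \<box> g')"
    and a_iso:
      "\<lbrakk>A \<in> Obj \<C>; B \<in> Obj \<C>; C \<in> Obj \<C>\<rbrakk> \<Longrightarrow>
        a A B C \<in> isos \<C> (A \<^bold>\<box> (B \<^bold>\<box> C)) ((A \<^bold>\<box> B) \<^bold>\<box> C)"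
    and uL_iso: "A \<in> Obj \<C> \<Longrightarrow> uL A \<in> isos \<C> (I \<^bold>\<box> A) A"
    and uR_iso: "A \<in> Obj \<C> \<Longrightarrow> uR A \<in> isos \<C> (A \<^bold>\<box> I) A"
    and a_natural:
      "\<lbrakk>f \<in> hom \<C> A A'; g \<in> hom \<C> B B'; h \<in> hom \<C> C C'\<rbrakk> \<Longrightarrow>
        (f \<box> (g \<box> h)) \<Zcomp> a A' B' C' = a A B C \<Zcomp> ((f \<box> g) \<box> h)"
    and uL_natural: "f \<in> hom \<C> A A' \<Longrightarrow> (\<one> I \<box> f) \<Zcomp> uL A' = uL A \<Zcomp> f"
    and uR_natural: "f \<in> hom \<C> A A' \<Longrightarrow> (f \<box> \<one> I) \<Zcomp> uR A' = uR A \<Zcomp> f"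
    and pentagon:
      "\<lbrakk>A \<in> Obj \<C>; B \<in> Obj \<C>; C \<in> Obj \<C>; E \<in> Obj \<C>\<rbrakk> \<Longrightarrow>
        a A B (C \<^bold>\<box> E) \<Zcomp> a (A \<^bold>\<box> B) C E =
        (\<one> A \<box> a B C E) \<Zcomp> a A (B \<^bold>\<box> C) E \<Zcomp> (a A B C \<box> \<one> E)"
    and triangle:
      "\<lbrakk>A \<in> Obj \<C>; B \<in> Obj \<C>\<rbrakk> \<Longrightarrow> a A I B \<Zcomp> (uR A \<box> \<one> B) = \<one> A \<box> uL B"

locale symmetric_monoidal = monoidal \<C> ob ar I a uL uR
  for \<C> :: "('o, 'a, 'x) cat_scheme" (structure)
    and ob (infixr "\<^bold>\<box>" 70) and ar (infixr "\<box>" 70) and I a uL uR +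
  fixes c :: "'o \<Rightarrow> 'o \<Rightarrow> 'a"
  assumes c_hom: "\<lbrakk>A \<in> Obj \<C>; B \<in> Obj \<C>\<rbrakk> \<Longrightarrow> c A B \<in> hom \<C> (A \<^bold>\<box> B) (B \<^bold>\<box> A)"
    and c_natural:
      "\<lbrakk>f \<in> hom \<C> A A'; g \<in> hom \<C> B B'\<rbrakk> \<Longrightarrow> (f \<box> g) \<Zcomp> c A' B' = c A B \<Zcomp> (g \<box> f)"
    and c_inverse: "\<lbrakk>A \<in> Obj \<C>; B \<in> Obj \<C>\<rbrakk> \<Longrightarrow> c A B \<Zcomp> c B A = \<one> (A \<^bold>\<box> B)"
    and c_unit: "A \<in> Obj \<C> \<Longrightarrow> c A I \<Zcomp> uL A = uR A"
    and hexagon: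
      "\<lbrakk>A \<in> Obj \<C>; B \<in> Obj \<C>; C \<in> Obj \<C>\<rbrakk> \<Longrightarrow>
        a A B C \<Zcomp> c (A \<^bold>\<box> B) C \<Zcomp> a C A B =
        (\<one> A \<box> c B C) \<Zcomp> a A C B \<Zcomp> (c A C \<box> \<one> B)"

record ('o, 'a) ldc_data = "('o, 'a) cat" +
  tensor_obj :: "'o \<Rightarrow> 'o \<Rightarrow> 'o" (infixr "\<^bold>\<otimes>\<index>" 70)
  tensor :: "'a \<Rightarrow> 'a \<Rightarrow> 'a" (infixr "\<otimes>\<index>" 70)
  tensor_unit :: 'o ("\<top>\<index>")
  tensor_assoc :: "'o \<Rightarrow> 'o \<Rightarrow> 'o \<Rightarrow> 'a" ("a\<^sub>\<otimes>\<index>")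
  tensor_uL :: "'o \<Rightarrow> 'a" ("u\<^sub>\<otimes>\<^sup>L\<index>")
  tensor_uR :: "'o \<Rightarrow> 'a" ("u\<^sub>\<otimes>\<^sup>R\<index>")
  par_obj :: "'o \<Rightarrow> 'o \<Rightarrow> 'o" (infixr "\<^bold>\<oplus>\<index>" 70)
  par :: "'a \<Rightarrow> 'a \<Rightarrow> 'a" (infixr "\<oplus>\<index>" 70)
  par_unit :: 'o ("\<bottom>\<index>")
  par_assoc :: "'o \<Rightarrow> 'o \<Rightarrow> 'o \<Rightarrow> 'a" ("a\<^sub>\<oplus>\<index>")
  par_uL :: "'o \<Rightarrow> 'a" ("u\<^sub>\<oplus>\<^sup>L\<index>")
  par_uR :: "'o \<Rightarrow> 'a" ("u\<^sub>\<oplus>\<^sup>R\<index>")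
  distL :: "'o \<Rightarrow> 'o \<Rightarrow> 'o \<Rightarrow> 'a" ("\<partial>\<^sup>L\<index>")
  distR :: "'o \<Rightarrow> 'o \<Rightarrow> 'o \<Rightarrow> 'a" ("\<partial>\<^sup>R\<index>")

locale ldc =
  category \<C> +
  tensor: monoidal \<C> "tensor_obj \<C>" "tensor \<C>" "\<top>" "a\<^sub>\<otimes>" "u\<^sub>\<otimes>\<^sup>L" "u\<^sub>\<otimes>\<^sup>R" +
  par: monoidal \<C> "par_obj \<C>" "par \<C>" "\<bottom>" "a\<^sub>\<oplus>" "u\<^sub>\<oplus>\<^sup>L" "u\<^sub>\<oplus>\<^sup>R"
  for \<C> :: "('o, 'a, 'x) ldc_data_scheme" (structure) +
  assumes distL_hom:
      "\<lbrakk>A \<in> Obj \<C>; B \<in> Obj \<C>; C \<in> Obj \<C>\<rbrakk> \<Longrightarrow>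
        \<partial>\<^sup>L A B C \<in> hom \<C> (A \<^bold>\<otimes> (B \<^bold>\<oplus> C)) ((A \<^bold>\<otimes> B) \<^bold>\<oplus> C)"
    and distR_hom:
      "\<lbrakk>A \<in> Obj \<C>; B \<in> Obj \<C>; C \<in> Obj \<C>\<rbrakk> \<Longrightarrow>
        \<partial>\<^sup>R A B C \<in> hom \<C> ((A \<^bold>\<oplus> B) \<^bold>\<otimes> C) (A \<^bold>\<oplus> (B \<^bold>\<otimes> C))"
    and distL_natural:
      "\<lbrakk>f \<in> hom \<C> A A'; g \<in> hom \<C> B B'; h \<in> hom \<C> C C'\<rbrakk> \<Longrightarrow>
        (f \<otimes> (g \<oplus> h)) \<Zcomp> \<partial>\<^sup>L A' B' C' = \<partial>\<^sup>L A B C \<Zcomp> ((f \<otimes> g) \<oplus> h)"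
    and distR_natural:
      "\<lbrakk>f \<in> hom \<C> A A'; g \<in> hom \<C> B B'; h \<in> hom \<C> C C'\<rbrakk> \<Longrightarrow>
        ((f \<oplus> g) \<otimes> h) \<Zcomp> \<partial>\<^sup>R A' B' C' = \<partial>\<^sup>R A B C \<Zcomp> (f \<oplus> (g \<otimes> h))"
    and distL_tensor_unit:
      "\<lbrakk>A \<in> Obj \<C>; B \<in> Obj \<C>\<rbrakk> \<Longrightarrow> \<partial>\<^sup>L \<top> A B \<Zcomp> (u\<^sub>\<otimes>\<^sup>L A \<oplus> \<one> B) = u\<^sub>\<otimes>\<^sup>L (A \<^bold>\<oplus> B)"
    and distR_tensor_unit:
      "\<lbrakk>A \<in> Obj \<C>; B \<in> Obj \<C>\<rbrakk> \<Longrightarrow> \<partial>\<^sup>R A B \<top> \<Zcomp> (\<one> A \<oplus> u\<^sub>\<otimes>\<^sup>R B) = u\<^sub>\<otimes>\<^sup>R (A \<^bold>\<oplus> B)"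
    and distL_par_unit:
      "\<lbrakk>A \<in> Obj \<C>; B \<in> Obj \<C>\<rbrakk> \<Longrightarrow> \<partial>\<^sup>L A B \<bottom> \<Zcomp> u\<^sub>\<oplus>\<^sup>R (A \<^bold>\<otimes> B) = \<one> A \<otimes> u\<^sub>\<oplus>\<^sup>R B"
    and distR_par_unit:
      "\<lbrakk>A \<in> Obj \<C>; B \<in> Obj \<C>\<rbrakk> \<Longrightarrow> \<partial>\<^sup>R \<bottom> A B \<Zcomp> u\<^sub>\<oplus>\<^sup>L (A \<^bold>\<otimes> B) = u\<^sub>\<oplus>\<^sup>L A \<otimes> \<one> B"
    and distL_tensor_assoc:
      "\<lbrakk>A \<in> Obj \<C>; B \<in> Obj \<C>; C \<in> Obj \<C>; E \<in> Obj \<C>\<rbrakk> \<Longrightarrow>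
        a\<^sub>\<otimes> A B (C \<^bold>\<oplus> E) \<Zcomp> \<partial>\<^sup>L (A \<^bold>\<otimes> B) C E =
        (\<one> A \<otimes> \<partial>\<^sup>L B C E) \<Zcomp> \<partial>\<^sup>L A (B \<^bold>\<otimes> C) E \<Zcomp> (a\<^sub>\<otimes> A B C \<oplus> \<one> E)"
    and distR_tensor_assoc:
      "\<lbrakk>A \<in> Obj \<C>; B \<in> Obj \<C>; C \<in> Obj \<C>; E \<in> Obj \<C>\<rbrakk> \<Longrightarrow>
        a\<^sub>\<otimes> (A \<^bold>\<oplus> B) C E \<Zcomp> (\<partial>\<^sup>R A B C \<otimes> \<one> E) \<Zcomp> \<partial>\<^sup>R A (B \<^bold>\<otimes> C) E =
        \<partial>\<^sup>R A B (C \<^bold>\<otimes> E) \<Zcomp> (\<one> A \<oplus> a\<^sub>\<otimes> B C E)"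
    and distL_par_assoc:
      "\<lbrakk>A \<in> Obj \<C>; B \<in> Obj \<C>; C \<in> Obj \<C>; E \<in> Obj \<C>\<rbrakk> \<Longrightarrow>
        (\<one> A \<otimes> a\<^sub>\<oplus> B C E) \<Zcomp> \<partial>\<^sup>L A (B \<^bold>\<oplus> C) E \<Zcomp> (\<partial>\<^sup>L A B C \<oplus> \<one> E) =
        \<partial>\<^sup>L A B (C \<^bold>\<oplus> E) \<Zcomp> a\<^sub>\<oplus> (A \<^bold>\<otimes> B) C E"
    and distR_par_assoc:
      "\<lbrakk>A \<in> Obj \<C>; B \<in> Obj \<C>; C \<in> Obj \<C>; E \<in> Obj \<C>\<rbrakk> \<Longrightarrow>
        \<partial>\<^sup>R A (B \<^bold>\<oplus> C) E \<Zcomp> (\<one> A \<oplus> \<partial>\<^sup>R B C E) \<Zcomp> a\<^sub>\<oplus> A B (C \<^bold>\<otimes> E) =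
        (a\<^sub>\<oplus> A B C \<otimes> \<one> E) \<Zcomp> \<partial>\<^sup>R (A \<^bold>\<oplus> B) C E"
    and distL_distR_tensor:
      "\<lbrakk>A \<in> Obj \<C>; B \<in> Obj \<C>; C \<in> Obj \<C>; E \<in> Obj \<C>\<rbrakk> \<Longrightarrow>
        a\<^sub>\<otimes> A (B \<^bold>\<oplus> C) E \<Zcomp> (\<partial>\<^sup>L A B C \<otimes> \<one> E) \<Zcomp> \<partial>\<^sup>R (A \<^bold>\<otimes> B) C E =
        (\<one> A \<otimes> \<partial>\<^sup>R B C E) \<Zcomp> \<partial>\<^sup>L A B (C \<^bold>\<otimes> E)"
    and distL_distR_par:
      "\<lbrakk>A \<in> Obj \<C>; B \<in> Obj \<C>; C \<in> Obj \<C>; E \<in> Obj \<C>\<rbrakk> \<Longrightarrow>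
        \<partial>\<^sup>R A B (C \<^bold>\<oplus> E) \<Zcomp> (\<one> A \<oplus> \<partial>\<^sup>L B C E) \<Zcomp> a\<^sub>\<oplus> A (B \<^bold>\<otimes> C) E =
        \<partial>\<^sup>L (A \<^bold>\<oplus> B) C E \<Zcomp> (\<partial>\<^sup>R A B C \<oplus> \<one> E)"

text \<open>Symmetries are kept in a separate record, so that an LDC carries no symmetry unless one is
  supplied.\<close>

record ('o, 'a) symmetry =
  sym_tensor :: "'o \<Rightarrow> 'o \<Rightarrow> 'a" ("c\<^sub>\<otimes>\<index>")
  sym_par :: "'o \<Rightarrow> 'o \<Rightarrow> 'a" ("c\<^sub>\<oplus>\<index>")

locale symmetric_ldc =
  ldc \<C> +
  tensor: symmetric_monoidal \<C> "tensor_obj \<C>" "tensor \<C>" "\<top>\<^bsub>\<C>\<^esub>" "a\<^sub>\<otimes>\<^bsub>\<C>\<^esub>"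
    "u\<^sub>\<otimes>\<^sup>L\<^bsub>\<C>\<^esub>" "u\<^sub>\<otimes>\<^sup>R\<^bsub>\<C>\<^esub>" "c\<^sub>\<otimes>\<^bsub>\<S>\<^esub>" +
  par: symmetric_monoidal \<C> "par_obj \<C>" "par \<C>" "\<bottom>\<^bsub>\<C>\<^esub>" "a\<^sub>\<oplus>\<^bsub>\<C>\<^esub>"
    "u\<^sub>\<oplus>\<^sup>L\<^bsub>\<C>\<^esub>" "u\<^sub>\<oplus>\<^sup>R\<^bsub>\<C>\<^esub>" "c\<^sub>\<oplus>\<^bsub>\<S>\<^esub>"
  for \<C> :: "('o, 'a, 'x) ldc_data_scheme" (structure) and \<S> :: "('o, 'a) symmetry" +
  assumes distR_distL:
      "\<lbrakk>A \<in> Obj \<C>; B \<in> Obj \<C>; C \<in> Obj \<C>\<rbrakk> \<Longrightarrow>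
        \<partial>\<^sup>R A B C = c\<^sub>\<otimes>\<^bsub>\<S>\<^esub> (A \<^bold>\<oplus> B) C \<Zcomp> (\<one> C \<otimes> c\<^sub>\<oplus>\<^bsub>\<S>\<^esub> A B) \<Zcomp> \<partial>\<^sup>L C B A
          \<Zcomp> (c\<^sub>\<otimes>\<^bsub>\<S>\<^esub> C B \<oplus> \<one> A) \<Zcomp> c\<^sub>\<oplus>\<^bsub>\<S>\<^esub> (B \<^bold>\<otimes> C) A"

record ('o, 'a) isomix_data = "('o, 'a) ldc_data" +
  mix :: 'a ("\<m>\<index>")

definition mx :: "('o, 'a, 'x) isomix_data_scheme \<Rightarrow> 'o \<Rightarrow> 'o \<Rightarrow> 'a" ("mx\<index>") where
  "mx\<^bsub>\<C>\<^esub> A B =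
     (\<one>\<^bsub>\<C>\<^esub> A \<otimes>\<^bsub>\<C>\<^esub> inv\<^bsub>\<C>\<^esub> (u\<^sub>\<oplus>\<^sup>L\<^bsub>\<C>\<^esub> B)) \<Zcomp>\<^bsub>\<C>\<^esub> (\<one>\<^bsub>\<C>\<^esub> A \<otimes>\<^bsub>\<C>\<^esub> (\<m>\<^bsub>\<C>\<^esub> \<oplus>\<^bsub>\<C>\<^esub> \<one>\<^bsub>\<C>\<^esub> B))
       \<Zcomp>\<^bsub>\<C>\<^esub> \<partial>\<^sup>L\<^bsub>\<C>\<^esub> A \<top>\<^bsub>\<C>\<^esub> B \<Zcomp>\<^bsub>\<C>\<^esub> (u\<^sub>\<otimes>\<^sup>R\<^bsub>\<C>\<^esub> A \<oplus>\<^bsub>\<C>\<^esub> \<one>\<^bsub>\<C>\<^esub> B)"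

locale isomix_category = ldc \<C> for \<C> :: "('o, 'a, 'x) isomix_data_scheme" (structure) +
  assumes mix_iso: "\<m> \<in> isos \<C> \<bottom> \<top>"

locale symmetric_isomix_category = isomix_category \<C> + symmetric_ldc \<C> \<S>
  for \<C> :: "('o, 'a, 'x) isomix_data_scheme" and \<S> :: "('o, 'a) symmetry"

definition core :: "('o, 'a, 'x) isomix_data_scheme \<Rightarrow> 'o set" where
  "core \<C> = {U \<in> Obj \<C>. \<forall>X \<in> Obj \<C>.
     mx\<^bsub>\<C>\<^esub> U X \<in> isos \<C> (U \<^bold>\<otimes>\<^bsub>\<C>\<^esub> X) (U \<^bold>\<oplus>\<^bsub>\<C>\<^esub> X) \<and> mx\<^bsub>\<C>\<^esub> X U \<in> isos \<C> (X \<^bold>\<otimes>\<^bsub>\<C>\<^esub> U) (X \<^bold>\<oplus>\<^bsub>\<C>\<^esub> U)}"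

record ('o, 'a) dagger_data = "('o, 'a) isomix_data" +
  dag_obj :: "'o \<Rightarrow> 'o" ("_\<^bold>\<dagger>\<index>" [1000] 1000)
  dag :: "'a \<Rightarrow> 'a" ("_\<dagger>\<index>" [1000] 1000)
  lam_tensor :: "'o \<Rightarrow> 'o \<Rightarrow> 'a" ("\<lambda>\<^sub>\<otimes>\<index>")
  lam_par :: "'o \<Rightarrow> 'o \<Rightarrow> 'a" ("\<lambda>\<^sub>\<oplus>\<index>")
  lam_top :: 'a ("\<lambda>\<^sub>\<top>\<index>")
  lam_bot :: 'a ("\<lambda>\<^sub>\<bottom>\<index>")
  iota :: "'o \<Rightarrow> 'a" ("\<iota>\<index>")

locale dagger_ldc = ldc \<C> for \<C> :: "('o, 'a, 'x) dagger_data_scheme" (structure) +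
  assumes dag_Obj: "A \<in> Obj \<C> \<Longrightarrow> A\<^bold>\<dagger> \<in> Obj \<C>"
    and dag_hom: "f \<in> hom \<C> A B \<Longrightarrow> f\<dagger> \<in> hom \<C> (B\<^bold>\<dagger>) (A\<^bold>\<dagger>)"
    and dag_Ident: "A \<in> Obj \<C> \<Longrightarrow> (\<one> A)\<dagger> = \<one> (A\<^bold>\<dagger>)"
    and dag_Comp: "\<lbrakk>f \<in> hom \<C> A B; g \<in> hom \<C> B C\<rbrakk> \<Longrightarrow> (f \<Zcomp> g)\<dagger> = g\<dagger> \<Zcomp> f\<dagger>"
    and lam_tensor_iso:
      "\<lbrakk>A \<in> Obj \<C>; B \<in> Obj \<C>\<rbrakk> \<Longrightarrow> \<lambda>\<^sub>\<otimes> A B \<in> isos \<C> (A\<^bold>\<dagger> \<^bold>\<otimes> B\<^bold>\<dagger>) ((A \<^bold>\<oplus> B)\<^bold>\<dagger>)"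
    and lam_par_iso:
      "\<lbrakk>A \<in> Obj \<C>; B \<in> Obj \<C>\<rbrakk> \<Longrightarrow> \<lambda>\<^sub>\<oplus> A B \<in> isos \<C> (A\<^bold>\<dagger> \<^bold>\<oplus> B\<^bold>\<dagger>) ((A \<^bold>\<otimes> B)\<^bold>\<dagger>)"
    and lam_top_iso: "\<lambda>\<^sub>\<top> \<in> isos \<C> \<top> (\<bottom>\<^bold>\<dagger>)"
    and lam_bot_iso: "\<lambda>\<^sub>\<bottom> \<in> isos \<C> \<bottom> (\<top>\<^bold>\<dagger>)"
    and iota_iso: "A \<in> Obj \<C> \<Longrightarrow> \<iota> A \<in> isos \<C> A (A\<^bold>\<dagger>\<^bold>\<dagger>)"
    and lam_tensor_natural:
      "\<lbrakk>f \<in> hom \<C> A A'; g \<in> hom \<C> B B'\<rbrakk> \<Longrightarrow>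
        (f\<dagger> \<otimes> g\<dagger>) \<Zcomp> \<lambda>\<^sub>\<otimes> A B = \<lambda>\<^sub>\<otimes> A' B' \<Zcomp> (f \<oplus> g)\<dagger>"
    and lam_par_natural:
      "\<lbrakk>f \<in> hom \<C> A A'; g \<in> hom \<C> B B'\<rbrakk> \<Longrightarrow>
        (f\<dagger> \<oplus> g\<dagger>) \<Zcomp> \<lambda>\<^sub>\<oplus> A B = \<lambda>\<^sub>\<oplus> A' B' \<Zcomp> (f \<otimes> g)\<dagger>"
    and iota_natural: "f \<in> hom \<C> A B \<Longrightarrow> f \<Zcomp> \<iota> B = \<iota> A \<Zcomp> f\<dagger>\<dagger>"
    and lam_tensor_assoc:
      "\<lbrakk>A \<in> Obj \<C>; B \<in> Obj \<C>; C \<in> Obj \<C>\<rbrakk> \<Longrightarrow>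
        a\<^sub>\<otimes> (A\<^bold>\<dagger>) (B\<^bold>\<dagger>) (C\<^bold>\<dagger>) \<Zcomp> (\<lambda>\<^sub>\<otimes> A B \<otimes> \<one> (C\<^bold>\<dagger>)) \<Zcomp> \<lambda>\<^sub>\<otimes> (A \<^bold>\<oplus> B) C =
        (\<one> (A\<^bold>\<dagger>) \<otimes> \<lambda>\<^sub>\<otimes> B C) \<Zcomp> \<lambda>\<^sub>\<otimes> A (B \<^bold>\<oplus> C) \<Zcomp> (inv (a\<^sub>\<oplus> A B C))\<dagger>"
    and lam_par_assoc:
      "\<lbrakk>A \<in> Obj \<C>; B \<in> Obj \<C>; C \<in> Obj \<C>\<rbrakk> \<Longrightarrow>
        a\<^sub>\<oplus> (A\<^bold>\<dagger>) (B\<^bold>\<dagger>) (C\<^bold>\<dagger>) \<Zcomp> (\<lambda>\<^sub>\<oplus> A B \<oplus> \<one> (C\<^bold>\<dagger>)) \<Zcomp> \<lambda>\<^sub>\<oplus> (A \<^bold>\<otimes> B) C =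
        (\<one> (A\<^bold>\<dagger>) \<oplus> \<lambda>\<^sub>\<oplus> B C) \<Zcomp> \<lambda>\<^sub>\<oplus> A (B \<^bold>\<otimes> C) \<Zcomp> (inv (a\<^sub>\<otimes> A B C))\<dagger>"
    and lam_tensor_uL:
      "A \<in> Obj \<C> \<Longrightarrow> (\<lambda>\<^sub>\<top> \<otimes> \<one> (A\<^bold>\<dagger>)) \<Zcomp> \<lambda>\<^sub>\<otimes> \<bottom> A = u\<^sub>\<otimes>\<^sup>L (A\<^bold>\<dagger>) \<Zcomp> (u\<^sub>\<oplus>\<^sup>L A)\<dagger>"
    and lam_tensor_uR:
      "A \<in> Obj \<C> \<Longrightarrow> (\<one> (A\<^bold>\<dagger>) \<otimes> \<lambda>\<^sub>\<top>) \<Zcomp> \<lambda>\<^sub>\<otimes> A \<bottom> = u\<^sub>\<otimes>\<^sup>R (A\<^bold>\<dagger>) \<Zcomp> (u\<^sub>\<oplus>\<^sup>R A)\<dagger>"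
    and lam_par_uL:
      "A \<in> Obj \<C> \<Longrightarrow> (\<lambda>\<^sub>\<bottom> \<oplus> \<one> (A\<^bold>\<dagger>)) \<Zcomp> \<lambda>\<^sub>\<oplus> \<top> A = u\<^sub>\<oplus>\<^sup>L (A\<^bold>\<dagger>) \<Zcomp> (u\<^sub>\<otimes>\<^sup>L A)\<dagger>"
    and lam_par_uR:
      "A \<in> Obj \<C> \<Longrightarrow> (\<one> (A\<^bold>\<dagger>) \<oplus> \<lambda>\<^sub>\<bottom>) \<Zcomp> \<lambda>\<^sub>\<oplus> A \<top> = u\<^sub>\<oplus>\<^sup>R (A\<^bold>\<dagger>) \<Zcomp> (u\<^sub>\<otimes>\<^sup>R A)\<dagger>"
    and lam_distL:
      "\<lbrakk>A \<in> Obj \<C>; B \<in> Obj \<C>; C \<in> Obj \<C>\<rbrakk> \<Longrightarrow>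
        \<partial>\<^sup>L (A\<^bold>\<dagger>) (B\<^bold>\<dagger>) (C\<^bold>\<dagger>) \<Zcomp> (\<lambda>\<^sub>\<otimes> A B \<oplus> \<one> (C\<^bold>\<dagger>)) \<Zcomp> \<lambda>\<^sub>\<oplus> (A \<^bold>\<oplus> B) C =
        (\<one> (A\<^bold>\<dagger>) \<otimes> \<lambda>\<^sub>\<oplus> B C) \<Zcomp> \<lambda>\<^sub>\<otimes> A (B \<^bold>\<otimes> C) \<Zcomp> (\<partial>\<^sup>R A B C)\<dagger>"
    and lam_distR:
      "\<lbrakk>A \<in> Obj \<C>; B \<in> Obj \<C>; C \<in> Obj \<C>\<rbrakk> \<Longrightarrow>
        \<partial>\<^sup>R (A\<^bold>\<dagger>) (B\<^bold>\<dagger>) (C\<^bold>\<dagger>) \<Zcomp> (\<one> (A\<^bold>\<dagger>) \<oplus> \<lambda>\<^sub>\<otimes> B C) \<Zcomp> \<lambda>\<^sub>\<oplus> A (B \<^bold>\<oplus> C) =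
        (\<lambda>\<^sub>\<oplus> A B \<otimes> \<one> (C\<^bold>\<dagger>)) \<Zcomp> \<lambda>\<^sub>\<otimes> (A \<^bold>\<otimes> B) C \<Zcomp> (\<partial>\<^sup>L A B C)\<dagger>"
    and iota_par:
      "\<lbrakk>A \<in> Obj \<C>; B \<in> Obj \<C>\<rbrakk> \<Longrightarrow>
        \<iota> (A \<^bold>\<oplus> B) \<Zcomp> (\<lambda>\<^sub>\<otimes> A B)\<dagger> = (\<iota> A \<oplus> \<iota> B) \<Zcomp> \<lambda>\<^sub>\<oplus> (A\<^bold>\<dagger>) (B\<^bold>\<dagger>)"
    and iota_tensor:
      "\<lbrakk>A \<in> Obj \<C>; B \<in> Obj \<C>\<rbrakk> \<Longrightarrow>
        \<iota> (A \<^bold>\<otimes> B) \<Zcomp> (\<lambda>\<^sub>\<oplus> A B)\<dagger> = (\<iota> A \<otimes> \<iota> B) \<Zcomp> \<lambda>\<^sub>\<otimes> (A\<^bold>\<dagger>) (B\<^bold>\<dagger>)"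
    and iota_bot: "\<iota> \<bottom> \<Zcomp> \<lambda>\<^sub>\<top>\<dagger> = \<lambda>\<^sub>\<bottom>"
    and iota_top: "\<iota> \<top> \<Zcomp> \<lambda>\<^sub>\<bottom>\<dagger> = \<lambda>\<^sub>\<top>"
    and iota_dag: "A \<in> Obj \<C> \<Longrightarrow> \<iota> (A\<^bold>\<dagger>) = (inv (\<iota> A))\<dagger>"

locale dagger_isomix_category = dagger_ldc \<C> + isomix_category \<C>
  for \<C> :: "('o, 'a, 'x) dagger_data_scheme" (structure) +
  assumes mix_dag: "\<m> \<Zcomp> \<lambda>\<^sub>\<top> = \<lambda>\<^sub>\<bottom> \<Zcomp> \<m>\<dagger>"

locale symmetric_dagger_isomix_category =
  dagger_isomix_category \<C> + symmetric_isomix_category \<C> \<S>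
  for \<C> :: "('o, 'a, 'x) dagger_data_scheme" (structure) and \<S> :: "('o, 'a) symmetry" +
  assumes lam_tensor_sym:
      "\<lbrakk>A \<in> Obj \<C>; B \<in> Obj \<C>\<rbrakk> \<Longrightarrow>
        \<lambda>\<^sub>\<otimes> A B \<Zcomp> (c\<^sub>\<oplus>\<^bsub>\<S>\<^esub> B A)\<dagger> = c\<^sub>\<otimes>\<^bsub>\<S>\<^esub> (A\<^bold>\<dagger>) (B\<^bold>\<dagger>) \<Zcomp> \<lambda>\<^sub>\<otimes> B A"
    and lam_par_sym:
      "\<lbrakk>A \<in> Obj \<C>; B \<in> Obj \<C>\<rbrakk> \<Longrightarrow>
        \<lambda>\<^sub>\<oplus> A B \<Zcomp> (c\<^sub>\<otimes>\<^bsub>\<S>\<^esub> B A)\<dagger> = c\<^sub>\<oplus>\<^bsub>\<S>\<^esub> (A\<^bold>\<dagger>) (B\<^bold>\<dagger>) \<Zcomp> \<lambda>\<^sub>\<oplus> B A"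

record ('o, 'a) unitary_data = "('o, 'a) dagger_data" +
  phi :: "'o \<Rightarrow> 'a" ("\<phi>\<index>")

locale unitary_category = dagger_isomix_category \<U>
  for \<U> :: "('u, 'm, 'x) unitary_data_scheme" (structure) +
  assumes all_core: "A \<in> Obj \<U> \<Longrightarrow> A \<in> core \<U>"
    and phi_iso: "A \<in> Obj \<U> \<Longrightarrow> \<phi> A \<in> isos \<U> A (A\<^bold>\<dagger>)"
    and phi_dag: "A \<in> Obj \<U> \<Longrightarrow> \<phi> (A\<^bold>\<dagger>) = (inv (\<phi> A))\<dagger>"
    and phi_iota: "A \<in> Obj \<U> \<Longrightarrow> \<phi> A \<Zcomp> \<phi> (A\<^bold>\<dagger>) = \<iota> A"
    and phi_bot: "\<phi> \<bottom> \<Zcomp> inv \<lambda>\<^sub>\<top> = \<m>"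
    and phi_top: "\<m> = \<lambda>\<^sub>\<bottom> \<Zcomp> inv (\<phi> \<top>)"
    and phi_par:
      "\<lbrakk>A \<in> Obj \<U>; B \<in> Obj \<U>\<rbrakk> \<Longrightarrow>
        (\<phi> A \<otimes> \<phi> B) \<Zcomp> \<lambda>\<^sub>\<otimes> A B \<Zcomp> inv (\<phi> (A \<^bold>\<oplus> B)) = mx A B"
    and phi_tensor:
      "\<lbrakk>A \<in> Obj \<U>; B \<in> Obj \<U>\<rbrakk> \<Longrightarrow>
        mx A B = \<phi> (A \<^bold>\<otimes> B) \<Zcomp> inv (\<lambda>\<^sub>\<oplus> A B) \<Zcomp> (inv (\<phi> A) \<oplus> inv (\<phi> B))"

record ('o, 'a, 'p, 'b) fun_data =
  fobj :: "'o \<Rightarrow> 'p"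
  farr :: "'a \<Rightarrow> 'b"

locale functor_on = source: category \<C> + target: category \<D>
  for \<C> :: "('o, 'a, 'x) cat_scheme" and \<D> :: "('p, 'b, 'y) cat_scheme" +
  fixes F :: "('o, 'a, 'p, 'b, 'z) fun_data_scheme"
  assumes fobj_Obj: "A \<in> Obj \<C> \<Longrightarrow> fobj F A \<in> Obj \<D>"
    and farr_hom: "f \<in> hom \<C> A B \<Longrightarrow> farr F f \<in> hom \<D> (fobj F A) (fobj F B)"
    and farr_Ident: "A \<in> Obj \<C> \<Longrightarrow> farr F (\<one>\<^bsub>\<C>\<^esub> A) = \<one>\<^bsub>\<D>\<^esub> (fobj F A)"
    and farr_Comp:
      "\<lbrakk>f \<in> hom \<C> A B; g \<in> hom \<C> B C\<rbrakk> \<Longrightarrow> farr F (f \<Zcomp>\<^bsub>\<C>\<^esub> g) = farr F f \<Zcomp>\<^bsub>\<D>\<^esub> farr F g"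

definition mutually_inverse ::
  "('o, 'a, 'x) cat_scheme \<Rightarrow> ('p, 'b, 'y) cat_scheme \<Rightarrow>
   ('o, 'a, 'p, 'b, 'z) fun_data_scheme \<Rightarrow> ('p, 'b, 'o, 'a, 'w) fun_data_scheme \<Rightarrow> bool" where
  "mutually_inverse \<C> \<D> F G \<longleftrightarrow>
     (\<forall>A \<in> Obj \<C>. fobj G (fobj F A) = A) \<and> (\<forall>f \<in> Arr \<C>. farr G (farr F f) = f) \<and>
     (\<forall>B \<in> Obj \<D>. fobj F (fobj G B) = B) \<and> (\<forall>g \<in> Arr \<D>. farr F (farr G g) = g)"

definition isomorphic_categories ::
  "('o, 'a, 'x) cat_scheme \<Rightarrow> ('p, 'b, 'y) cat_scheme \<Rightarrow> bool" where
  "isomorphic_categories \<C> \<D> \<longleftrightarrow>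
     (\<exists>(F :: ('o, 'a, 'p, 'b) fun_data) (G :: ('p, 'b, 'o, 'a) fun_data).
        functor_on \<C> \<D> F \<and> functor_on \<D> \<C> G \<and> mutually_inverse \<C> \<D> F G)"

record ('o, 'a, 'p, 'b) isomix_fun_data = "('o, 'a, 'p, 'b) fun_data" +
  m_tensor :: "'o \<Rightarrow> 'o \<Rightarrow> 'b"
  m_top :: 'b
  n_par :: "'o \<Rightarrow> 'o \<Rightarrow> 'b"
  n_bot :: 'b

locale isomix_functor =
  source: isomix_category \<C> + target: isomix_category \<D> + functor_on \<C> \<D> F
  for \<C> :: "('o, 'a, 'x) isomix_data_scheme" and \<D> :: "('p, 'b, 'y) isomix_data_scheme"
    and F :: "('o, 'a, 'p, 'b, 'z) isomix_fun_data_scheme" +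
  assumes m_tensor_hom:
      "\<lbrakk>A \<in> Obj \<C>; B \<in> Obj \<C>\<rbrakk> \<Longrightarrow>
        m_tensor F A B \<in> hom \<D> (fobj F A \<^bold>\<otimes>\<^bsub>\<D>\<^esub> fobj F B) (fobj F (A \<^bold>\<otimes>\<^bsub>\<C>\<^esub> B))"
    and m_top_hom: "m_top F \<in> hom \<D> \<top>\<^bsub>\<D>\<^esub> (fobj F \<top>\<^bsub>\<C>\<^esub>)"
    and n_par_hom:
      "\<lbrakk>A \<in> Obj \<C>; B \<in> Obj \<C>\<rbrakk> \<Longrightarrow>
        n_par F A B \<in> hom \<D> (fobj F (A \<^bold>\<oplus>\<^bsub>\<C>\<^esub> B)) (fobj F A \<^bold>\<oplus>\<^bsub>\<D>\<^esub> fobj F B)"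
    and n_bot_hom: "n_bot F \<in> hom \<D> (fobj F \<bottom>\<^bsub>\<C>\<^esub>) \<bottom>\<^bsub>\<D>\<^esub>"
    and m_tensor_natural:
      "\<lbrakk>f \<in> hom \<C> A A'; g \<in> hom \<C> B B'\<rbrakk> \<Longrightarrow>
        (farr F f \<otimes>\<^bsub>\<D>\<^esub> farr F g) \<Zcomp>\<^bsub>\<D>\<^esub> m_tensor F A' B' =
        m_tensor F A B \<Zcomp>\<^bsub>\<D>\<^esub> farr F (f \<otimes>\<^bsub>\<C>\<^esub> g)"
    and n_par_natural:
      "\<lbrakk>f \<in> hom \<C> A A'; g \<in> hom \<C> B B'\<rbrakk> \<Longrightarrow>
        farr F (f \<oplus>\<^bsub>\<C>\<^esub> g) \<Zcomp>\<^bsub>\<D>\<^esub> n_par F A' B' =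
        n_par F A B \<Zcomp>\<^bsub>\<D>\<^esub> (farr F f \<oplus>\<^bsub>\<D>\<^esub> farr F g)"
    and m_tensor_assoc:
      "\<lbrakk>A \<in> Obj \<C>; B \<in> Obj \<C>; C \<in> Obj \<C>\<rbrakk> \<Longrightarrow>
        (\<one>\<^bsub>\<D>\<^esub> (fobj F A) \<otimes>\<^bsub>\<D>\<^esub> m_tensor F B C) \<Zcomp>\<^bsub>\<D>\<^esub> m_tensor F A (B \<^bold>\<otimes>\<^bsub>\<C>\<^esub> C)
          \<Zcomp>\<^bsub>\<D>\<^esub> farr F (a\<^sub>\<otimes>\<^bsub>\<C>\<^esub> A B C) =
        a\<^sub>\<otimes>\<^bsub>\<D>\<^esub> (fobj F A) (fobj F B) (fobj F C)
          \<Zcomp>\<^bsub>\<D>\<^esub> (m_tensor F A B \<otimes>\<^bsub>\<D>\<^esub> \<one>\<^bsub>\<D>\<^esub> (fobj F C)) \<Zcomp>\<^bsub>\<D>\<^esub> m_tensor F (A \<^bold>\<otimes>\<^bsub>\<C>\<^esub> B) C"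
    and m_tensor_uL:
      "A \<in> Obj \<C> \<Longrightarrow>
        (m_top F \<otimes>\<^bsub>\<D>\<^esub> \<one>\<^bsub>\<D>\<^esub> (fobj F A)) \<Zcomp>\<^bsub>\<D>\<^esub> m_tensor F \<top>\<^bsub>\<C>\<^esub> A \<Zcomp>\<^bsub>\<D>\<^esub> farr F (u\<^sub>\<otimes>\<^sup>L\<^bsub>\<C>\<^esub> A) =
        u\<^sub>\<otimes>\<^sup>L\<^bsub>\<D>\<^esub> (fobj F A)"
    and m_tensor_uR:
      "A \<in> Obj \<C> \<Longrightarrow>
        (\<one>\<^bsub>\<D>\<^esub> (fobj F A) \<otimes>\<^bsub>\<D>\<^esub> m_top F) \<Zcomp>\<^bsub>\<D>\<^esub> m_tensor F A \<top>\<^bsub>\<C>\<^esub> \<Zcomp>\<^bsub>\<D>\<^esub> farr F (u\<^sub>\<otimes>\<^sup>R\<^bsub>\<C>\<^esub> A) =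
        u\<^sub>\<otimes>\<^sup>R\<^bsub>\<D>\<^esub> (fobj F A)"
    and n_par_assoc:
      "\<lbrakk>A \<in> Obj \<C>; B \<in> Obj \<C>; C \<in> Obj \<C>\<rbrakk> \<Longrightarrow>
        farr F (a\<^sub>\<oplus>\<^bsub>\<C>\<^esub> A B C) \<Zcomp>\<^bsub>\<D>\<^esub> n_par F (A \<^bold>\<oplus>\<^bsub>\<C>\<^esub> B) C
          \<Zcomp>\<^bsub>\<D>\<^esub> (n_par F A B \<oplus>\<^bsub>\<D>\<^esub> \<one>\<^bsub>\<D>\<^esub> (fobj F C)) =
        n_par F A (B \<^bold>\<oplus>\<^bsub>\<C>\<^esub> C) \<Zcomp>\<^bsub>\<D>\<^esub> (\<one>\<^bsub>\<D>\<^esub> (fobj F A) \<oplus>\<^bsub>\<D>\<^esub> n_par F B C)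
          \<Zcomp>\<^bsub>\<D>\<^esub> a\<^sub>\<oplus>\<^bsub>\<D>\<^esub> (fobj F A) (fobj F B) (fobj F C)"
    and n_par_uL:
      "A \<in> Obj \<C> \<Longrightarrow>
        n_par F \<bottom>\<^bsub>\<C>\<^esub> A \<Zcomp>\<^bsub>\<D>\<^esub> (n_bot F \<oplus>\<^bsub>\<D>\<^esub> \<one>\<^bsub>\<D>\<^esub> (fobj F A)) \<Zcomp>\<^bsub>\<D>\<^esub> u\<^sub>\<oplus>\<^sup>L\<^bsub>\<D>\<^esub> (fobj F A) =
        farr F (u\<^sub>\<oplus>\<^sup>L\<^bsub>\<C>\<^esub> A)"
    and n_par_uR:
      "A \<in> Obj \<C> \<Longrightarrow>
        n_par F A \<bottom>\<^bsub>\<C>\<^esub> \<Zcomp>\<^bsub>\<D>\<^esub> (\<one>\<^bsub>\<D>\<^esub> (fobj F A) \<oplus>\<^bsub>\<D>\<^esub> n_bot F) \<Zcomp>\<^bsub>\<D>\<^esub> u\<^sub>\<oplus>\<^sup>R\<^bsub>\<D>\<^esub> (fobj F A) =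
        farr F (u\<^sub>\<oplus>\<^sup>R\<^bsub>\<C>\<^esub> A)"
    and frobenius_L:
      "\<lbrakk>A \<in> Obj \<C>; B \<in> Obj \<C>; C \<in> Obj \<C>\<rbrakk> \<Longrightarrow>
        m_tensor F A (B \<^bold>\<oplus>\<^bsub>\<C>\<^esub> C) \<Zcomp>\<^bsub>\<D>\<^esub> farr F (\<partial>\<^sup>L\<^bsub>\<C>\<^esub> A B C) \<Zcomp>\<^bsub>\<D>\<^esub> n_par F (A \<^bold>\<otimes>\<^bsub>\<C>\<^esub> B) C =
        (\<one>\<^bsub>\<D>\<^esub> (fobj F A) \<otimes>\<^bsub>\<D>\<^esub> n_par F B C) \<Zcomp>\<^bsub>\<D>\<^esub> \<partial>\<^sup>L\<^bsub>\<D>\<^esub> (fobj F A) (fobj F B) (fobj F C)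
          \<Zcomp>\<^bsub>\<D>\<^esub> (m_tensor F A B \<oplus>\<^bsub>\<D>\<^esub> \<one>\<^bsub>\<D>\<^esub> (fobj F C))"
    and frobenius_R:
      "\<lbrakk>A \<in> Obj \<C>; B \<in> Obj \<C>; C \<in> Obj \<C>\<rbrakk> \<Longrightarrow>
        m_tensor F (A \<^bold>\<oplus>\<^bsub>\<C>\<^esub> B) C \<Zcomp>\<^bsub>\<D>\<^esub> farr F (\<partial>\<^sup>R\<^bsub>\<C>\<^esub> A B C) \<Zcomp>\<^bsub>\<D>\<^esub> n_par F A (B \<^bold>\<otimes>\<^bsub>\<C>\<^esub> C) =
        (n_par F A B \<otimes>\<^bsub>\<D>\<^esub> \<one>\<^bsub>\<D>\<^esub> (fobj F C)) \<Zcomp>\<^bsub>\<D>\<^esub> \<partial>\<^sup>R\<^bsub>\<D>\<^esub> (fobj F A) (fobj F B) (fobj F C)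
          \<Zcomp>\<^bsub>\<D>\<^esub> (\<one>\<^bsub>\<D>\<^esub> (fobj F A) \<oplus>\<^bsub>\<D>\<^esub> m_tensor F B C)"
    and farr_mix: "farr F \<m>\<^bsub>\<C>\<^esub> = n_bot F \<Zcomp>\<^bsub>\<D>\<^esub> \<m>\<^bsub>\<D>\<^esub> \<Zcomp>\<^bsub>\<D>\<^esub> m_top F"
    and inv_mix: "inv\<^bsub>\<D>\<^esub> \<m>\<^bsub>\<D>\<^esub> = m_top F \<Zcomp>\<^bsub>\<D>\<^esub> farr F (inv\<^bsub>\<C>\<^esub> \<m>\<^bsub>\<C>\<^esub>) \<Zcomp>\<^bsub>\<D>\<^esub> n_bot F"

locale strong_isomix_functor = isomix_functor \<C> \<D> F
  for \<C> :: "('o, 'a, 'x) isomix_data_scheme" and \<D> :: "('p, 'b, 'y) isomix_data_scheme"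
    and F :: "('o, 'a, 'p, 'b, 'z) isomix_fun_data_scheme" +
  assumes m_tensor_iso:
      "\<lbrakk>A \<in> Obj \<C>; B \<in> Obj \<C>\<rbrakk> \<Longrightarrow>
        m_tensor F A B \<in> isos \<D> (fobj F A \<^bold>\<otimes>\<^bsub>\<D>\<^esub> fobj F B) (fobj F (A \<^bold>\<otimes>\<^bsub>\<C>\<^esub> B))"
    and m_top_iso: "m_top F \<in> isos \<D> \<top>\<^bsub>\<D>\<^esub> (fobj F \<top>\<^bsub>\<C>\<^esub>)"
    and n_par_iso:
      "\<lbrakk>A \<in> Obj \<C>; B \<in> Obj \<C>\<rbrakk> \<Longrightarrow>
        n_par F A B \<in> isos \<D> (fobj F (A \<^bold>\<oplus>\<^bsub>\<C>\<^esub> B)) (fobj F A \<^bold>\<oplus>\<^bsub>\<D>\<^esub> fobj F B)"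
    and n_bot_iso: "n_bot F \<in> isos \<D> (fobj F \<bottom>\<^bsub>\<C>\<^esub>) \<bottom>\<^bsub>\<D>\<^esub>"

text \<open>Together with the typing assumptions of \<^locale>\<open>isomix_functor\<close>, the following forces
  \<open>F\<close> to preserve tensor, par and units on objects on the nose.\<close>

locale strict_isomix_functor = isomix_functor \<C> \<D> F
  for \<C> :: "('o, 'a, 'x) isomix_data_scheme" and \<D> :: "('p, 'b, 'y) isomix_data_scheme"
    and F :: "('o, 'a, 'p, 'b, 'z) isomix_fun_data_scheme" +
  assumes m_tensor_strict:
      "\<lbrakk>A \<in> Obj \<C>; B \<in> Obj \<C>\<rbrakk> \<Longrightarrow> m_tensor F A B = \<one>\<^bsub>\<D>\<^esub> (fobj F A \<^bold>\<otimes>\<^bsub>\<D>\<^esub> fobj F B)"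
    and m_top_strict: "m_top F = \<one>\<^bsub>\<D>\<^esub> \<top>\<^bsub>\<D>\<^esub>"
    and n_par_strict:
      "\<lbrakk>A \<in> Obj \<C>; B \<in> Obj \<C>\<rbrakk> \<Longrightarrow> n_par F A B = \<one>\<^bsub>\<D>\<^esub> (fobj F A \<^bold>\<oplus>\<^bsub>\<D>\<^esub> fobj F B)"
    and n_bot_strict: "n_bot F = \<one>\<^bsub>\<D>\<^esub> \<bottom>\<^bsub>\<D>\<^esub>"

locale symmetric_isomix_functor =
  source: symmetric_isomix_category \<C> \<S> + target: symmetric_isomix_category \<D> \<T> +
  isomix_functor \<C> \<D> F
  for \<C> :: "('o, 'a, 'x) isomix_data_scheme" and \<S> :: "('o, 'a) symmetry"
    and \<D> :: "('p, 'b, 'y) isomix_data_scheme" and \<T> :: "('p, 'b) symmetry"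
    and F :: "('o, 'a, 'p, 'b, 'z) isomix_fun_data_scheme" +
  assumes m_tensor_sym:
      "\<lbrakk>A \<in> Obj \<C>; B \<in> Obj \<C>\<rbrakk> \<Longrightarrow>
        c\<^sub>\<otimes>\<^bsub>\<T>\<^esub> (fobj F A) (fobj F B) \<Zcomp>\<^bsub>\<D>\<^esub> m_tensor F B A =
        m_tensor F A B \<Zcomp>\<^bsub>\<D>\<^esub> farr F (c\<^sub>\<otimes>\<^bsub>\<S>\<^esub> A B)"
    and n_par_sym:
      "\<lbrakk>A \<in> Obj \<C>; B \<in> Obj \<C>\<rbrakk> \<Longrightarrow>
        farr F (c\<^sub>\<oplus>\<^bsub>\<S>\<^esub> A B) \<Zcomp>\<^bsub>\<D>\<^esub> n_par F B A =
        n_par F A B \<Zcomp>\<^bsub>\<D>\<^esub> c\<^sub>\<oplus>\<^bsub>\<T>\<^esub> (fobj F A) (fobj F B)"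

definition isomorphic_symmetric_isomix ::
  "('o, 'a) isomix_data \<Rightarrow> ('o, 'a) symmetry \<Rightarrow> ('p, 'b) isomix_data \<Rightarrow> ('p, 'b) symmetry \<Rightarrow> bool"
  where
  "isomorphic_symmetric_isomix \<C> \<S> \<D> \<T> \<longleftrightarrow>
     (\<exists>(F :: ('o, 'a, 'p, 'b) isomix_fun_data) (G :: ('p, 'b, 'o, 'a) isomix_fun_data).
        strict_isomix_functor \<C> \<D> F \<and> symmetric_isomix_functor \<C> \<S> \<D> \<T> F \<and>
        strict_isomix_functor \<D> \<C> G \<and> symmetric_isomix_functor \<D> \<T> \<C> \<S> G \<and>
        mutually_inverse \<C> \<D> F G)"

definition isomix_fun_comp ::
  "('p, 'b, 'y) isomix_data_scheme \<Rightarrow> ('n, 'm, 'o, 'a, 'z) isomix_fun_data_scheme \<Rightarrow>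
   ('o, 'a, 'p, 'b, 'w) isomix_fun_data_scheme \<Rightarrow> ('n, 'm, 'p, 'b) isomix_fun_data" where
  "isomix_fun_comp \<D> M F =
     \<lparr>fobj = (\<lambda>U. fobj F (fobj M U)),
      farr = (\<lambda>f. farr F (farr M f)),
      m_tensor = (\<lambda>U V. m_tensor F (fobj M U) (fobj M V) \<Zcomp>\<^bsub>\<D>\<^esub> farr F (m_tensor M U V)),
      m_top = m_top F \<Zcomp>\<^bsub>\<D>\<^esub> farr F (m_top M),
      n_par = (\<lambda>U V. farr F (n_par M U V) \<Zcomp>\<^bsub>\<D>\<^esub> n_par F (fobj M U) (fobj M V)),
      n_bot = farr F (n_bot M) \<Zcomp>\<^bsub>\<D>\<^esub> n_bot F\<rparr>"

record ('o, 'a, 'p, 'b) dagger_fun_data = "('o, 'a, 'p, 'b) isomix_fun_data" +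
  rho :: "'o \<Rightarrow> 'b"

locale dagger_isomix_functor =
  source: dagger_isomix_category \<C> + target: dagger_isomix_category \<D> + isomix_functor \<C> \<D> F
  for \<C> :: "('o, 'a, 'x) dagger_data_scheme" and \<D> :: "('p, 'b, 'y) dagger_data_scheme"
    and F :: "('o, 'a, 'p, 'b, 'z) dagger_fun_data_scheme" +
  assumes rho_iso: "A \<in> Obj \<C> \<Longrightarrow> rho F A \<in> isos \<D> (fobj F (A\<^bold>\<dagger>\<^bsub>\<C>\<^esub>)) ((fobj F A)\<^bold>\<dagger>\<^bsub>\<D>\<^esub>)"
    and rho_natural:
      "f \<in> hom \<C> A B \<Longrightarrow>
        farr F (f\<dagger>\<^bsub>\<C>\<^esub>) \<Zcomp>\<^bsub>\<D>\<^esub> rho F A = rho F B \<Zcomp>\<^bsub>\<D>\<^esub> (farr F f)\<dagger>\<^bsub>\<D>\<^esub>"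
    and rho_tensor:
      "\<lbrakk>A \<in> Obj \<C>; B \<in> Obj \<C>\<rbrakk> \<Longrightarrow>
        m_tensor F (A\<^bold>\<dagger>\<^bsub>\<C>\<^esub>) (B\<^bold>\<dagger>\<^bsub>\<C>\<^esub>) \<Zcomp>\<^bsub>\<D>\<^esub> farr F (\<lambda>\<^sub>\<otimes>\<^bsub>\<C>\<^esub> A B) \<Zcomp>\<^bsub>\<D>\<^esub> rho F (A \<^bold>\<oplus>\<^bsub>\<C>\<^esub> B) =
        (rho F A \<otimes>\<^bsub>\<D>\<^esub> rho F B) \<Zcomp>\<^bsub>\<D>\<^esub> \<lambda>\<^sub>\<otimes>\<^bsub>\<D>\<^esub> (fobj F A) (fobj F B) \<Zcomp>\<^bsub>\<D>\<^esub> (n_par F A B)\<dagger>\<^bsub>\<D>\<^esub>"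
    and rho_top:
      "m_top F \<Zcomp>\<^bsub>\<D>\<^esub> farr F \<lambda>\<^sub>\<top>\<^bsub>\<C>\<^esub> \<Zcomp>\<^bsub>\<D>\<^esub> rho F \<bottom>\<^bsub>\<C>\<^esub> = \<lambda>\<^sub>\<top>\<^bsub>\<D>\<^esub> \<Zcomp>\<^bsub>\<D>\<^esub> (n_bot F)\<dagger>\<^bsub>\<D>\<^esub>"
    and rho_par:
      "\<lbrakk>A \<in> Obj \<C>; B \<in> Obj \<C>\<rbrakk> \<Longrightarrow>
        farr F (\<lambda>\<^sub>\<oplus>\<^bsub>\<C>\<^esub> A B) \<Zcomp>\<^bsub>\<D>\<^esub> rho F (A \<^bold>\<otimes>\<^bsub>\<C>\<^esub> B) \<Zcomp>\<^bsub>\<D>\<^esub> (m_tensor F A B)\<dagger>\<^bsub>\<D>\<^esub> =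
        n_par F (A\<^bold>\<dagger>\<^bsub>\<C>\<^esub>) (B\<^bold>\<dagger>\<^bsub>\<C>\<^esub>) \<Zcomp>\<^bsub>\<D>\<^esub> (rho F A \<oplus>\<^bsub>\<D>\<^esub> rho F B) \<Zcomp>\<^bsub>\<D>\<^esub> \<lambda>\<^sub>\<oplus>\<^bsub>\<D>\<^esub> (fobj F A) (fobj F B)"
    and rho_bot:
      "farr F \<lambda>\<^sub>\<bottom>\<^bsub>\<C>\<^esub> \<Zcomp>\<^bsub>\<D>\<^esub> rho F \<top>\<^bsub>\<C>\<^esub> \<Zcomp>\<^bsub>\<D>\<^esub> (m_top F)\<dagger>\<^bsub>\<D>\<^esub> = n_bot F \<Zcomp>\<^bsub>\<D>\<^esub> \<lambda>\<^sub>\<bottom>\<^bsub>\<D>\<^esub>"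
    and rho_iota:
      "A \<in> Obj \<C> \<Longrightarrow>
        \<iota>\<^bsub>\<D>\<^esub> (fobj F A) \<Zcomp>\<^bsub>\<D>\<^esub> (rho F A)\<dagger>\<^bsub>\<D>\<^esub> = farr F (\<iota>\<^bsub>\<C>\<^esub> A) \<Zcomp>\<^bsub>\<D>\<^esub> rho F (A\<^bold>\<dagger>\<^bsub>\<C>\<^esub>)"

locale mixed_unitary_category =
  source: unitary_category \<U> + target: dagger_isomix_category \<C> +
  strong_isomix_functor \<U> \<C> M + dagger_isomix_functor \<U> \<C> M
  for \<U> :: "('u, 'm, 'x) unitary_data_scheme" and \<C> :: "('o, 'a, 'y) dagger_data_scheme"
    and M :: "('u, 'm, 'o, 'a, 'z) dagger_fun_data_scheme" +
  assumes mx_left_iso: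
      "\<lbrakk>U \<in> Obj \<U>; X \<in> Obj \<C>\<rbrakk> \<Longrightarrow>
        mx\<^bsub>\<C>\<^esub> (fobj M U) X \<in> isos \<C> (fobj M U \<^bold>\<otimes>\<^bsub>\<C>\<^esub> X) (fobj M U \<^bold>\<oplus>\<^bsub>\<C>\<^esub> X)"
    and mx_right_iso:
      "\<lbrakk>U \<in> Obj \<U>; X \<in> Obj \<C>\<rbrakk> \<Longrightarrow>
        mx\<^bsub>\<C>\<^esub> X (fobj M U) \<in> isos \<C> (X \<^bold>\<otimes>\<^bsub>\<C>\<^esub> fobj M U) (X \<^bold>\<oplus>\<^bsub>\<C>\<^esub> fobj M U)"

locale symmetric_mixed_unitary_category =
  mixed_unitary_category \<U> \<C> M +
  source: symmetric_dagger_isomix_category \<U> \<R> +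
  target: symmetric_dagger_isomix_category \<C> \<S> +
  symmetric_isomix_functor \<U> \<R> \<C> \<S> M
  for \<U> :: "('u, 'm, 'x) unitary_data_scheme" and \<R> :: "('u, 'm) symmetry"
    and \<C> :: "('o, 'a, 'y) dagger_data_scheme" and \<S> :: "('o, 'a) symmetry"
    and M :: "('u, 'm, 'o, 'a, 'z) dagger_fun_data_scheme"

definition kraus_maps ::
  "('u, 'm, 'x) unitary_data_scheme \<Rightarrow> ('o, 'a, 'y) dagger_data_scheme \<Rightarrow>
   ('u, 'm, 'o, 'a, 'z) dagger_fun_data_scheme \<Rightarrow> 'o \<Rightarrow> 'o \<Rightarrow> ('a \<times> 'u) set" where
  "kraus_maps \<U> \<C> M A B = {(f, U). U \<in> Obj \<U> \<and> f \<in> hom \<C> A (fobj M U \<^bold>\<oplus>\<^bsub>\<C>\<^esub> B)}"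

text \<open>The arguments \<open>A B C W\<close> record \<open>f : A \<rightarrow> M(U) \<oplus> B\<close> and \<open>h : B \<otimes> C \<rightarrow> M(W)\<close>.\<close>

definition kraus_test ::
  "('u, 'm, 'x) unitary_data_scheme \<Rightarrow> ('o, 'a, 'y) dagger_data_scheme \<Rightarrow>
   ('u, 'm, 'o, 'a, 'z) dagger_fun_data_scheme \<Rightarrow> 'o \<Rightarrow> 'o \<Rightarrow> 'o \<Rightarrow> 'u \<Rightarrow> 'a \<Rightarrow> 'a \<times> 'u \<Rightarrow> 'a"
  where
  "kraus_test \<U> \<C> M A B C W h = (\<lambda>(f, U).
     (f \<otimes>\<^bsub>\<C>\<^esub> \<one>\<^bsub>\<C>\<^esub> C)
     \<Zcomp>\<^bsub>\<C>\<^esub> \<partial>\<^sup>R\<^bsub>\<C>\<^esub> (fobj M U) B C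
     \<Zcomp>\<^bsub>\<C>\<^esub> (\<one>\<^bsub>\<C>\<^esub> (fobj M U) \<oplus>\<^bsub>\<C>\<^esub> h)
     \<Zcomp>\<^bsub>\<C>\<^esub> inv\<^bsub>\<C>\<^esub> (mx\<^bsub>\<C>\<^esub> (fobj M U) (fobj M W))
     \<Zcomp>\<^bsub>\<C>\<^esub> (farr M (\<phi>\<^bsub>\<U>\<^esub> U) \<otimes>\<^bsub>\<C>\<^esub> farr M (\<phi>\<^bsub>\<U>\<^esub> W))
     \<Zcomp>\<^bsub>\<C>\<^esub> (rho M U \<otimes>\<^bsub>\<C>\<^esub> rho M W)
     \<Zcomp>\<^bsub>\<C>\<^esub> (\<one>\<^bsub>\<C>\<^esub> ((fobj M U)\<^bold>\<dagger>\<^bsub>\<C>\<^esub>) \<otimes>\<^bsub>\<C>\<^esub> (h\<dagger>\<^bsub>\<C>\<^esub> \<Zcomp>\<^bsub>\<C>\<^esub> inv\<^bsub>\<C>\<^esub> (\<lambda>\<^sub>\<oplus>\<^bsub>\<C>\<^esub> B C)))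
     \<Zcomp>\<^bsub>\<C>\<^esub> \<partial>\<^sup>L\<^bsub>\<C>\<^esub> ((fobj M U)\<^bold>\<dagger>\<^bsub>\<C>\<^esub>) (B\<^bold>\<dagger>\<^bsub>\<C>\<^esub>) (C\<^bold>\<dagger>\<^bsub>\<C>\<^esub>)
     \<Zcomp>\<^bsub>\<C>\<^esub> (\<lambda>\<^sub>\<otimes>\<^bsub>\<C>\<^esub> (fobj M U) B \<oplus>\<^bsub>\<C>\<^esub> \<one>\<^bsub>\<C>\<^esub> (C\<^bold>\<dagger>\<^bsub>\<C>\<^esub>))
     \<Zcomp>\<^bsub>\<C>\<^esub> (f\<dagger>\<^bsub>\<C>\<^esub> \<oplus>\<^bsub>\<C>\<^esub> \<one>\<^bsub>\<C>\<^esub> (C\<^bold>\<dagger>\<^bsub>\<C>\<^esub>))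
     \<Zcomp>\<^bsub>\<C>\<^esub> \<lambda>\<^sub>\<oplus>\<^bsub>\<C>\<^esub> A C)"

definition kraus_equiv ::
  "('u, 'm, 'x) unitary_data_scheme \<Rightarrow> ('o, 'a, 'y) dagger_data_scheme \<Rightarrow>
   ('u, 'm, 'o, 'a, 'z) dagger_fun_data_scheme \<Rightarrow> 'o \<Rightarrow> 'o \<Rightarrow> 'a \<times> 'u \<Rightarrow> 'a \<times> 'u \<Rightarrow> bool" where
  "kraus_equiv \<U> \<C> M A B k l \<longleftrightarrow>
     (\<forall>C \<in> Obj \<C>. \<forall>W \<in> Obj \<U>. \<forall>h \<in> hom \<C> (B \<^bold>\<otimes>\<^bsub>\<C>\<^esub> C) (fobj M W).
        kraus_test \<U> \<C> M A B C W h k = kraus_test \<U> \<C> M A B C W h l)"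

definition kraus_class ::
  "('u, 'm, 'x) unitary_data_scheme \<Rightarrow> ('o, 'a, 'y) dagger_data_scheme \<Rightarrow>
   ('u, 'm, 'o, 'a, 'z) dagger_fun_data_scheme \<Rightarrow> 'o \<Rightarrow> 'o \<Rightarrow> 'a \<times> 'u \<Rightarrow> ('a \<times> 'u) set" where
  "kraus_class \<U> \<C> M A B k = {l \<in> kraus_maps \<U> \<C> M A B. kraus_equiv \<U> \<C> M A B k l}"

text \<open>An arrow of \<open>CP\<^sup>\<infinity>\<close> is a class tagged with its domain and codomain, since the codomain \<open>B\<close>
  cannot be recovered from a Kraus map \<open>A \<rightarrow> M(U) \<oplus> B\<close>.\<close>

type_synonym ('u, 'o, 'a) cp_arr = "'o \<times> 'o \<times> ('a \<times> 'u) set"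

definition cp_arrow ::
  "('u, 'm, 'x) unitary_data_scheme \<Rightarrow> ('o, 'a, 'y) dagger_data_scheme \<Rightarrow>
   ('u, 'm, 'o, 'a, 'z) dagger_fun_data_scheme \<Rightarrow> 'o \<Rightarrow> 'o \<Rightarrow> 'a \<times> 'u \<Rightarrow> ('u, 'o, 'a) cp_arr" where
  "cp_arrow \<U> \<C> M A B k = (A, B, kraus_class \<U> \<C> M A B k)"

text \<open>Binary operations on Kraus maps are lifted to classes by taking the union of the classes
  of the results over all representatives; when the operation respects equivalence, this is the
  class of the result for any choice of representatives.\<close>

definition cp_lift ::
  "('u, 'm, 'x) unitary_data_scheme \<Rightarrow> ('o, 'a, 'y) dagger_data_scheme \<Rightarrow>
   ('u, 'm, 'o, 'a, 'z) dagger_fun_data_scheme \<Rightarrow> 'o \<Rightarrow> 'o \<Rightarrow>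
   ('a \<times> 'u \<Rightarrow> 'a \<times> 'u \<Rightarrow> 'a \<times> 'u) \<Rightarrow> ('a \<times> 'u) set \<Rightarrow> ('a \<times> 'u) set \<Rightarrow> ('u, 'o, 'a) cp_arr" where
  "cp_lift \<U> \<C> M A B op K L = (A, B, \<Union>k \<in> K. \<Union>l \<in> L. kraus_class \<U> \<C> M A B (op k l))"

definition kraus_comp ::
  "('u, 'm, 'x) unitary_data_scheme \<Rightarrow> ('o, 'a, 'y) dagger_data_scheme \<Rightarrow>
   ('u, 'm, 'o, 'a, 'z) dagger_fun_data_scheme \<Rightarrow> 'o \<Rightarrow> 'a \<times> 'u \<Rightarrow> 'a \<times> 'u \<Rightarrow> 'a \<times> 'u" where
  "kraus_comp \<U> \<C> M C = (\<lambda>(f, U) (g, V).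
     (f \<Zcomp>\<^bsub>\<C>\<^esub> (\<one>\<^bsub>\<C>\<^esub> (fobj M U) \<oplus>\<^bsub>\<C>\<^esub> g) \<Zcomp>\<^bsub>\<C>\<^esub> a\<^sub>\<oplus>\<^bsub>\<C>\<^esub> (fobj M U) (fobj M V) C
        \<Zcomp>\<^bsub>\<C>\<^esub> (inv\<^bsub>\<C>\<^esub> (n_par M U V) \<oplus>\<^bsub>\<C>\<^esub> \<one>\<^bsub>\<C>\<^esub> C),
      U \<^bold>\<oplus>\<^bsub>\<U>\<^esub> V))"

definition cp_comp ::
  "('u, 'm, 'x) unitary_data_scheme \<Rightarrow> ('o, 'a, 'y) dagger_data_scheme \<Rightarrow>
   ('u, 'm, 'o, 'a, 'z) dagger_fun_data_scheme \<Rightarrow>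
   ('u, 'o, 'a) cp_arr \<Rightarrow> ('u, 'o, 'a) cp_arr \<Rightarrow> ('u, 'o, 'a) cp_arr" where
  "cp_comp \<U> \<C> M = (\<lambda>(A, B, K) (B', C, L). cp_lift \<U> \<C> M A C (kraus_comp \<U> \<C> M C) K L)"

definition cp_Q ::
  "('u, 'm, 'x) unitary_data_scheme \<Rightarrow> ('o, 'a, 'y) dagger_data_scheme \<Rightarrow>
   ('u, 'm, 'o, 'a, 'z) dagger_fun_data_scheme \<Rightarrow> 'a \<Rightarrow> ('u, 'o, 'a) cp_arr" where
  "cp_Q \<U> \<C> M f = cp_arrow \<U> \<C> M (Dom \<C> f) (Cod \<C> f)
     (f \<Zcomp>\<^bsub>\<C>\<^esub> inv\<^bsub>\<C>\<^esub> (u\<^sub>\<oplus>\<^sup>L\<^bsub>\<C>\<^esub> (Cod \<C> f)) \<Zcomp>\<^bsub>\<C>\<^esub> (inv\<^bsub>\<C>\<^esub> (n_bot M) \<oplus>\<^bsub>\<C>\<^esub> \<one>\<^bsub>\<C>\<^esub> (Cod \<C> f)), \<bottom>\<^bsub>\<U>\<^esub>)"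

definition CP_category ::
  "('u, 'm, 'x) unitary_data_scheme \<Rightarrow> ('o, 'a, 'y) dagger_data_scheme \<Rightarrow>
   ('u, 'm, 'o, 'a, 'z) dagger_fun_data_scheme \<Rightarrow> ('o, ('u, 'o, 'a) cp_arr) cat" where
  "CP_category \<U> \<C> M =
     \<lparr>Obj = Obj \<C>,
      Arr = {cp_arrow \<U> \<C> M A B k | A B k. A \<in> Obj \<C> \<and> B \<in> Obj \<C> \<and> k \<in> kraus_maps \<U> \<C> M A B},
      Dom = (\<lambda>(A, B, K). A),
      Cod = (\<lambda>(A, B, K). B),
      Ident = (\<lambda>A. cp_arrow \<U> \<C> M A A
        (inv\<^bsub>\<C>\<^esub> (u\<^sub>\<oplus>\<^sup>L\<^bsub>\<C>\<^esub> A) \<Zcomp>\<^bsub>\<C>\<^esub> (inv\<^bsub>\<C>\<^esub> (n_bot M) \<oplus>\<^bsub>\<C>\<^esub> \<one>\<^bsub>\<C>\<^esub> A), \<bottom>\<^bsub>\<U>\<^esub>)),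
      Comp = cp_comp \<U> \<C> M\<rparr>"

text \<open>The canonical rearrangements of \<open>(X \<oplus> A) \<otimes> (Y \<oplus> B)\<close> and \<open>(X \<oplus> A) \<oplus> (Y \<oplus> B)\<close>, which move
  the ancillas \<open>X\<close> and \<open>Y\<close> to the left by means of the symmetry of par.\<close>

definition tensor_shuffle ::
  "('o, 'a, 'x) ldc_data_scheme \<Rightarrow> ('o, 'a) symmetry \<Rightarrow> 'o \<Rightarrow> 'o \<Rightarrow> 'o \<Rightarrow> 'o \<Rightarrow> 'a" where
  "tensor_shuffle \<C> \<S> X A Y B =
     \<partial>\<^sup>R\<^bsub>\<C>\<^esub> X A (Y \<^bold>\<oplus>\<^bsub>\<C>\<^esub> B)
     \<Zcomp>\<^bsub>\<C>\<^esub> (\<one>\<^bsub>\<C>\<^esub> X \<oplus>\<^bsub>\<C>\<^esub>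
           ((\<one>\<^bsub>\<C>\<^esub> A \<otimes>\<^bsub>\<C>\<^esub> c\<^sub>\<oplus>\<^bsub>\<S>\<^esub> Y B) \<Zcomp>\<^bsub>\<C>\<^esub> \<partial>\<^sup>L\<^bsub>\<C>\<^esub> A B Y \<Zcomp>\<^bsub>\<C>\<^esub> c\<^sub>\<oplus>\<^bsub>\<S>\<^esub> (A \<^bold>\<otimes>\<^bsub>\<C>\<^esub> B) Y))
     \<Zcomp>\<^bsub>\<C>\<^esub> a\<^sub>\<oplus>\<^bsub>\<C>\<^esub> X Y (A \<^bold>\<otimes>\<^bsub>\<C>\<^esub> B)"

definition par_shuffle ::
  "('o, 'a, 'x) ldc_data_scheme \<Rightarrow> ('o, 'a) symmetry \<Rightarrow> 'o \<Rightarrow> 'o \<Rightarrow> 'o \<Rightarrow> 'o \<Rightarrow> 'a" where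
  "par_shuffle \<C> \<S> X A Y B =
     inv\<^bsub>\<C>\<^esub> (a\<^sub>\<oplus>\<^bsub>\<C>\<^esub> X A (Y \<^bold>\<oplus>\<^bsub>\<C>\<^esub> B))
     \<Zcomp>\<^bsub>\<C>\<^esub> (\<one>\<^bsub>\<C>\<^esub> X \<oplus>\<^bsub>\<C>\<^esub>
           (a\<^sub>\<oplus>\<^bsub>\<C>\<^esub> A Y B \<Zcomp>\<^bsub>\<C>\<^esub> (c\<^sub>\<oplus>\<^bsub>\<S>\<^esub> A Y \<oplus>\<^bsub>\<C>\<^esub> \<one>\<^bsub>\<C>\<^esub> B) \<Zcomp>\<^bsub>\<C>\<^esub> inv\<^bsub>\<C>\<^esub> (a\<^sub>\<oplus>\<^bsub>\<C>\<^esub> Y A B)))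
     \<Zcomp>\<^bsub>\<C>\<^esub> a\<^sub>\<oplus>\<^bsub>\<C>\<^esub> X Y (A \<^bold>\<oplus>\<^bsub>\<C>\<^esub> B)"

definition kraus_tensor ::
  "('u, 'm, 'x) unitary_data_scheme \<Rightarrow> ('o, 'a, 'y) dagger_data_scheme \<Rightarrow> ('o, 'a) symmetry \<Rightarrow>
   ('u, 'm, 'o, 'a, 'z) dagger_fun_data_scheme \<Rightarrow> 'o \<Rightarrow> 'o \<Rightarrow> 'a \<times> 'u \<Rightarrow> 'a \<times> 'u \<Rightarrow> 'a \<times> 'u" where
  "kraus_tensor \<U> \<C> \<S> M A' B' = (\<lambda>(f, U) (g, V).
     ((f \<otimes>\<^bsub>\<C>\<^esub> g) \<Zcomp>\<^bsub>\<C>\<^esub> tensor_shuffle \<C> \<S> (fobj M U) A' (fobj M V) B'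
        \<Zcomp>\<^bsub>\<C>\<^esub> (inv\<^bsub>\<C>\<^esub> (n_par M U V) \<oplus>\<^bsub>\<C>\<^esub> \<one>\<^bsub>\<C>\<^esub> (A' \<^bold>\<otimes>\<^bsub>\<C>\<^esub> B')),
      U \<^bold>\<oplus>\<^bsub>\<U>\<^esub> V))"

definition kraus_par ::
  "('u, 'm, 'x) unitary_data_scheme \<Rightarrow> ('o, 'a, 'y) dagger_data_scheme \<Rightarrow> ('o, 'a) symmetry \<Rightarrow>
   ('u, 'm, 'o, 'a, 'z) dagger_fun_data_scheme \<Rightarrow> 'o \<Rightarrow> 'o \<Rightarrow> 'a \<times> 'u \<Rightarrow> 'a \<times> 'u \<Rightarrow> 'a \<times> 'u" where
  "kraus_par \<U> \<C> \<S> M A' B' = (\<lambda>(f, U) (g, V).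
     ((f \<oplus>\<^bsub>\<C>\<^esub> g) \<Zcomp>\<^bsub>\<C>\<^esub> par_shuffle \<C> \<S> (fobj M U) A' (fobj M V) B'
        \<Zcomp>\<^bsub>\<C>\<^esub> (inv\<^bsub>\<C>\<^esub> (n_par M U V) \<oplus>\<^bsub>\<C>\<^esub> \<one>\<^bsub>\<C>\<^esub> (A' \<^bold>\<oplus>\<^bsub>\<C>\<^esub> B')),
      U \<^bold>\<oplus>\<^bsub>\<U>\<^esub> V))"

definition cp_tensor ::
  "('u, 'm, 'x) unitary_data_scheme \<Rightarrow> ('o, 'a, 'y) dagger_data_scheme \<Rightarrow> ('o, 'a) symmetry \<Rightarrow>
   ('u, 'm, 'o, 'a, 'z) dagger_fun_data_scheme \<Rightarrow>
   ('u, 'o, 'a) cp_arr \<Rightarrow> ('u, 'o, 'a) cp_arr \<Rightarrow> ('u, 'o, 'a) cp_arr" where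
  "cp_tensor \<U> \<C> \<S> M = (\<lambda>(A, A', K) (B, B', L).
     cp_lift \<U> \<C> M (A \<^bold>\<otimes>\<^bsub>\<C>\<^esub> B) (A' \<^bold>\<otimes>\<^bsub>\<C>\<^esub> B') (kraus_tensor \<U> \<C> \<S> M A' B') K L)"

definition cp_par ::
  "('u, 'm, 'x) unitary_data_scheme \<Rightarrow> ('o, 'a, 'y) dagger_data_scheme \<Rightarrow> ('o, 'a) symmetry \<Rightarrow>
   ('u, 'm, 'o, 'a, 'z) dagger_fun_data_scheme \<Rightarrow>
   ('u, 'o, 'a) cp_arr \<Rightarrow> ('u, 'o, 'a) cp_arr \<Rightarrow> ('u, 'o, 'a) cp_arr" where
  "cp_par \<U> \<C> \<S> M = (\<lambda>(A, A', K) (B, B', L).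
     cp_lift \<U> \<C> M (A \<^bold>\<oplus>\<^bsub>\<C>\<^esub> B) (A' \<^bold>\<oplus>\<^bsub>\<C>\<^esub> B') (kraus_par \<U> \<C> \<S> M A' B') K L)"

definition CP_isomix ::
  "('u, 'm, 'x) unitary_data_scheme \<Rightarrow> ('o, 'a, 'y) dagger_data_scheme \<Rightarrow> ('o, 'a) symmetry \<Rightarrow>
   ('u, 'm, 'o, 'a, 'z) dagger_fun_data_scheme \<Rightarrow> ('o, ('u, 'o, 'a) cp_arr) isomix_data" where
  "CP_isomix \<U> \<C> \<S> M =
     \<lparr>Obj = Obj (CP_category \<U> \<C> M),
      Arr = Arr (CP_category \<U> \<C> M),
      Dom = Dom (CP_category \<U> \<C> M),
      Cod = Cod (CP_category \<U> \<C> M),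
      Ident = Ident (CP_category \<U> \<C> M),
      Comp = Comp (CP_category \<U> \<C> M),
      tensor_obj = tensor_obj \<C>,
      tensor = cp_tensor \<U> \<C> \<S> M,
      tensor_unit = \<top>\<^bsub>\<C>\<^esub>,
      tensor_assoc = (\<lambda>A B C. cp_Q \<U> \<C> M (a\<^sub>\<otimes>\<^bsub>\<C>\<^esub> A B C)),
      tensor_uL = (\<lambda>A. cp_Q \<U> \<C> M (u\<^sub>\<otimes>\<^sup>L\<^bsub>\<C>\<^esub> A)),
      tensor_uR = (\<lambda>A. cp_Q \<U> \<C> M (u\<^sub>\<otimes>\<^sup>R\<^bsub>\<C>\<^esub> A)),
      par_obj = par_obj \<C>,
      par = cp_par \<U> \<C> \<S> M,
      par_unit = \<bottom>\<^bsub>\<C>\<^esub>,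
      par_assoc = (\<lambda>A B C. cp_Q \<U> \<C> M (a\<^sub>\<oplus>\<^bsub>\<C>\<^esub> A B C)),
      par_uL = (\<lambda>A. cp_Q \<U> \<C> M (u\<^sub>\<oplus>\<^sup>L\<^bsub>\<C>\<^esub> A)),
      par_uR = (\<lambda>A. cp_Q \<U> \<C> M (u\<^sub>\<oplus>\<^sup>R\<^bsub>\<C>\<^esub> A)),
      distL = (\<lambda>A B C. cp_Q \<U> \<C> M (\<partial>\<^sup>L\<^bsub>\<C>\<^esub> A B C)),
      distR = (\<lambda>A B C. cp_Q \<U> \<C> M (\<partial>\<^sup>R\<^bsub>\<C>\<^esub> A B C)),
      mix = cp_Q \<U> \<C> M \<m>\<^bsub>\<C>\<^esub>\<rparr>"

definition CP_symmetry ::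
  "('u, 'm, 'x) unitary_data_scheme \<Rightarrow> ('o, 'a, 'y) dagger_data_scheme \<Rightarrow> ('o, 'a) symmetry \<Rightarrow>
   ('u, 'm, 'o, 'a, 'z) dagger_fun_data_scheme \<Rightarrow> ('o, ('u, 'o, 'a) cp_arr) symmetry" where
  "CP_symmetry \<U> \<C> \<S> M =
     \<lparr>sym_tensor = (\<lambda>A B. cp_Q \<U> \<C> M (c\<^sub>\<otimes>\<^bsub>\<S>\<^esub> A B)),
      sym_par = (\<lambda>A B. cp_Q \<U> \<C> M (c\<^sub>\<oplus>\<^bsub>\<S>\<^esub> A B))\<rparr>"

text \<open>The map \<open>\<bottom> \<oplus> \<bottom> \<rightarrow> \<bottom>\<close> of the environment axioms is the left unitor at \<open>\<bottom>\<close>, which by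
  coherence is also the right one.\<close>

locale environment_structure =
  mixed_unitary_category \<U> \<C> M + env: strict_isomix_functor \<C> \<D> F
  for \<U> :: "('u, 'm, 'x) unitary_data_scheme" and \<C> :: "('o, 'a, 'y) dagger_data_scheme"
    and M :: "('u, 'm, 'o, 'a, 'z) dagger_fun_data_scheme"
    and \<D> :: "('p, 'b, 'w) isomix_data_scheme"
    and F :: "('o, 'a, 'p, 'b, 'v) isomix_fun_data_scheme" +
  fixes d :: "'u \<Rightarrow> 'b"
  assumes discard_hom: "U \<in> Obj \<U> \<Longrightarrow> d U \<in> hom \<D> (fobj F (fobj M U)) \<bottom>\<^bsub>\<D>\<^esub>"
    and env_tensor:
      "\<lbrakk>U \<in> Obj \<U>; V \<in> Obj \<U>\<rbrakk> \<Longrightarrow>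
        mx\<^bsub>\<D>\<^esub> (fobj F (fobj M U)) (fobj F (fobj M V)) \<Zcomp>\<^bsub>\<D>\<^esub> (d U \<oplus>\<^bsub>\<D>\<^esub> d V) \<Zcomp>\<^bsub>\<D>\<^esub> u\<^sub>\<oplus>\<^sup>L\<^bsub>\<D>\<^esub> \<bottom>\<^bsub>\<D>\<^esub> =
        m_tensor (isomix_fun_comp \<D> M F) U V \<Zcomp>\<^bsub>\<D>\<^esub> d (U \<^bold>\<otimes>\<^bsub>\<U>\<^esub> V)"
    and env_par:
      "\<lbrakk>U \<in> Obj \<U>; V \<in> Obj \<U>\<rbrakk> \<Longrightarrow>
        n_par (isomix_fun_comp \<D> M F) U V \<Zcomp>\<^bsub>\<D>\<^esub> (d U \<oplus>\<^bsub>\<D>\<^esub> d V) \<Zcomp>\<^bsub>\<D>\<^esub> u\<^sub>\<oplus>\<^sup>L\<^bsub>\<D>\<^esub> \<bottom>\<^bsub>\<D>\<^esub> =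
        d (U \<^bold>\<oplus>\<^bsub>\<U>\<^esub> V)"
    and env_kraus:
      "\<lbrakk>A \<in> Obj \<C>; B \<in> Obj \<C>; (f, U) \<in> kraus_maps \<U> \<C> M A B; (g, V) \<in> kraus_maps \<U> \<C> M A B\<rbrakk> \<Longrightarrow>
        kraus_equiv \<U> \<C> M A B (f, U) (g, V) \<longleftrightarrow>
        farr F f \<Zcomp>\<^bsub>\<D>\<^esub> n_par F (fobj M U) B \<Zcomp>\<^bsub>\<D>\<^esub> (d U \<oplus>\<^bsub>\<D>\<^esub> \<one>\<^bsub>\<D>\<^esub> (fobj F B)) =
        farr F g \<Zcomp>\<^bsub>\<D>\<^esub> n_par F (fobj M V) B \<Zcomp>\<^bsub>\<D>\<^esub> (d V \<oplus>\<^bsub>\<D>\<^esub> \<one>\<^bsub>\<D>\<^esub> (fobj F B))"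

locale symmetric_environment_structure =
  environment_structure \<U> \<C> M \<D> F d + symmetric_mixed_unitary_category \<U> \<R> \<C> \<S> M +
  env: symmetric_isomix_functor \<C> \<S> \<D> \<T> F
  for \<U> :: "('u, 'm, 'x) unitary_data_scheme" and \<R> :: "('u, 'm) symmetry"
    and \<C> :: "('o, 'a, 'y) dagger_data_scheme" and \<S> :: "('o, 'a) symmetry"
    and M :: "('u, 'm, 'o, 'a, 'z) dagger_fun_data_scheme"
    and \<D> :: "('p, 'b, 'w) isomix_data_scheme" and \<T> :: "('p, 'b) symmetry"
    and F :: "('o, 'a, 'p, 'b, 'v) isomix_fun_data_scheme"
    and d :: "'u \<Rightarrow> 'b"

definition has_purification ::
  "('u, 'm, 'x) unitary_data_scheme \<Rightarrow> ('o, 'a, 'y) dagger_data_scheme \<Rightarrow>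
   ('u, 'm, 'o, 'a, 'z) dagger_fun_data_scheme \<Rightarrow> ('p, 'b, 'w) isomix_data_scheme \<Rightarrow>
   ('o, 'a, 'p, 'b, 'v) isomix_fun_data_scheme \<Rightarrow> ('u \<Rightarrow> 'b) \<Rightarrow> bool" where
  "has_purification \<U> \<C> M \<D> F d \<longleftrightarrow>
     bij_betw (fobj F) (Obj \<C>) (Obj \<D>) \<and>
     (\<forall>A \<in> Obj \<C>. \<forall>B \<in> Obj \<C>. \<forall>f \<in> hom \<D> (fobj F A) (fobj F B).
        \<exists>(f', U) \<in> kraus_maps \<U> \<C> M A B.
          f = farr F f' \<Zcomp>\<^bsub>\<D>\<^esub> n_par F (fobj M U) B \<Zcomp>\<^bsub>\<D>\<^esub> (d U \<oplus>\<^bsub>\<D>\<^esub> \<one>\<^bsub>\<D>\<^esub> (fobj F B))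
                \<Zcomp>\<^bsub>\<D>\<^esub> u\<^sub>\<oplus>\<^sup>L\<^bsub>\<D>\<^esub> (fobj F B))"

end

theory Submission
  imports Defs
begin

text \<open>
  The functor \<open>F\<close> and the discard maps turn a Kraus map \<open>(f, U) : A \<rightarrow> B\<close> into the arrow
  \<open>F(f); (d\<^sub>U \<oplus> 1); u\<^sub>\<oplus>\<^sup>L : F(A) \<rightarrow> F(B)\<close> of \<open>\<D>\<close>, called its denotation below. The second environment axiom
  says that two parallel Kraus maps are equivalent exactly when they have the same denotation, and
  purification says that every arrow \<open>F(A) \<rightarrow> F(B)\<close> is a denotation. Hence arrows of \<open>CP\<^sup>\<infinity>\<close> and arrows
  of \<open>\<D>\<close> correspond bijectively, an arrow of \<open>\<D>\<close> being matched with the set of its purifications,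
  and \<open>F\<close> itself is the bijection on objects.

  The correspondence preserves the structure because discarding is compatible with the way ancillas
  are gathered. By the axiom for par, the discard map of \<open>U \<oplus> V\<close> is the two discard maps side by
  side, so that a composite, a tensor or a par of Kraus maps denotes the composite, tensor or par of
  the denotations as soon as the coherence isomorphisms that collect the ancillas disappear when
  both ancillas are the unit (\<open>comp_discard\<close>, \<open>tensor_shuffle_discard\<close>, \<open>par_shuffle_discard\<close>).

  Identities and the arrows \<open>Q(f)\<close> need in addition that the discard map of the ancilla \<open>\<bottom>\<close> is the
  canonical isomorphism \<open>F(M(\<bottom>)) \<rightarrow> \<bottom>\<close> (\<open>discard_bottom\<close>), which is not an axiom. It holds because
  equivalence of Kraus maps is insensitive to unitary changes of the ancilla
  (\<open>kraus_test_unitary\<close>) and the unitor \<open>U \<oplus> \<bottom> \<rightarrow> U\<close> is unitary: enlarging the ancilla by \<open>\<bottom>\<close>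
  composes a denotation with a fixed arrow \<open>\<bottom> \<rightarrow> \<bottom>\<close>, and a purification of the identity of \<open>\<bottom>\<close>
  shows that this arrow is an identity.

  No axiom of an isomix category has to be verified for \<open>CP\<^sup>\<infinity>\<close> by hand: a bijective, structure
  preserving map out of \<open>\<D>\<close> transports all of them at once
  (\<open>symmetric_isomix_isomorphism\<close>).
\<close>

section \<open>Typing and cancellation in categories\<close>

text \<open>Typing is computed from \<^const>\<open>Arr\<close>, \<^const>\<open>Dom\<close> and \<^const>\<open>Cod\<close> rather than from
  hom-sets: rewriting then never has to guess an intermediate object, and composites can be brought
  to a right-nested normal form.\<close>

declare hom_def [simp]

context category
begin

lemma Ident_Arr [simp]:
  assumes "A \<in> Obj \<C>"
  shows "\<one> A \<in> Arr \<C>" "Dom \<C> (\<one> A) = A" "Cod \<C> (\<one> A) = A"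
  using Ident_hom[OF assms] by simp_all

lemma Dom_Cod_Obj [simp]:
  assumes "f \<in> Arr \<C>"
  shows "Dom \<C> f \<in> Obj \<C>" "Cod \<C> f \<in> Obj \<C>"
  using assms Dom_Obj Cod_Obj by auto

lemma Comp_Arr [simp]:
  assumes "f \<in> Arr \<C>" "g \<in> Arr \<C>" "Cod \<C> f = Dom \<C> g"
  shows "f \<Zcomp> g \<in> Arr \<C>" "Dom \<C> (f \<Zcomp> g) = Dom \<C> f" "Cod \<C> (f \<Zcomp> g) = Cod \<C> g"
  using Comp_hom[of f "Dom \<C> f" "Dom \<C> g" g "Cod \<C> g"] assms by simp_all

lemma Comp_Ident_Arr [simp]:
  "f \<in> Arr \<C> \<Longrightarrow> Dom \<C> f = A \<Longrightarrow> \<one> A \<Zcomp> f = f"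
  "f \<in> Arr \<C> \<Longrightarrow> Cod \<C> f = A \<Longrightarrow> f \<Zcomp> \<one> A = f"
  using Ident_Comp[of f] Comp_Ident[of f] by auto

lemma Comp_assoc_Arr [simp]:
  assumes "f \<in> Arr \<C>" "g \<in> Arr \<C>" "h \<in> Arr \<C>" "Cod \<C> f = Dom \<C> g" "Cod \<C> g = Dom \<C> h"
  shows "(f \<Zcomp> g) \<Zcomp> h = f \<Zcomp> (g \<Zcomp> h)"
  using Comp_assoc[of f "Dom \<C> f" "Dom \<C> g" g "Dom \<C> h" h "Cod \<C> h"] assms by simp

lemma inv_arr_unique:
  assumes "f \<in> Arr \<C>" "g \<in> Arr \<C>" "Cod \<C> f = Dom \<C> g" "Cod \<C> g = Dom \<C> f"
    "f \<Zcomp> g = \<one> (Dom \<C> f)" "g \<Zcomp> f = \<one> (Cod \<C> f)"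
  shows "inv f = g"
  unfolding inv_arr_def
proof (rule the_equality)
  show "g \<in> hom \<C> (Cod \<C> f) (Dom \<C> f) \<and> f \<Zcomp> g = \<one> (Dom \<C> f) \<and> g \<Zcomp> f = \<one> (Cod \<C> f)"
    using assms by simp
next
  fix h assume h: "h \<in> hom \<C> (Cod \<C> f) (Dom \<C> f) \<and> f \<Zcomp> h = \<one> (Dom \<C> f) \<and> h \<Zcomp> f = \<one> (Cod \<C> f)"
  have "h = (g \<Zcomp> f) \<Zcomp> h" using h assms by simp
  also have "\<dots> = g \<Zcomp> (f \<Zcomp> h)" using h assms(1-4) by (intro Comp_assoc_Arr) auto
  also have "\<dots> = g" using h assms by simp
  finally show "h = g" .
qed

lemma isosI:
  assumes "f \<in> Arr \<C>" "g \<in> Arr \<C>" "Dom \<C> f = A" "Cod \<C> f = B" "Dom \<C> g = B" "Cod \<C> g = A"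
    "f \<Zcomp> g = \<one> A" "g \<Zcomp> f = \<one> B"
  shows "f \<in> isos \<C> A B"
  using assms unfolding isos_def by auto

lemma isos_Arr:
  assumes "f \<in> isos \<C> A B"
  shows "f \<in> Arr \<C>" "Dom \<C> f = A" "Cod \<C> f = B"
  using assms unfolding isos_def by auto

lemma inv_arr_isos:
  assumes "f \<in> isos \<C> A B"
  shows "inv f \<in> Arr \<C>" "Dom \<C> (inv f) = B" "Cod \<C> (inv f) = A"
    "f \<Zcomp> inv f = \<one> A" "inv f \<Zcomp> f = \<one> B"
proof -
  obtain g where "g \<in> Arr \<C>" "Dom \<C> g = B" "Cod \<C> g = A" "f \<Zcomp> g = \<one> A" "g \<Zcomp> f = \<one> B"
    using assms unfolding isos_def by auto
  then show "inv f \<in> Arr \<C>" "Dom \<C> (inv f) = B" "Cod \<C> (inv f) = A"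
    "f \<Zcomp> inv f = \<one> A" "inv f \<Zcomp> f = \<one> B"
    using inv_arr_unique[of f g] isos_Arr[OF assms] by auto
qed

lemma inv_arr_Arr [simp]:
  assumes "f \<in> isos \<C> (Dom \<C> f) (Cod \<C> f)"
  shows "inv f \<in> Arr \<C>" "Dom \<C> (inv f) = Cod \<C> f" "Cod \<C> (inv f) = Dom \<C> f"
    "f \<Zcomp> inv f = \<one> (Dom \<C> f)" "inv f \<Zcomp> f = \<one> (Cod \<C> f)"
  using inv_arr_isos[OF assms] by simp_all

lemma inv_arr_cancel [simp]:
  assumes "f \<in> isos \<C> (Dom \<C> f) (Cod \<C> f)" "g \<in> Arr \<C>"
  shows "Dom \<C> g = Dom \<C> f \<Longrightarrow> f \<Zcomp> (inv f \<Zcomp> g) = g"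
    "Dom \<C> g = Cod \<C> f \<Longrightarrow> inv f \<Zcomp> (f \<Zcomp> g) = g"
  using assms isos_Arr[OF assms(1)] by (simp_all flip: Comp_assoc_Arr)

lemma iso_cancel_left:
  assumes "f \<in> isos \<C> A B" "g \<in> Arr \<C>" "h \<in> Arr \<C>" "Dom \<C> g = B" "Dom \<C> h = B"
    "f \<Zcomp> g = f \<Zcomp> h"
  shows "g = h"
proof -
  have "inv f \<Zcomp> (f \<Zcomp> g) = inv f \<Zcomp> (f \<Zcomp> h)" using assms by simp
  then show ?thesis using assms(1-5) isos_Arr[OF assms(1)] by simp
qed

lemma iso_cancel_right:
  assumes "f \<in> isos \<C> A B" "g \<in> Arr \<C>" "h \<in> Arr \<C>" "Cod \<C> g = A" "Cod \<C> h = A"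
    "g \<Zcomp> f = h \<Zcomp> f"
  shows "g = h"
proof -
  have "(g \<Zcomp> f) \<Zcomp> inv f = (h \<Zcomp> f) \<Zcomp> inv f" using assms by simp
  then show ?thesis using assms(1-5) isos_Arr[OF assms(1)] by simp
qed

end

section \<open>Units and discarding in a monoidal category\<close>

context monoidal
begin

declare unit_Obj [simp] ob_Obj [simp] ar_Ident [simp]

lemma ar_Arr [simp]:
  assumes "f \<in> Arr \<C>" "g \<in> Arr \<C>"
  shows "f \<box> g \<in> Arr \<C>" "Dom \<C> (f \<box> g) = Dom \<C> f \<^bold>\<box> Dom \<C> g"
    "Cod \<C> (f \<box> g) = Cod \<C> f \<^bold>\<box> Cod \<C> g"
  using ar_hom[of f "Dom \<C> f" "Cod \<C> f" g "Dom \<C> g" "Cod \<C> g"] assms by simp_all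

text \<open>Parallel composition is merged rather than split, so that a chain of arrows whiskered on
  either side has a unique normal form.\<close>

lemma ar_merge [simp]:
  assumes "f \<in> Arr \<C>" "f' \<in> Arr \<C>" "g \<in> Arr \<C>" "g' \<in> Arr \<C>"
    "Cod \<C> f = Dom \<C> f'" "Cod \<C> g = Dom \<C> g'"
  shows "(f \<box> g) \<Zcomp> (f' \<box> g') = (f \<Zcomp> f') \<box> (g \<Zcomp> g')"
  using ar_Comp[of f "Dom \<C> f" "Cod \<C> f" f' "Cod \<C> f'" g "Dom \<C> g" "Cod \<C> g" g' "Cod \<C> g'"]
    assms by simp

lemma ar_merge_assoc [simp]:
  assumes "f \<in> Arr \<C>" "f' \<in> Arr \<C>" "g \<in> Arr \<C>" "g' \<in> Arr \<C>" "h \<in> Arr \<C>"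
    "Cod \<C> f = Dom \<C> f'" "Cod \<C> g = Dom \<C> g'" "Dom \<C> h = Cod \<C> f' \<^bold>\<box> Cod \<C> g'"
  shows "(f \<box> g) \<Zcomp> ((f' \<box> g') \<Zcomp> h) = ((f \<Zcomp> f') \<box> (g \<Zcomp> g')) \<Zcomp> h"
  using assms by (simp flip: Comp_assoc_Arr)

declare a_iso [simp] uL_iso [simp] uR_iso [simp]

lemma structure_Arr [simp]:
  "A \<in> Obj \<C> \<Longrightarrow> B \<in> Obj \<C> \<Longrightarrow> C \<in> Obj \<C> \<Longrightarrow> a A B C \<in> Arr \<C>"
  "A \<in> Obj \<C> \<Longrightarrow> B \<in> Obj \<C> \<Longrightarrow> C \<in> Obj \<C> \<Longrightarrow> Dom \<C> (a A B C) = A \<^bold>\<box> (B \<^bold>\<box> C)"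
  "A \<in> Obj \<C> \<Longrightarrow> B \<in> Obj \<C> \<Longrightarrow> C \<in> Obj \<C> \<Longrightarrow> Cod \<C> (a A B C) = (A \<^bold>\<box> B) \<^bold>\<box> C"
  "A \<in> Obj \<C> \<Longrightarrow> uL A \<in> Arr \<C>" "A \<in> Obj \<C> \<Longrightarrow> Dom \<C> (uL A) = I \<^bold>\<box> A"
  "A \<in> Obj \<C> \<Longrightarrow> Cod \<C> (uL A) = A"
  "A \<in> Obj \<C> \<Longrightarrow> uR A \<in> Arr \<C>" "A \<in> Obj \<C> \<Longrightarrow> Dom \<C> (uR A) = A \<^bold>\<box> I"
  "A \<in> Obj \<C> \<Longrightarrow> Cod \<C> (uR A) = A"
  using isos_Arr[OF a_iso] isos_Arr[OF uL_iso] isos_Arr[OF uR_iso] by simp_all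

lemma a_natural_Arr:
  assumes "f \<in> Arr \<C>" "g \<in> Arr \<C>" "h \<in> Arr \<C>"
  shows "(f \<box> (g \<box> h)) \<Zcomp> a (Cod \<C> f) (Cod \<C> g) (Cod \<C> h)
    = a (Dom \<C> f) (Dom \<C> g) (Dom \<C> h) \<Zcomp> ((f \<box> g) \<box> h)"
  using a_natural[of f "Dom \<C> f" "Cod \<C> f" g "Dom \<C> g" "Cod \<C> g" h "Dom \<C> h" "Cod \<C> h"] assms
  by simp

lemma uL_natural_Arr: "f \<in> Arr \<C> \<Longrightarrow> (\<one> I \<box> f) \<Zcomp> uL (Cod \<C> f) = uL (Dom \<C> f) \<Zcomp> f"
  using uL_natural[of f "Dom \<C> f" "Cod \<C> f"] by simp

lemma uR_natural_Arr: "f \<in> Arr \<C> \<Longrightarrow> (f \<box> \<one> I) \<Zcomp> uR (Cod \<C> f) = uR (Dom \<C> f) \<Zcomp> f"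
  using uR_natural[of f "Dom \<C> f" "Cod \<C> f"] by simp

text \<open>Whiskering with the unit is naturally isomorphic to the identity functor, hence faithful.\<close>

lemma unit_faithful_left:
  assumes f: "f \<in> Arr \<C>" and g: "g \<in> Arr \<C>" and "Dom \<C> f = Dom \<C> g" "Cod \<C> f = Cod \<C> g"
    and eq: "\<one> I \<box> f = \<one> I \<box> g"
  shows "f = g"
proof (rule iso_cancel_left[OF uL_iso[of "Dom \<C> f"]])
  show "uL (Dom \<C> f) \<Zcomp> f = uL (Dom \<C> f) \<Zcomp> g"
    using uL_natural_Arr[OF f] uL_natural_Arr[OF g] unfolding eq assms(3,4) by metis
qed (use assms(1-4) in simp_all)

lemma unit_faithful_right:
  assumes f: "f \<in> Arr \<C>" and g: "g \<in> Arr \<C>" and "Dom \<C> f = Dom \<C> g" "Cod \<C> f = Cod \<C> g"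
    and eq: "f \<box> \<one> I = g \<box> \<one> I"
  shows "f = g"
proof (rule iso_cancel_left[OF uR_iso[of "Dom \<C> f"]])
  show "uR (Dom \<C> f) \<Zcomp> f = uR (Dom \<C> f) \<Zcomp> g"
    using uR_natural_Arr[OF f] uR_natural_Arr[OF g] unfolding eq assms(3,4) by metis
qed (use assms(1-4) in simp_all)

text \<open>Kelly's coherence law. By faithfulness of whiskering with the unit it suffices to compare both
  sides after \<open>\<one> I \<box> _\<close>, where the pentagon turns the left side into an instance of the triangle.\<close>

lemma uL_ob:
  assumes A [simp]: "A \<in> Obj \<C>" and B [simp]: "B \<in> Obj \<C>"
  shows "a I A B \<Zcomp> (uL A \<box> \<one> B) = uL (A \<^bold>\<box> B)"
proof (rule unit_faithful_left)
  have 1: "((\<one> I \<box> uL A) \<box> \<one> B) = (a I I A \<Zcomp> (uR I \<box> \<one> A)) \<box> \<one> B"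
    using triangle[of I A] by simp
  have "(\<one> I \<box> (a I A B \<Zcomp> (uL A \<box> \<one> B))) \<Zcomp> a I A B
      = (\<one> I \<box> a I A B) \<Zcomp> ((\<one> I \<box> (uL A \<box> \<one> B)) \<Zcomp> a I A B)"
    by simp
  also have "\<dots> = (\<one> I \<box> a I A B) \<Zcomp> (a I (I \<^bold>\<box> A) B \<Zcomp> ((\<one> I \<box> uL A) \<box> \<one> B))"
    using a_natural_Arr[of "\<one> I" "uL A" "\<one> B"] by simp
  also have "\<dots> = ((\<one> I \<box> a I A B) \<Zcomp> a I (I \<^bold>\<box> A) B \<Zcomp> (a I I A \<box> \<one> B)) \<Zcomp> ((uR I \<box> \<one> A) \<box> \<one> B)"
    using 1 by simp
  also have "\<dots> = (a I I (A \<^bold>\<box> B) \<Zcomp> a (I \<^bold>\<box> I) A B) \<Zcomp> ((uR I \<box> \<one> A) \<box> \<one> B)"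
    using pentagon[of I I A B] by simp
  also have "\<dots> = (a I I (A \<^bold>\<box> B) \<Zcomp> (uR I \<box> \<one> (A \<^bold>\<box> B))) \<Zcomp> a I A B"
    using a_natural_Arr[of "uR I" "\<one> A" "\<one> B"] by simp
  also have "\<dots> = (\<one> I \<box> uL (A \<^bold>\<box> B)) \<Zcomp> a I A B"
    using triangle[of I "A \<^bold>\<box> B"] by simp
  finally have "(\<one> I \<box> (a I A B \<Zcomp> (uL A \<box> \<one> B))) \<Zcomp> a I A B = (\<one> I \<box> uL (A \<^bold>\<box> B)) \<Zcomp> a I A B" .
  then show "\<one> I \<box> (a I A B \<Zcomp> (uL A \<box> \<one> B)) = \<one> I \<box> uL (A \<^bold>\<box> B)"
    by - (rule iso_cancel_right[of "a I A B" "I \<^bold>\<box> (A \<^bold>\<box> B)" "(I \<^bold>\<box> A) \<^bold>\<box> B"], simp_all)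
qed simp_all

text \<open>Both unitors at the unit, whiskered with the unit on the right, become the triangle at \<open>I, I\<close>.\<close>

lemma uL_unit_eq_uR_unit: "uL I = uR I"
proof (rule unit_faithful_right)
  have "\<one> I \<box> uL I = uL (I \<^bold>\<box> I)"
    using uL_natural_Arr[of "uL I"]
    by - (rule iso_cancel_right[of "uL I" "I \<^bold>\<box> I" I], simp_all)
  then have "a I I I \<Zcomp> (uL I \<box> \<one> I) = a I I I \<Zcomp> (uR I \<box> \<one> I)"
    using uL_ob[of I I] triangle[of I I] by simp
  then show "uL I \<box> \<one> I = uR I \<box> \<one> I"
    by - (rule iso_cancel_left[of "a I I I" "I \<^bold>\<box> (I \<^bold>\<box> I)" "(I \<^bold>\<box> I) \<^bold>\<box> I"], simp_all)
qed simp_all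

end

context monoidal
begin

lemma a_natural_inv:
  assumes [simp]: "f \<in> Arr \<C>" "g \<in> Arr \<C>" "h \<in> Arr \<C>"
  shows "((f \<box> g) \<box> h) \<Zcomp> inv (a (Cod \<C> f) (Cod \<C> g) (Cod \<C> h))
    = inv (a (Dom \<C> f) (Dom \<C> g) (Dom \<C> h)) \<Zcomp> (f \<box> (g \<box> h))"
proof (rule iso_cancel_left[OF a_iso])
  let ?a = "a (Dom \<C> f) (Dom \<C> g) (Dom \<C> h)" and ?a' = "a (Cod \<C> f) (Cod \<C> g) (Cod \<C> h)"
  have "?a \<Zcomp> (((f \<box> g) \<box> h) \<Zcomp> inv ?a') = (?a \<Zcomp> ((f \<box> g) \<box> h)) \<Zcomp> inv ?a'" by simp
  also have "\<dots> = ((f \<box> (g \<box> h)) \<Zcomp> ?a') \<Zcomp> inv ?a'" by (simp only: a_natural_Arr assms)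
  finally show "?a \<Zcomp> (((f \<box> g) \<box> h) \<Zcomp> inv ?a') = ?a \<Zcomp> (inv ?a \<Zcomp> (f \<box> (g \<box> h)))" by simp
qed simp_all

text \<open>Throwing away two objects \<open>X\<close>, \<open>Y\<close> jointly amounts to throwing away \<open>Y\<close> and then \<open>X\<close>; by
  naturality everything happens at the unit, where it is Kelly's law.\<close>

lemma assoc_discard:
  assumes [simp]: "x \<in> Arr \<C>" "Cod \<C> x = I" "y \<in> Arr \<C>" "Cod \<C> y = I" "C \<in> Obj \<C>"
  shows "a (Dom \<C> x) (Dom \<C> y) C \<Zcomp> ((((x \<box> y) \<Zcomp> uL I) \<box> \<one> C) \<Zcomp> uL C)
    = (x \<box> ((y \<box> \<one> C) \<Zcomp> uL C)) \<Zcomp> uL C"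
proof -
  let ?a = "a (Dom \<C> x) (Dom \<C> y) C"
  have "?a \<Zcomp> ((((x \<box> y) \<Zcomp> uL I) \<box> \<one> C) \<Zcomp> uL C)
      = (?a \<Zcomp> ((x \<box> y) \<box> \<one> C)) \<Zcomp> ((uL I \<box> \<one> C) \<Zcomp> uL C)" by simp
  also have "\<dots> = ((x \<box> (y \<box> \<one> C)) \<Zcomp> a I I C) \<Zcomp> ((uL I \<box> \<one> C) \<Zcomp> uL C)"
    using a_natural_Arr[of x y "\<one> C"] by simp
  also have "\<dots> = (x \<box> (y \<box> \<one> C)) \<Zcomp> ((a I I C \<Zcomp> (uL I \<box> \<one> C)) \<Zcomp> uL C)" by simp
  also have "\<dots> = (x \<box> (y \<box> \<one> C)) \<Zcomp> (uL (I \<^bold>\<box> C) \<Zcomp> uL C)" by (simp only: uL_ob unit_Obj assms)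
  also have "\<dots> = (x \<box> (y \<box> \<one> C)) \<Zcomp> ((\<one> I \<box> uL C) \<Zcomp> uL C)" using uL_natural_Arr[of "uL C"] by simp
  also have "\<dots> = (x \<box> ((y \<box> \<one> C) \<Zcomp> uL C)) \<Zcomp> uL C" by simp
  finally show ?thesis .
qed

text \<open>The arrow \<open>(x \<box> \<one> B) \<Zcomp> uL B\<close> throws away an ancilla along \<open>x\<close>. Composing first and throwing
  away both ancillas at the end gives the same as throwing away each ancilla as soon as it appears.\<close>

lemma comp_discard:
  assumes [simp]: "x \<in> Arr \<C>" "Dom \<C> x = X" "Cod \<C> x = I" "y \<in> Arr \<C>" "Dom \<C> y = Y" "Cod \<C> y = I"
    "f \<in> Arr \<C>" "Cod \<C> f = X \<^bold>\<box> B" "g \<in> Arr \<C>" "Dom \<C> g = B" "Cod \<C> g = Y \<^bold>\<box> C"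
    "C \<in> Obj \<C>"
  shows "f \<Zcomp> (\<one> X \<box> g) \<Zcomp> a X Y C \<Zcomp> (((x \<box> y) \<Zcomp> uL I) \<box> \<one> C) \<Zcomp> uL C
    = (f \<Zcomp> (x \<box> \<one> B) \<Zcomp> uL B) \<Zcomp> (g \<Zcomp> (y \<box> \<one> C) \<Zcomp> uL C)"
proof -
  have [simp]: "X \<in> Obj \<C>" "Y \<in> Obj \<C>" "B \<in> Obj \<C>"
    using Dom_Cod_Obj[of x] Dom_Cod_Obj[of y] Dom_Cod_Obj[of g] by simp_all
  define k where "k = (y \<box> \<one> C) \<Zcomp> uL C"
  have [simp]: "k \<in> Arr \<C>" "Dom \<C> k = Y \<^bold>\<box> C" "Cod \<C> k = C" by (simp_all add: k_def)
  have "f \<Zcomp> (\<one> X \<box> g) \<Zcomp> a X Y C \<Zcomp> (((x \<box> y) \<Zcomp> uL I) \<box> \<one> C) \<Zcomp> uL C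
      = (f \<Zcomp> (\<one> X \<box> g)) \<Zcomp> (a X Y C \<Zcomp> ((((x \<box> y) \<Zcomp> uL I) \<box> \<one> C) \<Zcomp> uL C))"
    by simp
  also have "\<dots> = (f \<Zcomp> (\<one> X \<box> g)) \<Zcomp> ((x \<box> k) \<Zcomp> uL C)"
    using assoc_discard[of x y C] by (simp add: k_def)
  also have "\<dots> = (f \<Zcomp> (x \<box> \<one> B)) \<Zcomp> ((\<one> I \<box> (g \<Zcomp> k)) \<Zcomp> uL C)" by simp
  also have "\<dots> = (f \<Zcomp> (x \<box> \<one> B)) \<Zcomp> (uL B \<Zcomp> (g \<Zcomp> k))"
    using uL_natural_Arr[of "g \<Zcomp> k"] by simp
  finally show ?thesis by (simp add: k_def)
qed

text \<open>Kelly's law read through the inverse associator: by naturality \<open>x\<close> may be discarded before or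
  after rebracketing.\<close>

lemma assoc_inv_discard:
  assumes [simp]: "x \<in> Arr \<C>" "Cod \<C> x = I" "f \<in> Arr \<C>" "g \<in> Arr \<C>"
  shows "inv (a (Dom \<C> x) (Dom \<C> f) (Dom \<C> g)) \<Zcomp> ((x \<box> (f \<box> g)) \<Zcomp> uL (Cod \<C> f \<^bold>\<box> Cod \<C> g))
    = ((x \<box> f) \<Zcomp> uL (Cod \<C> f)) \<box> g"
proof -
  have 1: "inv (a I A B) \<Zcomp> uL (A \<^bold>\<box> B) = uL A \<box> \<one> B" if [simp]: "A \<in> Obj \<C>" "B \<in> Obj \<C>" for A B
    unfolding uL_ob[OF that, symmetric] by simp
  have "inv (a (Dom \<C> x) (Dom \<C> f) (Dom \<C> g)) \<Zcomp> ((x \<box> (f \<box> g)) \<Zcomp> uL (Cod \<C> f \<^bold>\<box> Cod \<C> g))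
    = (inv (a (Dom \<C> x) (Dom \<C> f) (Dom \<C> g)) \<Zcomp> (x \<box> (f \<box> g))) \<Zcomp> uL (Cod \<C> f \<^bold>\<box> Cod \<C> g)"
    by simp
  also have "\<dots> = (((x \<box> f) \<box> g) \<Zcomp> inv (a I (Cod \<C> f) (Cod \<C> g))) \<Zcomp> uL (Cod \<C> f \<^bold>\<box> Cod \<C> g)"
    using a_natural_inv[of x f g] by simp
  also have "\<dots> = ((x \<box> f) \<box> g) \<Zcomp> (inv (a I (Cod \<C> f) (Cod \<C> g)) \<Zcomp> uL (Cod \<C> f \<^bold>\<box> Cod \<C> g))"
    by simp
  also have "\<dots> = ((x \<box> f) \<box> g) \<Zcomp> (uL (Cod \<C> f) \<box> \<one> (Cod \<C> g))"
    using 1[of "Cod \<C> f" "Cod \<C> g"] by simp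
  finally show ?thesis by simp
qed

end

context symmetric_monoidal
begin

lemma c_Arr [simp]:
  assumes "A \<in> Obj \<C>" "B \<in> Obj \<C>"
  shows "c A B \<in> Arr \<C>" "Dom \<C> (c A B) = A \<^bold>\<box> B" "Cod \<C> (c A B) = B \<^bold>\<box> A"
  using c_hom[OF assms] by simp_all

lemma c_natural_Arr:
  "f \<in> Arr \<C> \<Longrightarrow> g \<in> Arr \<C> \<Longrightarrow>
    (f \<box> g) \<Zcomp> c (Cod \<C> f) (Cod \<C> g) = c (Dom \<C> f) (Dom \<C> g) \<Zcomp> (g \<box> f)"
  using c_natural[of f _ _ g] by simp

text \<open>The symmetry exchanges discarding on the left with discarding on the right.\<close>

lemma c_discard:
  assumes [simp]: "y \<in> Arr \<C>" "Cod \<C> y = I" "A \<in> Obj \<C>"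
  shows "c A (Dom \<C> y) \<Zcomp> ((y \<box> \<one> A) \<Zcomp> uL A) = (\<one> A \<box> y) \<Zcomp> uR A"
proof -
  have "c A (Dom \<C> y) \<Zcomp> ((y \<box> \<one> A) \<Zcomp> uL A) = ((\<one> A \<box> y) \<Zcomp> c A I) \<Zcomp> uL A"
    using c_natural_Arr[of "\<one> A" y] by simp
  also have "\<dots> = (\<one> A \<box> y) \<Zcomp> (c A I \<Zcomp> uL A)" by simp
  finally show ?thesis by (simp add: c_unit)
qed

lemma c_discard':
  assumes [simp]: "y \<in> Arr \<C>" "Cod \<C> y = I" "A \<in> Obj \<C>"
  shows "c (Dom \<C> y) A \<Zcomp> ((\<one> A \<box> y) \<Zcomp> uR A) = (y \<box> \<one> A) \<Zcomp> uL A"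
proof -
  have "c (Dom \<C> y) A \<Zcomp> ((\<one> A \<box> y) \<Zcomp> uR A)
      = (c (Dom \<C> y) A \<Zcomp> c A (Dom \<C> y)) \<Zcomp> ((y \<box> \<one> A) \<Zcomp> uL A)"
    unfolding c_discard[OF assms, symmetric] by simp
  then show ?thesis by (simp add: c_inverse)
qed

end

section \<open>Gathering ancillas in a symmetric linearly distributive category\<close>

context ldc
begin

lemma dist_Arr [simp]:
  assumes "A \<in> Obj \<C>" "B \<in> Obj \<C>" "C \<in> Obj \<C>"
  shows "\<partial>\<^sup>L A B C \<in> Arr \<C>" "Dom \<C> (\<partial>\<^sup>L A B C) = A \<^bold>\<otimes> (B \<^bold>\<oplus> C)" "Cod \<C> (\<partial>\<^sup>L A B C) = (A \<^bold>\<otimes> B) \<^bold>\<oplus> C"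
    "\<partial>\<^sup>R A B C \<in> Arr \<C>" "Dom \<C> (\<partial>\<^sup>R A B C) = (A \<^bold>\<oplus> B) \<^bold>\<otimes> C" "Cod \<C> (\<partial>\<^sup>R A B C) = A \<^bold>\<oplus> (B \<^bold>\<otimes> C)"
  using distL_hom[OF assms] distR_hom[OF assms] by simp_all

lemma distL_natural_Arr:
  assumes "f \<in> Arr \<C>" "g \<in> Arr \<C>" "h \<in> Arr \<C>"
  shows "(f \<otimes> (g \<oplus> h)) \<Zcomp> \<partial>\<^sup>L (Cod \<C> f) (Cod \<C> g) (Cod \<C> h)
    = \<partial>\<^sup>L (Dom \<C> f) (Dom \<C> g) (Dom \<C> h) \<Zcomp> ((f \<otimes> g) \<oplus> h)"
  using distL_natural[of f "Dom \<C> f" "Cod \<C> f" g "Dom \<C> g" "Cod \<C> g" h "Dom \<C> h" "Cod \<C> h"] assms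
  by simp

lemma distR_natural_Arr:
  assumes "f \<in> Arr \<C>" "g \<in> Arr \<C>" "h \<in> Arr \<C>"
  shows "((f \<oplus> g) \<otimes> h) \<Zcomp> \<partial>\<^sup>R (Cod \<C> f) (Cod \<C> g) (Cod \<C> h)
    = \<partial>\<^sup>R (Dom \<C> f) (Dom \<C> g) (Dom \<C> h) \<Zcomp> (f \<oplus> (g \<otimes> h))"
  using distR_natural[of f "Dom \<C> f" "Cod \<C> f" g "Dom \<C> g" "Cod \<C> g" h "Dom \<C> h" "Cod \<C> h"] assms
  by simp

end

context symmetric_ldc
begin

lemma tensor_shuffle_Arr [simp]:
  assumes "X \<in> Obj \<C>" "A \<in> Obj \<C>" "Y \<in> Obj \<C>" "B \<in> Obj \<C>"
  shows "tensor_shuffle \<C> \<S> X A Y B \<in> Arr \<C>"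
    "Dom \<C> (tensor_shuffle \<C> \<S> X A Y B) = (X \<^bold>\<oplus> A) \<^bold>\<otimes> (Y \<^bold>\<oplus> B)"
    "Cod \<C> (tensor_shuffle \<C> \<S> X A Y B) = (X \<^bold>\<oplus> Y) \<^bold>\<oplus> (A \<^bold>\<otimes> B)"
  using assms by (simp_all add: tensor_shuffle_def)

lemma par_shuffle_Arr [simp]:
  assumes "X \<in> Obj \<C>" "A \<in> Obj \<C>" "Y \<in> Obj \<C>" "B \<in> Obj \<C>"
  shows "par_shuffle \<C> \<S> X A Y B \<in> Arr \<C>"
    "Dom \<C> (par_shuffle \<C> \<S> X A Y B) = (X \<^bold>\<oplus> A) \<^bold>\<oplus> (Y \<^bold>\<oplus> B)"
    "Cod \<C> (par_shuffle \<C> \<S> X A Y B) = (X \<^bold>\<oplus> Y) \<^bold>\<oplus> (A \<^bold>\<oplus> B)"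
  using assms by (simp_all add: par_shuffle_def)

text \<open>Naturality moves the discard maps \<open>x\<close>, \<open>y\<close> in front of the distributors, which at the par
  unit are unitors.\<close>

lemma tensor_shuffle_discard:
  assumes [simp]: "x \<in> Arr \<C>" "Cod \<C> x = \<bottom>" "y \<in> Arr \<C>" "Cod \<C> y = \<bottom>" "A \<in> Obj \<C>" "B \<in> Obj \<C>"
  shows "tensor_shuffle \<C> \<S> (Dom \<C> x) A (Dom \<C> y) B
      \<Zcomp> ((((x \<oplus> y) \<Zcomp> u\<^sub>\<oplus>\<^sup>L \<bottom>) \<oplus> \<one> (A \<^bold>\<otimes> B)) \<Zcomp> u\<^sub>\<oplus>\<^sup>L (A \<^bold>\<otimes> B))
    = ((x \<oplus> \<one> A) \<Zcomp> u\<^sub>\<oplus>\<^sup>L A) \<otimes> ((y \<oplus> \<one> B) \<Zcomp> u\<^sub>\<oplus>\<^sup>L B)"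
proof -
  let ?X = "Dom \<C> x" and ?Y = "Dom \<C> y"
  define k where "k = (y \<oplus> \<one> B) \<Zcomp> u\<^sub>\<oplus>\<^sup>L B"
  have k [simp]: "k \<in> Arr \<C>" "Dom \<C> k = ?Y \<^bold>\<oplus> B" "Cod \<C> k = B" by (simp_all add: k_def)
  define r where "r = (\<one> A \<otimes> c\<^sub>\<oplus>\<^bsub>\<S>\<^esub> ?Y B) \<Zcomp> \<partial>\<^sup>L A B ?Y \<Zcomp> c\<^sub>\<oplus>\<^bsub>\<S>\<^esub> (A \<^bold>\<otimes> B) ?Y"
  have r [simp]: "r \<in> Arr \<C>" "Dom \<C> r = A \<^bold>\<otimes> (?Y \<^bold>\<oplus> B)" "Cod \<C> r = ?Y \<^bold>\<oplus> (A \<^bold>\<otimes> B)"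
    by (simp_all add: r_def)
  let ?D = "\<partial>\<^sup>L A B ?Y"
  \<comment> \<open>The second distributor, conjugated by the symmetry, lets \<open>y\<close> act on the right factor only.\<close>
  have rk: "r \<Zcomp> ((y \<oplus> \<one> (A \<^bold>\<otimes> B)) \<Zcomp> u\<^sub>\<oplus>\<^sup>L (A \<^bold>\<otimes> B)) = \<one> A \<otimes> k"
  proof -
    have "r \<Zcomp> ((y \<oplus> \<one> (A \<^bold>\<otimes> B)) \<Zcomp> u\<^sub>\<oplus>\<^sup>L (A \<^bold>\<otimes> B))
        = (\<one> A \<otimes> c\<^sub>\<oplus>\<^bsub>\<S>\<^esub> ?Y B) \<Zcomp> ?D \<Zcomp> ((\<one> (A \<^bold>\<otimes> B) \<oplus> y) \<Zcomp> u\<^sub>\<oplus>\<^sup>R (A \<^bold>\<otimes> B))"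
      using par.c_discard[of y "A \<^bold>\<otimes> B"] by (simp add: r_def)
    also have "\<dots> = (\<one> A \<otimes> c\<^sub>\<oplus>\<^bsub>\<S>\<^esub> ?Y B) \<Zcomp> (?D \<Zcomp> (\<one> (A \<^bold>\<otimes> B) \<oplus> y)) \<Zcomp> u\<^sub>\<oplus>\<^sup>R (A \<^bold>\<otimes> B)"
      by simp
    also have "\<dots> = (\<one> A \<otimes> c\<^sub>\<oplus>\<^bsub>\<S>\<^esub> ?Y B) \<Zcomp> ((\<one> A \<otimes> (\<one> B \<oplus> y)) \<Zcomp> \<partial>\<^sup>L A B \<bottom>) \<Zcomp> u\<^sub>\<oplus>\<^sup>R (A \<^bold>\<otimes> B)"
      by (simp only: distL_natural_Arr[of "\<one> A" "\<one> B" y, simplified])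
    also have "\<dots> = (\<one> A \<otimes> c\<^sub>\<oplus>\<^bsub>\<S>\<^esub> ?Y B) \<Zcomp> (\<one> A \<otimes> (\<one> B \<oplus> y)) \<Zcomp> (\<partial>\<^sup>L A B \<bottom> \<Zcomp> u\<^sub>\<oplus>\<^sup>R (A \<^bold>\<otimes> B))"
      by simp
    also have "\<dots> = \<one> A \<otimes> (c\<^sub>\<oplus>\<^bsub>\<S>\<^esub> ?Y B \<Zcomp> ((\<one> B \<oplus> y) \<Zcomp> u\<^sub>\<oplus>\<^sup>R B))"
      by (simp add: distL_par_unit)
    finally show ?thesis unfolding k_def by (simp only: par.c_discard' assms)
  qed
  have "tensor_shuffle \<C> \<S> ?X A ?Y B
      \<Zcomp> ((((x \<oplus> y) \<Zcomp> u\<^sub>\<oplus>\<^sup>L \<bottom>) \<oplus> \<one> (A \<^bold>\<otimes> B)) \<Zcomp> u\<^sub>\<oplus>\<^sup>L (A \<^bold>\<otimes> B))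
    = (\<partial>\<^sup>R ?X A (?Y \<^bold>\<oplus> B) \<Zcomp> (\<one> ?X \<oplus> r)) \<Zcomp> (a\<^sub>\<oplus> ?X ?Y (A \<^bold>\<otimes> B)
      \<Zcomp> ((((x \<oplus> y) \<Zcomp> u\<^sub>\<oplus>\<^sup>L \<bottom>) \<oplus> \<one> (A \<^bold>\<otimes> B)) \<Zcomp> u\<^sub>\<oplus>\<^sup>L (A \<^bold>\<otimes> B)))"
    unfolding tensor_shuffle_def r_def[symmetric] by simp
  also have "\<dots> = (\<partial>\<^sup>R ?X A (?Y \<^bold>\<oplus> B) \<Zcomp> (\<one> ?X \<oplus> r))
      \<Zcomp> ((x \<oplus> ((y \<oplus> \<one> (A \<^bold>\<otimes> B)) \<Zcomp> u\<^sub>\<oplus>\<^sup>L (A \<^bold>\<otimes> B))) \<Zcomp> u\<^sub>\<oplus>\<^sup>L (A \<^bold>\<otimes> B))"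
    using par.assoc_discard[of x y "A \<^bold>\<otimes> B"] by simp
  also have "\<dots> = (\<partial>\<^sup>R ?X A (?Y \<^bold>\<oplus> B) \<Zcomp> (x \<oplus> (\<one> A \<otimes> k))) \<Zcomp> u\<^sub>\<oplus>\<^sup>L (A \<^bold>\<otimes> B)"
    using rk by simp
  also have "\<dots> = (((x \<oplus> \<one> A) \<otimes> k) \<Zcomp> \<partial>\<^sup>R \<bottom> A B) \<Zcomp> u\<^sub>\<oplus>\<^sup>L (A \<^bold>\<otimes> B)"
    using distR_natural_Arr[of x "\<one> A" k] by simp
  also have "\<dots> = ((x \<oplus> \<one> A) \<otimes> k) \<Zcomp> (\<partial>\<^sup>R \<bottom> A B \<Zcomp> u\<^sub>\<oplus>\<^sup>L (A \<^bold>\<otimes> B))"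
    by simp
  also have "\<dots> = ((x \<oplus> \<one> A) \<Zcomp> u\<^sub>\<oplus>\<^sup>L A) \<otimes> k"
    by (simp add: distR_par_unit)
  finally show ?thesis by (simp only: k_def)
qed

text \<open>The same for par; here the triangle law plays the part of the unit laws of the
  distributors.\<close>

lemma par_shuffle_discard:
  assumes [simp]: "x \<in> Arr \<C>" "Cod \<C> x = \<bottom>" "y \<in> Arr \<C>" "Cod \<C> y = \<bottom>" "A \<in> Obj \<C>" "B \<in> Obj \<C>"
  shows "par_shuffle \<C> \<S> (Dom \<C> x) A (Dom \<C> y) B
      \<Zcomp> ((((x \<oplus> y) \<Zcomp> u\<^sub>\<oplus>\<^sup>L \<bottom>) \<oplus> \<one> (A \<^bold>\<oplus> B)) \<Zcomp> u\<^sub>\<oplus>\<^sup>L (A \<^bold>\<oplus> B))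
    = ((x \<oplus> \<one> A) \<Zcomp> u\<^sub>\<oplus>\<^sup>L A) \<oplus> ((y \<oplus> \<one> B) \<Zcomp> u\<^sub>\<oplus>\<^sup>L B)"
proof -
  let ?X = "Dom \<C> x" and ?Y = "Dom \<C> y"
  define k where "k = (y \<oplus> \<one> B) \<Zcomp> u\<^sub>\<oplus>\<^sup>L B"
  have k [simp]: "k \<in> Arr \<C>" "Dom \<C> k = ?Y \<^bold>\<oplus> B" "Cod \<C> k = B" by (simp_all add: k_def)
  define s where "s = a\<^sub>\<oplus> A ?Y B \<Zcomp> (c\<^sub>\<oplus>\<^bsub>\<S>\<^esub> A ?Y \<oplus> \<one> B) \<Zcomp> inv (a\<^sub>\<oplus> ?Y A B)"
  have s [simp]: "s \<in> Arr \<C>" "Dom \<C> s = A \<^bold>\<oplus> (?Y \<^bold>\<oplus> B)" "Cod \<C> s = ?Y \<^bold>\<oplus> (A \<^bold>\<oplus> B)"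
    by (simp_all add: s_def)
  \<comment> \<open>Moving \<open>Y\<close> past \<open>A\<close> and discarding it there is discarding it in place.\<close>
  have sk: "s \<Zcomp> ((y \<oplus> \<one> (A \<^bold>\<oplus> B)) \<Zcomp> u\<^sub>\<oplus>\<^sup>L (A \<^bold>\<oplus> B)) = \<one> A \<oplus> k"
  proof -
    have "s \<Zcomp> ((y \<oplus> \<one> (A \<^bold>\<oplus> B)) \<Zcomp> u\<^sub>\<oplus>\<^sup>L (A \<^bold>\<oplus> B))
        = (a\<^sub>\<oplus> A ?Y B \<Zcomp> (c\<^sub>\<oplus>\<^bsub>\<S>\<^esub> A ?Y \<oplus> \<one> B))
          \<Zcomp> (inv (a\<^sub>\<oplus> ?Y A B) \<Zcomp> ((y \<oplus> (\<one> A \<oplus> \<one> B)) \<Zcomp> u\<^sub>\<oplus>\<^sup>L (A \<^bold>\<oplus> B)))"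
      unfolding s_def by simp
    also have "\<dots> = (a\<^sub>\<oplus> A ?Y B \<Zcomp> (c\<^sub>\<oplus>\<^bsub>\<S>\<^esub> A ?Y \<oplus> \<one> B)) \<Zcomp> (((y \<oplus> \<one> A) \<Zcomp> u\<^sub>\<oplus>\<^sup>L A) \<oplus> \<one> B)"
      using par.assoc_inv_discard[of y "\<one> A" "\<one> B"] by simp
    also have "\<dots> = a\<^sub>\<oplus> A ?Y B \<Zcomp> ((c\<^sub>\<oplus>\<^bsub>\<S>\<^esub> A ?Y \<Zcomp> ((y \<oplus> \<one> A) \<Zcomp> u\<^sub>\<oplus>\<^sup>L A)) \<oplus> \<one> B)"
      by simp
    also have "\<dots> = a\<^sub>\<oplus> A ?Y B \<Zcomp> (((\<one> A \<oplus> y) \<Zcomp> u\<^sub>\<oplus>\<^sup>R A) \<oplus> \<one> B)"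
      by (simp only: par.c_discard assms)
    also have "\<dots> = (a\<^sub>\<oplus> A ?Y B \<Zcomp> ((\<one> A \<oplus> y) \<oplus> \<one> B)) \<Zcomp> (u\<^sub>\<oplus>\<^sup>R A \<oplus> \<one> B)"
      by simp
    also have "\<dots> = ((\<one> A \<oplus> (y \<oplus> \<one> B)) \<Zcomp> a\<^sub>\<oplus> A \<bottom> B) \<Zcomp> (u\<^sub>\<oplus>\<^sup>R A \<oplus> \<one> B)"
      using par.a_natural_Arr[of "\<one> A" y "\<one> B"] by simp
    also have "\<dots> = (\<one> A \<oplus> (y \<oplus> \<one> B)) \<Zcomp> (a\<^sub>\<oplus> A \<bottom> B \<Zcomp> (u\<^sub>\<oplus>\<^sup>R A \<oplus> \<one> B))"
      by simp
    also have "\<dots> = (\<one> A \<oplus> (y \<oplus> \<one> B)) \<Zcomp> (\<one> A \<oplus> u\<^sub>\<oplus>\<^sup>L B)"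
      by (simp only: par.triangle assms)
    finally show ?thesis unfolding k_def by simp
  qed
  have "par_shuffle \<C> \<S> ?X A ?Y B
      \<Zcomp> ((((x \<oplus> y) \<Zcomp> u\<^sub>\<oplus>\<^sup>L \<bottom>) \<oplus> \<one> (A \<^bold>\<oplus> B)) \<Zcomp> u\<^sub>\<oplus>\<^sup>L (A \<^bold>\<oplus> B))
    = (inv (a\<^sub>\<oplus> ?X A (?Y \<^bold>\<oplus> B)) \<Zcomp> (\<one> ?X \<oplus> s)) \<Zcomp> (a\<^sub>\<oplus> ?X ?Y (A \<^bold>\<oplus> B)
      \<Zcomp> ((((x \<oplus> y) \<Zcomp> u\<^sub>\<oplus>\<^sup>L \<bottom>) \<oplus> \<one> (A \<^bold>\<oplus> B)) \<Zcomp> u\<^sub>\<oplus>\<^sup>L (A \<^bold>\<oplus> B)))"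
    unfolding par_shuffle_def s_def[symmetric] by simp
  also have "\<dots> = (inv (a\<^sub>\<oplus> ?X A (?Y \<^bold>\<oplus> B)) \<Zcomp> (\<one> ?X \<oplus> s))
      \<Zcomp> ((x \<oplus> ((y \<oplus> \<one> (A \<^bold>\<oplus> B)) \<Zcomp> u\<^sub>\<oplus>\<^sup>L (A \<^bold>\<oplus> B))) \<Zcomp> u\<^sub>\<oplus>\<^sup>L (A \<^bold>\<oplus> B))"
    using par.assoc_discard[of x y "A \<^bold>\<oplus> B"] by simp
  also have "\<dots> = inv (a\<^sub>\<oplus> ?X A (?Y \<^bold>\<oplus> B)) \<Zcomp> ((x \<oplus> (\<one> A \<oplus> k)) \<Zcomp> u\<^sub>\<oplus>\<^sup>L (A \<^bold>\<oplus> B))"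
    using sk by simp
  also have "\<dots> = ((x \<oplus> \<one> A) \<Zcomp> u\<^sub>\<oplus>\<^sup>L A) \<oplus> k"
    using par.assoc_inv_discard[of x "\<one> A" k] by simp
  finally show ?thesis by (simp only: k_def)
qed

end

context isomix_category
begin

lemma mix_Arr [simp]: "\<m> \<in> Arr \<C>" "Dom \<C> \<m> = \<bottom>" "Cod \<C> \<m> = \<top>"
  using isos_Arr[OF mix_iso] by simp_all

declare mix_iso [simp]

lemma mx_Arr [simp]:
  assumes "A \<in> Obj \<C>" "B \<in> Obj \<C>"
  shows "mx A B \<in> Arr \<C>" "Dom \<C> (mx A B) = A \<^bold>\<otimes> B" "Cod \<C> (mx A B) = A \<^bold>\<oplus> B"
  using assms by (simp_all add: mx_def)

lemma mx_natural_left: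
  assumes [simp]: "f \<in> Arr \<C>" "B \<in> Obj \<C>"
  shows "(f \<otimes> \<one> B) \<Zcomp> mx (Cod \<C> f) B = mx (Dom \<C> f) B \<Zcomp> (f \<oplus> \<one> B)"
proof -
  define w where "w = inv (u\<^sub>\<oplus>\<^sup>L B) \<Zcomp> (\<m> \<oplus> \<one> B)"
  have w [simp]: "w \<in> Arr \<C>" "Dom \<C> w = B" "Cod \<C> w = \<top> \<^bold>\<oplus> B" by (simp_all add: w_def)
  have mx: "mx A B = (\<one> A \<otimes> w) \<Zcomp> (\<partial>\<^sup>L A \<top> B \<Zcomp> (u\<^sub>\<otimes>\<^sup>R A \<oplus> \<one> B))" if "A \<in> Obj \<C>" for A
    using that by (simp add: mx_def w_def)
  let ?A = "Dom \<C> f" and ?A' = "Cod \<C> f"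
  have "(f \<otimes> \<one> B) \<Zcomp> mx ?A' B
      = (\<one> ?A \<otimes> w) \<Zcomp> ((f \<otimes> (\<one> \<top> \<oplus> \<one> B)) \<Zcomp> \<partial>\<^sup>L ?A' \<top> B) \<Zcomp> (u\<^sub>\<otimes>\<^sup>R ?A' \<oplus> \<one> B)"
    by (simp add: mx)
  also have "\<dots> = (\<one> ?A \<otimes> w) \<Zcomp> (\<partial>\<^sup>L ?A \<top> B \<Zcomp> ((f \<otimes> \<one> \<top>) \<oplus> \<one> B)) \<Zcomp> (u\<^sub>\<otimes>\<^sup>R ?A' \<oplus> \<one> B)"
    using distL_natural_Arr[of f "\<one> \<top>" "\<one> B"] by simp
  also have "\<dots> = (\<one> ?A \<otimes> w) \<Zcomp> \<partial>\<^sup>L ?A \<top> B \<Zcomp> (((f \<otimes> \<one> \<top>) \<Zcomp> u\<^sub>\<otimes>\<^sup>R ?A') \<oplus> \<one> B)"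
    by simp
  also have "\<dots> = (\<one> ?A \<otimes> w) \<Zcomp> \<partial>\<^sup>L ?A \<top> B \<Zcomp> ((u\<^sub>\<otimes>\<^sup>R ?A \<Zcomp> f) \<oplus> \<one> B)"
    by (simp only: tensor.uR_natural_Arr assms)
  also have "\<dots> = mx ?A B \<Zcomp> (f \<oplus> \<one> B)"
    by (simp add: mx)
  finally show ?thesis .
qed

text \<open>By the unit law of the distributor the mix map at \<open>\<bottom>\<close> is, up to unitors, the map \<open>\<m>\<close>; the two
  par unitors at \<open>\<bottom>\<close> that appear on the way cancel because they agree.\<close>

lemma mx_bottom_right:
  assumes [simp]: "A \<in> Obj \<C>"
  shows "mx A \<bottom> \<Zcomp> u\<^sub>\<oplus>\<^sup>R A = (\<one> A \<otimes> \<m>) \<Zcomp> u\<^sub>\<otimes>\<^sup>R A"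
proof -
  have m: "inv (u\<^sub>\<oplus>\<^sup>L \<bottom>) \<Zcomp> ((\<m> \<oplus> \<one> \<bottom>) \<Zcomp> u\<^sub>\<oplus>\<^sup>R \<top>) = \<m>"
    using par.uR_natural_Arr[of "\<m>"] by (simp flip: par.uL_unit_eq_uR_unit)
  have "mx A \<bottom> \<Zcomp> u\<^sub>\<oplus>\<^sup>R A = (\<one> A \<otimes> (inv (u\<^sub>\<oplus>\<^sup>L \<bottom>) \<Zcomp> (\<m> \<oplus> \<one> \<bottom>)))
      \<Zcomp> \<partial>\<^sup>L A \<top> \<bottom> \<Zcomp> ((u\<^sub>\<otimes>\<^sup>R A \<oplus> \<one> \<bottom>) \<Zcomp> u\<^sub>\<oplus>\<^sup>R A)"
    by (simp add: mx_def)
  also have "\<dots> = (\<one> A \<otimes> (inv (u\<^sub>\<oplus>\<^sup>L \<bottom>) \<Zcomp> (\<m> \<oplus> \<one> \<bottom>)))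
      \<Zcomp> (\<partial>\<^sup>L A \<top> \<bottom> \<Zcomp> u\<^sub>\<oplus>\<^sup>R (A \<^bold>\<otimes> \<top>)) \<Zcomp> u\<^sub>\<otimes>\<^sup>R A"
    using par.uR_natural_Arr[of "u\<^sub>\<otimes>\<^sup>R A"] by simp
  also have "\<dots> = (\<one> A \<otimes> (inv (u\<^sub>\<oplus>\<^sup>L \<bottom>) \<Zcomp> (\<m> \<oplus> \<one> \<bottom>)))
      \<Zcomp> (\<one> A \<otimes> u\<^sub>\<oplus>\<^sup>R \<top>) \<Zcomp> u\<^sub>\<otimes>\<^sup>R A"
    by (simp add: distL_par_unit)
  also have "\<dots> = (\<one> A \<otimes> (inv (u\<^sub>\<oplus>\<^sup>L \<bottom>) \<Zcomp> ((\<m> \<oplus> \<one> \<bottom>) \<Zcomp> u\<^sub>\<oplus>\<^sup>R \<top>))) \<Zcomp> u\<^sub>\<otimes>\<^sup>R A"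
    by simp
  finally show ?thesis by (simp only: m)
qed

end

section \<open>Transport of structure along a bijection\<close>

text \<open>Only the source is assumed to be a category. The structure on \<open>\<E>\<close> is required to correspond to
  that of the source, which forces \<open>\<E>\<close> to satisfy the same equations.\<close>

locale category_isomorphism = category \<C>
  for \<C> :: "('o, 'a, 'x) cat_scheme" (structure) +
  fixes \<E> :: "('p, 'b, 'y) cat_scheme" and R :: "('o, 'a, 'p, 'b, 'z) fun_data_scheme"
  assumes fobj_bij: "bij_betw (fobj R) (Obj \<C>) (Obj \<E>)"
    and farr_bij: "bij_betw (farr R) (Arr \<C>) (Arr \<E>)"
    and Dom_farr [simp]: "f \<in> Arr \<C> \<Longrightarrow> Dom \<E> (farr R f) = fobj R (Dom \<C> f)"
    and Cod_farr [simp]: "f \<in> Arr \<C> \<Longrightarrow> Cod \<E> (farr R f) = fobj R (Cod \<C> f)"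
    and Ident_fobj [simp]: "A \<in> Obj \<C> \<Longrightarrow> \<one>\<^bsub>\<E>\<^esub> (fobj R A) = farr R (\<one> A)"
    and Comp_farr [simp]:
      "\<lbrakk>f \<in> Arr \<C>; g \<in> Arr \<C>; Cod \<C> f = Dom \<C> g\<rbrakk> \<Longrightarrow> farr R f \<Zcomp>\<^bsub>\<E>\<^esub> farr R g = farr R (f \<Zcomp> g)"
begin

lemma fobj_Obj [simp]: "A \<in> Obj \<C> \<Longrightarrow> fobj R A \<in> Obj \<E>"
  using fobj_bij by (rule bij_betw_apply)

lemma farr_Arr [simp]: "f \<in> Arr \<C> \<Longrightarrow> farr R f \<in> Arr \<E>"
  using farr_bij by (rule bij_betw_apply)

lemma fobj_eq_iff [simp]: "A \<in> Obj \<C> \<Longrightarrow> B \<in> Obj \<C> \<Longrightarrow> fobj R A = fobj R B \<longleftrightarrow> A = B"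
  using bij_betw_imp_inj_on[OF fobj_bij] by (rule inj_on_eq_iff)

lemma Obj_E:
  assumes "A \<in> Obj \<E>"
  obtains A' where "A' \<in> Obj \<C>" "A = fobj R A'"
  using assms bij_betw_imp_surj_on[OF fobj_bij] by blast

lemma Arr_E:
  assumes "f \<in> Arr \<E>"
  obtains f' where "f' \<in> Arr \<C>" "f = farr R f'"
  using assms bij_betw_imp_surj_on[OF farr_bij] by blast

lemma hom_E:
  assumes "f \<in> hom \<E> A B"
  obtains f' where "f' \<in> Arr \<C>" "f = farr R f'" "A = fobj R (Dom \<C> f')" "B = fobj R (Cod \<C> f')"
proof -
  have "f \<in> Arr \<E>" using assms by simp
  then show ?thesis using assms that by (elim Arr_E) auto
qed

lemma target_category: "category \<E>"
proof
  show "Dom \<E> f \<in> Obj \<E>" "Cod \<E> f \<in> Obj \<E>" if "f \<in> Arr \<E>" for f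
    using that by (elim Arr_E, simp)+
  show "\<one>\<^bsub>\<E>\<^esub> A \<in> hom \<E> A A" if "A \<in> Obj \<E>" for A
    using that by (elim Obj_E) simp
  show "f \<Zcomp>\<^bsub>\<E>\<^esub> g \<in> hom \<E> A B" if "f \<in> hom \<E> A C" "g \<in> hom \<E> C B" for f g A B C
    using that by (elim hom_E) simp
  show "\<one>\<^bsub>\<E>\<^esub> A \<Zcomp>\<^bsub>\<E>\<^esub> f = f" "f \<Zcomp>\<^bsub>\<E>\<^esub> \<one>\<^bsub>\<E>\<^esub> B = f" if "f \<in> hom \<E> A B" for f A B
    using that by (elim hom_E, simp)+
  show "(f \<Zcomp>\<^bsub>\<E>\<^esub> g) \<Zcomp>\<^bsub>\<E>\<^esub> h = f \<Zcomp>\<^bsub>\<E>\<^esub> (g \<Zcomp>\<^bsub>\<E>\<^esub> h)"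
    if "f \<in> hom \<E> A B" "g \<in> hom \<E> B C" "h \<in> hom \<E> C D" for f g h A B C D
    using that by (elim hom_E) simp
qed

sublocale target: category \<E>
  by (rule target_category)

lemma functor_on: "functor_on \<C> \<E> R"
  by unfold_locales auto

lemma farr_isos [simp]:
  assumes "f \<in> isos \<C> A B"
  shows "farr R f \<in> isos \<E> (fobj R A) (fobj R B)"
proof -
  note facts = isos_Arr[OF assms] inv_arr_isos[OF assms]
  have "A \<in> Obj \<C>" "B \<in> Obj \<C>" using Dom_Cod_Obj[of f] facts by auto
  then show ?thesis using facts by (intro target.isosI[where g = "farr R (inv f)"]) auto
qed

lemma farr_inv_arr:
  assumes "f \<in> isos \<C> A B"
  shows "inv\<^bsub>\<E>\<^esub> (farr R f) = farr R (inv f)"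
proof -
  note facts = isos_Arr[OF assms] inv_arr_isos[OF assms]
  have "A \<in> Obj \<C>" "B \<in> Obj \<C>" using Dom_Cod_Obj[of f] facts by auto
  then show ?thesis using facts by (intro target.inv_arr_unique) auto
qed

lemma inverse_isomorphism:
  fixes R' :: "('p, 'b, 'o, 'a, 'w) fun_data_scheme"
  assumes obj: "\<And>A. A \<in> Obj \<C> \<Longrightarrow> fobj R' (fobj R A) = A"
    and arr: "\<And>f. f \<in> Arr \<C> \<Longrightarrow> farr R' (farr R f) = f"
  shows "category_isomorphism \<E> \<C> R'" "mutually_inverse \<C> \<E> R R'"
proof -
  have obj': "fobj R' A \<in> Obj \<C>" "fobj R (fobj R' A) = A" if "A \<in> Obj \<E>" for A
    using that obj by (elim Obj_E, simp)+
  have arr': "farr R' f \<in> Arr \<C>" "farr R (farr R' f) = f" if "f \<in> Arr \<E>" for f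
    using that arr by (elim Arr_E, simp)+
  show "mutually_inverse \<C> \<E> R R'"
    unfolding mutually_inverse_def using obj obj' arr arr' by blast
  show "category_isomorphism \<E> \<C> R'"
  proof
    show "bij_betw (fobj R') (Obj \<E>) (Obj \<C>)"
      by (rule bij_betw_byWitness[where f' = "fobj R"]) (use obj obj' in auto)
    show "bij_betw (farr R') (Arr \<E>) (Arr \<C>)"
      by (rule bij_betw_byWitness[where f' = "farr R"]) (use arr arr' in auto)
    show "Dom \<C> (farr R' f) = fobj R' (Dom \<E> f)" "Cod \<C> (farr R' f) = fobj R' (Cod \<E> f)"
      if "f \<in> Arr \<E>" for f
      using that obj arr by (elim Arr_E, simp)+
    show "\<one> (fobj R' A) = farr R' (\<one>\<^bsub>\<E>\<^esub> A)" if "A \<in> Obj \<E>" for A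
      using that obj arr by (elim Obj_E) simp
    show "farr R' f \<Zcomp> farr R' g = farr R' (f \<Zcomp>\<^bsub>\<E>\<^esub> g)"
      if "f \<in> Arr \<E>" "g \<in> Arr \<E>" "Cod \<E> f = Dom \<E> g" for f g
      using that obj arr by (elim Arr_E) simp
  qed
qed

end

text \<open>Stated for an arbitrary monoidal structure so that it serves both tensor and par.\<close>

locale monoidal_transport =
  category_isomorphism \<C> \<E> R + monoidal \<C> ob ar I a uL uR
  for \<C> :: "('o, 'a, 'x) cat_scheme" (structure) and \<E> :: "('p, 'b, 'y) cat_scheme"
    and R :: "('o, 'a, 'p, 'b, 'z) fun_data_scheme"
    and ob (infixr "\<^bold>\<box>" 70) and ar (infixr "\<box>" 70) and I a uL uR +
  fixes ob' (infixr "\<^bold>\<box>''" 70) and ar' (infixr "\<box>''" 70) and I' a' uL' uR'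
  assumes ob' [simp]:
      "A \<in> Obj \<C> \<Longrightarrow> B \<in> Obj \<C> \<Longrightarrow> fobj R A \<^bold>\<box>' fobj R B = fobj R (A \<^bold>\<box> B)"
    and ar' [simp]:
      "f \<in> Arr \<C> \<Longrightarrow> g \<in> Arr \<C> \<Longrightarrow> farr R f \<box>' farr R g = farr R (f \<box> g)"
    and I' [simp]: "I' = fobj R I"
    and a' [simp]: "A \<in> Obj \<C> \<Longrightarrow> B \<in> Obj \<C> \<Longrightarrow> C \<in> Obj \<C> \<Longrightarrow>
      a' (fobj R A) (fobj R B) (fobj R C) = farr R (a A B C)"
    and uL' [simp]: "A \<in> Obj \<C> \<Longrightarrow> uL' (fobj R A) = farr R (uL A)"
    and uR' [simp]: "A \<in> Obj \<C> \<Longrightarrow> uR' (fobj R A) = farr R (uR A)"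
begin

lemma target_monoidal: "monoidal \<E> ob' ar' I' a' uL' uR'"
proof
  show "I' \<in> Obj \<E>" by simp
  show "A \<^bold>\<box>' B \<in> Obj \<E>" if "A \<in> Obj \<E>" "B \<in> Obj \<E>" for A B
    using that by (elim Obj_E) simp
  show "f \<box>' g \<in> hom \<E> (A \<^bold>\<box>' B) (A' \<^bold>\<box>' B')" if "f \<in> hom \<E> A A'" "g \<in> hom \<E> B B'" for f g A A' B B'
    using that by (elim hom_E) simp
  show "\<one>\<^bsub>\<E>\<^esub> A \<box>' \<one>\<^bsub>\<E>\<^esub> B = \<one>\<^bsub>\<E>\<^esub> (A \<^bold>\<box>' B)" if "A \<in> Obj \<E>" "B \<in> Obj \<E>" for A B
    using that by (elim Obj_E) simp
  show "(f \<Zcomp>\<^bsub>\<E>\<^esub> f') \<box>' (g \<Zcomp>\<^bsub>\<E>\<^esub> g') = (f \<box>' g) \<Zcomp>\<^bsub>\<E>\<^esub> (f' \<box>' g')"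
    if "f \<in> hom \<E> A A'" "f' \<in> hom \<E> A' A''" "g \<in> hom \<E> B B'" "g' \<in> hom \<E> B' B''"
    for f f' g g' A A' A'' B B' B''
    using that by (elim hom_E) simp
  show "a' A B C \<in> isos \<E> (A \<^bold>\<box>' (B \<^bold>\<box>' C)) ((A \<^bold>\<box>' B) \<^bold>\<box>' C)"
    if "A \<in> Obj \<E>" "B \<in> Obj \<E>" "C \<in> Obj \<E>" for A B C
    using that by (elim Obj_E) simp
  show "uL' A \<in> isos \<E> (I' \<^bold>\<box>' A) A" "uR' A \<in> isos \<E> (A \<^bold>\<box>' I') A" if "A \<in> Obj \<E>" for A
    using that by (elim Obj_E, simp)+
  show "(f \<box>' (g \<box>' h)) \<Zcomp>\<^bsub>\<E>\<^esub> a' A' B' C' = a' A B C \<Zcomp>\<^bsub>\<E>\<^esub> ((f \<box>' g) \<box>' h)"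
    if "f \<in> hom \<E> A A'" "g \<in> hom \<E> B B'" "h \<in> hom \<E> C C'" for f g h A A' B B' C C'
    using that by (elim hom_E) (simp add: a_natural_Arr)
  show "(\<one>\<^bsub>\<E>\<^esub> I' \<box>' f) \<Zcomp>\<^bsub>\<E>\<^esub> uL' A' = uL' A \<Zcomp>\<^bsub>\<E>\<^esub> f" if "f \<in> hom \<E> A A'" for f A A'
    using that by (elim hom_E) (simp add: uL_natural_Arr)
  show "(f \<box>' \<one>\<^bsub>\<E>\<^esub> I') \<Zcomp>\<^bsub>\<E>\<^esub> uR' A' = uR' A \<Zcomp>\<^bsub>\<E>\<^esub> f" if "f \<in> hom \<E> A A'" for f A A'
    using that by (elim hom_E) (simp add: uR_natural_Arr)
  show "a' A B (C \<^bold>\<box>' D) \<Zcomp>\<^bsub>\<E>\<^esub> a' (A \<^bold>\<box>' B) C D =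
      (\<one>\<^bsub>\<E>\<^esub> A \<box>' a' B C D) \<Zcomp>\<^bsub>\<E>\<^esub> a' A (B \<^bold>\<box>' C) D \<Zcomp>\<^bsub>\<E>\<^esub> (a' A B C \<box>' \<one>\<^bsub>\<E>\<^esub> D)"
    if "A \<in> Obj \<E>" "B \<in> Obj \<E>" "C \<in> Obj \<E>" "D \<in> Obj \<E>" for A B C D
    using that by (elim Obj_E) (simp add: pentagon)
  show "a' A I' B \<Zcomp>\<^bsub>\<E>\<^esub> (uR' A \<box>' \<one>\<^bsub>\<E>\<^esub> B) = \<one>\<^bsub>\<E>\<^esub> A \<box>' uL' B"
    if "A \<in> Obj \<E>" "B \<in> Obj \<E>" for A B
    using that by (elim Obj_E) (simp add: triangle)
qed

end

locale symmetric_monoidal_transport =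
  monoidal_transport \<C> \<E> R ob ar I a uL uR ob' ar' I' a' uL' uR' +
  symmetric_monoidal \<C> ob ar I a uL uR c
  for \<C> :: "('o, 'a, 'x) cat_scheme" (structure) and \<E> :: "('p, 'b, 'y) cat_scheme"
    and R :: "('o, 'a, 'p, 'b, 'z) fun_data_scheme"
    and ob (infixr "\<^bold>\<box>" 70) and ar (infixr "\<box>" 70) and I a uL uR
    and ob' (infixr "\<^bold>\<box>''" 70) and ar' (infixr "\<box>''" 70) and I' a' uL' uR' and c +
  fixes c'
  assumes c' [simp]: "A \<in> Obj \<C> \<Longrightarrow> B \<in> Obj \<C> \<Longrightarrow> c' (fobj R A) (fobj R B) = farr R (c A B)"
begin

lemma target_symmetric_monoidal: "symmetric_monoidal \<E> ob' ar' I' a' uL' uR' c'"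
proof (intro symmetric_monoidal.intro symmetric_monoidal_axioms.intro)
  show "monoidal \<E> ob' ar' I' a' uL' uR'" by (rule target_monoidal)
  show "c' A B \<in> hom \<E> (A \<^bold>\<box>' B) (B \<^bold>\<box>' A)" if "A \<in> Obj \<E>" "B \<in> Obj \<E>" for A B
    using that by (elim Obj_E) simp
  show "(f \<box>' g) \<Zcomp>\<^bsub>\<E>\<^esub> c' A' B' = c' A B \<Zcomp>\<^bsub>\<E>\<^esub> (g \<box>' f)"
    if "f \<in> hom \<E> A A'" "g \<in> hom \<E> B B'" for f g A A' B B'
    using that by (elim hom_E) (simp add: c_natural_Arr)
  show "c' A B \<Zcomp>\<^bsub>\<E>\<^esub> c' B A = \<one>\<^bsub>\<E>\<^esub> (A \<^bold>\<box>' B)" if "A \<in> Obj \<E>" "B \<in> Obj \<E>" for A B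
    using that by (elim Obj_E) (simp add: c_inverse)
  show "c' A I' \<Zcomp>\<^bsub>\<E>\<^esub> uL' A = uR' A" if "A \<in> Obj \<E>" for A
    using that by (elim Obj_E) (simp add: c_unit)
  show "a' A B C \<Zcomp>\<^bsub>\<E>\<^esub> c' (A \<^bold>\<box>' B) C \<Zcomp>\<^bsub>\<E>\<^esub> a' C A B =
      (\<one>\<^bsub>\<E>\<^esub> A \<box>' c' B C) \<Zcomp>\<^bsub>\<E>\<^esub> a' A C B \<Zcomp>\<^bsub>\<E>\<^esub> (c' A C \<box>' \<one>\<^bsub>\<E>\<^esub> B)"
    if "A \<in> Obj \<E>" "B \<in> Obj \<E>" "C \<in> Obj \<E>" for A B C
    using that hexagon by (elim Obj_E) simp
qed

end

text \<open>The last four assumptions make \<open>R\<close> a strict functor: its comparison maps are identities of \<open>\<E>\<close>.\<close>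

locale isomix_isomorphism =
  isomix_category \<C> + category_isomorphism \<C> \<E> R +
  tensor_map: monoidal_transport \<C> \<E> R "tensor_obj \<C>" "tensor \<C>" "\<top>" "a\<^sub>\<otimes>" "u\<^sub>\<otimes>\<^sup>L" "u\<^sub>\<otimes>\<^sup>R"
    "tensor_obj \<E>" "tensor \<E>" "\<top>\<^bsub>\<E>\<^esub>" "a\<^sub>\<otimes>\<^bsub>\<E>\<^esub>" "u\<^sub>\<otimes>\<^sup>L\<^bsub>\<E>\<^esub>" "u\<^sub>\<otimes>\<^sup>R\<^bsub>\<E>\<^esub>" +
  par_map: monoidal_transport \<C> \<E> R "par_obj \<C>" "par \<C>" "\<bottom>" "a\<^sub>\<oplus>" "u\<^sub>\<oplus>\<^sup>L" "u\<^sub>\<oplus>\<^sup>R"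
    "par_obj \<E>" "par \<E>" "\<bottom>\<^bsub>\<E>\<^esub>" "a\<^sub>\<oplus>\<^bsub>\<E>\<^esub>" "u\<^sub>\<oplus>\<^sup>L\<^bsub>\<E>\<^esub>" "u\<^sub>\<oplus>\<^sup>R\<^bsub>\<E>\<^esub>"
  for \<C> :: "('o, 'a, 'x) isomix_data_scheme" (structure)
    and \<E> :: "('p, 'b, 'y) isomix_data_scheme"
    and R :: "('o, 'a, 'p, 'b, 'z) isomix_fun_data_scheme" +
  assumes distL_farr [simp]: "A \<in> Obj \<C> \<Longrightarrow> B \<in> Obj \<C> \<Longrightarrow> C \<in> Obj \<C> \<Longrightarrow>
      \<partial>\<^sup>L\<^bsub>\<E>\<^esub> (fobj R A) (fobj R B) (fobj R C) = farr R (\<partial>\<^sup>L A B C)"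
    and distR_farr [simp]: "A \<in> Obj \<C> \<Longrightarrow> B \<in> Obj \<C> \<Longrightarrow> C \<in> Obj \<C> \<Longrightarrow>
      \<partial>\<^sup>R\<^bsub>\<E>\<^esub> (fobj R A) (fobj R B) (fobj R C) = farr R (\<partial>\<^sup>R A B C)"
    and mix_farr [simp]: "\<m>\<^bsub>\<E>\<^esub> = farr R \<m>"
    and m_tensor_R [simp]: "A \<in> Obj \<C> \<Longrightarrow> B \<in> Obj \<C> \<Longrightarrow>
      m_tensor R A B = \<one>\<^bsub>\<E>\<^esub> (fobj R A \<^bold>\<otimes>\<^bsub>\<E>\<^esub> fobj R B)"
    and m_top_R [simp]: "m_top R = \<one>\<^bsub>\<E>\<^esub> \<top>\<^bsub>\<E>\<^esub>"
    and n_par_R [simp]: "A \<in> Obj \<C> \<Longrightarrow> B \<in> Obj \<C> \<Longrightarrow>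
      n_par R A B = \<one>\<^bsub>\<E>\<^esub> (fobj R A \<^bold>\<oplus>\<^bsub>\<E>\<^esub> fobj R B)"
    and n_bot_R [simp]: "n_bot R = \<one>\<^bsub>\<E>\<^esub> \<bottom>\<^bsub>\<E>\<^esub>"
begin

lemma target_ldc: "ldc \<E>"
proof (intro ldc.intro ldc_axioms.intro)
  show "category \<E>" by (rule target_category)
  show "monoidal \<E> (tensor_obj \<E>) (tensor \<E>) \<top>\<^bsub>\<E>\<^esub> a\<^sub>\<otimes>\<^bsub>\<E>\<^esub> u\<^sub>\<otimes>\<^sup>L\<^bsub>\<E>\<^esub> u\<^sub>\<otimes>\<^sup>R\<^bsub>\<E>\<^esub>"
    by (rule tensor_map.target_monoidal)
  show "monoidal \<E> (par_obj \<E>) (par \<E>) \<bottom>\<^bsub>\<E>\<^esub> a\<^sub>\<oplus>\<^bsub>\<E>\<^esub> u\<^sub>\<oplus>\<^sup>L\<^bsub>\<E>\<^esub> u\<^sub>\<oplus>\<^sup>R\<^bsub>\<E>\<^esub>"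
    by (rule par_map.target_monoidal)
qed (elim Obj_E hom_E;
    use distL_natural_Arr distR_natural_Arr distL_tensor_unit distR_tensor_unit distL_par_unit
      distR_par_unit distL_tensor_assoc distR_tensor_assoc distL_par_assoc distR_par_assoc
      distL_distR_tensor distL_distR_par in simp)+

lemma target_isomix: "isomix_category \<E>"
proof (intro isomix_category.intro isomix_category_axioms.intro)
  show "\<m>\<^bsub>\<E>\<^esub> \<in> isos \<E> \<bottom>\<^bsub>\<E>\<^esub> \<top>\<^bsub>\<E>\<^esub>" by simp
qed (rule target_ldc)

sublocale target: isomix_category \<E>
  by (rule target_isomix)

lemma strict_isomix_functor: "strict_isomix_functor \<C> \<E> R"
proof -
  interpret functor_on \<C> \<E> R by (rule functor_on)
  show ?thesis
  proof
    show "m_tensor R A B \<in> hom \<E> (fobj R A \<^bold>\<otimes>\<^bsub>\<E>\<^esub> fobj R B) (fobj R (A \<^bold>\<otimes> B))"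
      "n_par R A B \<in> hom \<E> (fobj R (A \<^bold>\<oplus> B)) (fobj R A \<^bold>\<oplus>\<^bsub>\<E>\<^esub> fobj R B)"
      if "A \<in> Obj \<C>" "B \<in> Obj \<C>" for A B
      using that by simp_all
    show "m_top R \<in> hom \<E> \<top>\<^bsub>\<E>\<^esub> (fobj R \<top>)" "n_bot R \<in> hom \<E> (fobj R \<bottom>) \<bottom>\<^bsub>\<E>\<^esub>"
      by simp_all
    show "inv\<^bsub>\<E>\<^esub> \<m>\<^bsub>\<E>\<^esub> = m_top R \<Zcomp>\<^bsub>\<E>\<^esub> farr R (inv \<m>) \<Zcomp>\<^bsub>\<E>\<^esub> n_bot R"
      using farr_inv_arr[OF mix_iso] by simp
  qed auto
qed

end

definition strict_functor ::
  "('p, 'b, 'y) isomix_data_scheme \<Rightarrow> ('o \<Rightarrow> 'p) \<Rightarrow> ('a \<Rightarrow> 'b) \<Rightarrow> ('o, 'a, 'p, 'b) isomix_fun_data" where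
  "strict_functor \<E> \<psi> \<Psi> =
    \<lparr>fobj = \<psi>, farr = \<Psi>,
     m_tensor = (\<lambda>A B. \<one>\<^bsub>\<E>\<^esub> (\<psi> A \<^bold>\<otimes>\<^bsub>\<E>\<^esub> \<psi> B)), m_top = \<one>\<^bsub>\<E>\<^esub> \<top>\<^bsub>\<E>\<^esub>,
     n_par = (\<lambda>A B. \<one>\<^bsub>\<E>\<^esub> (\<psi> A \<^bold>\<oplus>\<^bsub>\<E>\<^esub> \<psi> B)), n_bot = \<one>\<^bsub>\<E>\<^esub> \<bottom>\<^bsub>\<E>\<^esub>\<rparr>"

lemma strict_functor_simps [simp]:
  "fobj (strict_functor \<E> \<psi> \<Psi>) = \<psi>" "farr (strict_functor \<E> \<psi> \<Psi>) = \<Psi>"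
  "m_tensor (strict_functor \<E> \<psi> \<Psi>) A B = \<one>\<^bsub>\<E>\<^esub> (\<psi> A \<^bold>\<otimes>\<^bsub>\<E>\<^esub> \<psi> B)"
  "m_top (strict_functor \<E> \<psi> \<Psi>) = \<one>\<^bsub>\<E>\<^esub> \<top>\<^bsub>\<E>\<^esub>"
  "n_par (strict_functor \<E> \<psi> \<Psi>) A B = \<one>\<^bsub>\<E>\<^esub> (\<psi> A \<^bold>\<oplus>\<^bsub>\<E>\<^esub> \<psi> B)"
  "n_bot (strict_functor \<E> \<psi> \<Psi>) = \<one>\<^bsub>\<E>\<^esub> \<bottom>\<^bsub>\<E>\<^esub>"
  by (simp_all add: strict_functor_def)

locale symmetric_isomix_isomorphism =
  isomix_isomorphism \<C> \<E> R + symmetric_isomix_category \<C> \<S>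
  for \<C> :: "('o, 'a, 'x) isomix_data_scheme" (structure) and \<S> :: "('o, 'a) symmetry"
    and \<E> :: "('p, 'b, 'y) isomix_data_scheme" and \<T> :: "('p, 'b) symmetry"
    and R :: "('o, 'a, 'p, 'b, 'z) isomix_fun_data_scheme" +
  assumes sym_tensor_farr [simp]: "A \<in> Obj \<C> \<Longrightarrow> B \<in> Obj \<C> \<Longrightarrow>
      c\<^sub>\<otimes>\<^bsub>\<T>\<^esub> (fobj R A) (fobj R B) = farr R (c\<^sub>\<otimes>\<^bsub>\<S>\<^esub> A B)"
    and sym_par_farr [simp]: "A \<in> Obj \<C> \<Longrightarrow> B \<in> Obj \<C> \<Longrightarrow>
      c\<^sub>\<oplus>\<^bsub>\<T>\<^esub> (fobj R A) (fobj R B) = farr R (c\<^sub>\<oplus>\<^bsub>\<S>\<^esub> A B)"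
begin

lemma target_symmetric_isomix: "symmetric_isomix_category \<E> \<T>"
proof (intro symmetric_isomix_category.intro symmetric_ldc.intro symmetric_ldc_axioms.intro)
  interpret t: symmetric_monoidal_transport \<C> \<E> R "tensor_obj \<C>" "tensor \<C>" "\<top>" "a\<^sub>\<otimes>"
    "u\<^sub>\<otimes>\<^sup>L" "u\<^sub>\<otimes>\<^sup>R" "tensor_obj \<E>" "tensor \<E>" "\<top>\<^bsub>\<E>\<^esub>" "a\<^sub>\<otimes>\<^bsub>\<E>\<^esub>" "u\<^sub>\<otimes>\<^sup>L\<^bsub>\<E>\<^esub>"
    "u\<^sub>\<otimes>\<^sup>R\<^bsub>\<E>\<^esub>" "c\<^sub>\<otimes>\<^bsub>\<S>\<^esub>" "c\<^sub>\<otimes>\<^bsub>\<T>\<^esub>"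
    by unfold_locales simp
  interpret p: symmetric_monoidal_transport \<C> \<E> R "par_obj \<C>" "par \<C>" "\<bottom>" "a\<^sub>\<oplus>"
    "u\<^sub>\<oplus>\<^sup>L" "u\<^sub>\<oplus>\<^sup>R" "par_obj \<E>" "par \<E>" "\<bottom>\<^bsub>\<E>\<^esub>" "a\<^sub>\<oplus>\<^bsub>\<E>\<^esub>" "u\<^sub>\<oplus>\<^sup>L\<^bsub>\<E>\<^esub>"
    "u\<^sub>\<oplus>\<^sup>R\<^bsub>\<E>\<^esub>" "c\<^sub>\<oplus>\<^bsub>\<S>\<^esub>" "c\<^sub>\<oplus>\<^bsub>\<T>\<^esub>"
    by unfold_locales simp
  show "isomix_category \<E>" "ldc \<E>" by (rule target_isomix target_ldc)+
  show "symmetric_monoidal \<E> (tensor_obj \<E>) (tensor \<E>) \<top>\<^bsub>\<E>\<^esub> a\<^sub>\<otimes>\<^bsub>\<E>\<^esub> u\<^sub>\<otimes>\<^sup>L\<^bsub>\<E>\<^esub> u\<^sub>\<otimes>\<^sup>R\<^bsub>\<E>\<^esub>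
      c\<^sub>\<otimes>\<^bsub>\<T>\<^esub>"
    by (rule t.target_symmetric_monoidal)
  show "symmetric_monoidal \<E> (par_obj \<E>) (par \<E>) \<bottom>\<^bsub>\<E>\<^esub> a\<^sub>\<oplus>\<^bsub>\<E>\<^esub> u\<^sub>\<oplus>\<^sup>L\<^bsub>\<E>\<^esub> u\<^sub>\<oplus>\<^sup>R\<^bsub>\<E>\<^esub>
      c\<^sub>\<oplus>\<^bsub>\<T>\<^esub>"
    by (rule p.target_symmetric_monoidal)
qed (elim Obj_E; use distR_distL in simp)

lemma symmetric_isomix_functor: "symmetric_isomix_functor \<C> \<S> \<E> \<T> R"
proof -
  interpret strict: strict_isomix_functor \<C> \<E> R by (rule strict_isomix_functor)
  interpret sym: symmetric_isomix_category \<E> \<T> by (rule target_symmetric_isomix)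
  show ?thesis by unfold_locales simp_all
qed

lemma inverse_symmetric_isomix_isomorphism:
  assumes obj: "\<And>A. A \<in> Obj \<C> \<Longrightarrow> \<psi> (fobj R A) = A"
    and arr: "\<And>f. f \<in> Arr \<C> \<Longrightarrow> \<Psi> (farr R f) = f"
  shows "symmetric_isomix_isomorphism \<E> \<T> \<C> \<S> (strict_functor \<C> \<psi> \<Psi>)"
proof -
  interpret sym: symmetric_isomix_category \<E> \<T> by (rule target_symmetric_isomix)
  interpret inverse: category_isomorphism \<E> \<C> "strict_functor \<C> \<psi> \<Psi>"
    by (rule inverse_isomorphism) (simp_all add: obj arr)
  show ?thesis
    by unfold_locales (auto elim!: Obj_E Arr_E simp: obj arr)
qed

end

section \<open>Unitary changes of ancilla\<close>

context functor_on
begin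

declare fobj_Obj [simp] farr_Ident [simp]

lemma farr_Arr [simp]:
  assumes "f \<in> Arr \<C>"
  shows "farr F f \<in> Arr \<D>" "Dom \<D> (farr F f) = fobj F (Dom \<C> f)" "Cod \<D> (farr F f) = fobj F (Cod \<C> f)"
  using farr_hom[of f "Dom \<C> f" "Cod \<C> f"] assms by simp_all

lemma farr_Comp_Arr [simp]:
  "f \<in> Arr \<C> \<Longrightarrow> g \<in> Arr \<C> \<Longrightarrow> Cod \<C> f = Dom \<C> g \<Longrightarrow> farr F (f \<Zcomp>\<^bsub>\<C>\<^esub> g) = farr F f \<Zcomp>\<^bsub>\<D>\<^esub> farr F g"
  using farr_Comp[of f _ _ g] by simp

lemma farr_isos:
  assumes "f \<in> isos \<C> A B"
  shows "farr F f \<in> isos \<D> (fobj F A) (fobj F B)" "inv\<^bsub>\<D>\<^esub> (farr F f) = farr F (inv\<^bsub>\<C>\<^esub> f)"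
proof -
  note facts = source.isos_Arr[OF assms] source.inv_arr_isos[OF assms]
  have [simp]: "A \<in> Obj \<C>" "B \<in> Obj \<C>"
    using source.Dom_Cod_Obj[of f] facts by auto
  have "farr F f \<Zcomp>\<^bsub>\<D>\<^esub> farr F (inv\<^bsub>\<C>\<^esub> f) = \<one>\<^bsub>\<D>\<^esub> (fobj F A)"
    "farr F (inv\<^bsub>\<C>\<^esub> f) \<Zcomp>\<^bsub>\<D>\<^esub> farr F f = \<one>\<^bsub>\<D>\<^esub> (fobj F B)"
    using facts by (simp_all flip: farr_Comp_Arr)
  then show "farr F f \<in> isos \<D> (fobj F A) (fobj F B)" "inv\<^bsub>\<D>\<^esub> (farr F f) = farr F (inv\<^bsub>\<C>\<^esub> f)"
    using facts
    by (auto intro: target.isosI[where g = "farr F (inv\<^bsub>\<C>\<^esub> f)"] target.inv_arr_unique)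
qed

end

context dagger_ldc
begin

declare dag_Obj [simp] dag_Ident [simp] lam_tensor_iso [simp] lam_par_iso [simp] lam_top_iso [simp]

lemma dag_Arr [simp]:
  assumes "f \<in> Arr \<C>"
  shows "f\<dagger> \<in> Arr \<C>" "Dom \<C> (f\<dagger>) = (Cod \<C> f)\<^bold>\<dagger>" "Cod \<C> (f\<dagger>) = (Dom \<C> f)\<^bold>\<dagger>"
  using dag_hom[of f "Dom \<C> f" "Cod \<C> f"] assms by simp_all

lemma dag_Comp_Arr [simp]:
  "f \<in> Arr \<C> \<Longrightarrow> g \<in> Arr \<C> \<Longrightarrow> Cod \<C> f = Dom \<C> g \<Longrightarrow> (f \<Zcomp> g)\<dagger> = g\<dagger> \<Zcomp> f\<dagger>"
  using dag_Comp[of f _ _ g] by simp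

lemma lam_Arr [simp]:
  "A \<in> Obj \<C> \<Longrightarrow> B \<in> Obj \<C> \<Longrightarrow> \<lambda>\<^sub>\<otimes> A B \<in> Arr \<C>"
  "A \<in> Obj \<C> \<Longrightarrow> B \<in> Obj \<C> \<Longrightarrow> Dom \<C> (\<lambda>\<^sub>\<otimes> A B) = A\<^bold>\<dagger> \<^bold>\<otimes> B\<^bold>\<dagger>"
  "A \<in> Obj \<C> \<Longrightarrow> B \<in> Obj \<C> \<Longrightarrow> Cod \<C> (\<lambda>\<^sub>\<otimes> A B) = (A \<^bold>\<oplus> B)\<^bold>\<dagger>"
  "A \<in> Obj \<C> \<Longrightarrow> B \<in> Obj \<C> \<Longrightarrow> \<lambda>\<^sub>\<oplus> A B \<in> Arr \<C>"
  "A \<in> Obj \<C> \<Longrightarrow> B \<in> Obj \<C> \<Longrightarrow> Dom \<C> (\<lambda>\<^sub>\<oplus> A B) = A\<^bold>\<dagger> \<^bold>\<oplus> B\<^bold>\<dagger>"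
  "A \<in> Obj \<C> \<Longrightarrow> B \<in> Obj \<C> \<Longrightarrow> Cod \<C> (\<lambda>\<^sub>\<oplus> A B) = (A \<^bold>\<otimes> B)\<^bold>\<dagger>"
  "\<lambda>\<^sub>\<top> \<in> Arr \<C>" "Dom \<C> \<lambda>\<^sub>\<top> = \<top>" "Cod \<C> \<lambda>\<^sub>\<top> = \<bottom>\<^bold>\<dagger>"
  using isos_Arr[OF lam_tensor_iso] isos_Arr[OF lam_par_iso] isos_Arr[OF lam_top_iso] by simp_all

lemma lam_tensor_natural_Arr:
  "f \<in> Arr \<C> \<Longrightarrow> g \<in> Arr \<C> \<Longrightarrow>
    (f\<dagger> \<otimes> g\<dagger>) \<Zcomp> \<lambda>\<^sub>\<otimes> (Dom \<C> f) (Dom \<C> g) = \<lambda>\<^sub>\<otimes> (Cod \<C> f) (Cod \<C> g) \<Zcomp> (f \<oplus> g)\<dagger>"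
  using lam_tensor_natural[of f _ _ g] by simp

end

context unitary_category
begin

declare phi_iso [simp]

lemma phi_Arr [simp]:
  "A \<in> Obj \<U> \<Longrightarrow> \<phi> A \<in> Arr \<U>" "A \<in> Obj \<U> \<Longrightarrow> Dom \<U> (\<phi> A) = A"
  "A \<in> Obj \<U> \<Longrightarrow> Cod \<U> (\<phi> A) = A\<^bold>\<dagger>"
  using isos_Arr[OF phi_iso] by simp_all

lemma phi_bottom: "\<phi> \<bottom> = \<m> \<Zcomp> \<lambda>\<^sub>\<top>"
  unfolding phi_bot[symmetric] by simp

text \<open>The right unitor is unitary. The unitary structure on \<open>U \<oplus> \<bottom>\<close> is determined, through the
  invertible mix map, by those on \<open>U\<close> and \<open>\<bottom>\<close>, and the latter is \<open>\<m> \<Zcomp> \<lambda>\<^sub>\<top>\<close>; so both sides can be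
  compared after the mix map, where they reduce to the unit law of the dagger.\<close>

lemma par_uR_unitary:
  assumes [simp]: "U \<in> Obj \<U>"
  shows "\<phi> (U \<^bold>\<oplus> \<bottom>) = u\<^sub>\<oplus>\<^sup>R U \<Zcomp> (\<phi> U \<Zcomp> (u\<^sub>\<oplus>\<^sup>R U)\<dagger>)"
proof (rule iso_cancel_left)
  show "mx U \<bottom> \<in> isos \<U> (U \<^bold>\<otimes> \<bottom>) (U \<^bold>\<oplus> \<bottom>)"
    using all_core[OF assms] by (simp add: core_def)
  have "mx U \<bottom> \<Zcomp> (u\<^sub>\<oplus>\<^sup>R U \<Zcomp> (\<phi> U \<Zcomp> (u\<^sub>\<oplus>\<^sup>R U)\<dagger>))
      = (mx U \<bottom> \<Zcomp> u\<^sub>\<oplus>\<^sup>R U) \<Zcomp> (\<phi> U \<Zcomp> (u\<^sub>\<oplus>\<^sup>R U)\<dagger>)"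
    by simp
  also have "\<dots> = (\<one> U \<otimes> \<m>) \<Zcomp> (u\<^sub>\<otimes>\<^sup>R U \<Zcomp> \<phi> U) \<Zcomp> (u\<^sub>\<oplus>\<^sup>R U)\<dagger>"
    by (simp add: mx_bottom_right)
  also have "\<dots> = (\<one> U \<otimes> \<m>) \<Zcomp> ((\<phi> U \<otimes> \<one> \<top>) \<Zcomp> u\<^sub>\<otimes>\<^sup>R (U\<^bold>\<dagger>)) \<Zcomp> (u\<^sub>\<oplus>\<^sup>R U)\<dagger>"
    by (simp only: tensor.uR_natural_Arr[of "\<phi> U", simplified])
  also have "\<dots> = (\<phi> U \<otimes> \<m>) \<Zcomp> (u\<^sub>\<otimes>\<^sup>R (U\<^bold>\<dagger>) \<Zcomp> (u\<^sub>\<oplus>\<^sup>R U)\<dagger>)"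
    by simp
  also have "\<dots> = (\<phi> U \<otimes> \<m>) \<Zcomp> ((\<one> (U\<^bold>\<dagger>) \<otimes> \<lambda>\<^sub>\<top>) \<Zcomp> \<lambda>\<^sub>\<otimes> U \<bottom>)"
    by (simp only: lam_tensor_uR assms)
  also have "\<dots> = (\<phi> U \<otimes> \<phi> \<bottom>) \<Zcomp> \<lambda>\<^sub>\<otimes> U \<bottom>"
    by (simp add: phi_bottom)
  also have "\<dots> = ((\<phi> U \<otimes> \<phi> \<bottom>) \<Zcomp> \<lambda>\<^sub>\<otimes> U \<bottom> \<Zcomp> inv (\<phi> (U \<^bold>\<oplus> \<bottom>))) \<Zcomp> \<phi> (U \<^bold>\<oplus> \<bottom>)"
    by simp
  also have "\<dots> = mx U \<bottom> \<Zcomp> \<phi> (U \<^bold>\<oplus> \<bottom>)"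
    by (simp only: phi_par assms par.unit_Obj)
  finally show "mx U \<bottom> \<Zcomp> \<phi> (U \<^bold>\<oplus> \<bottom>) = mx U \<bottom> \<Zcomp> (u\<^sub>\<oplus>\<^sup>R U \<Zcomp> (\<phi> U \<Zcomp> (u\<^sub>\<oplus>\<^sup>R U)\<dagger>))" by simp
qed simp_all

end

context mixed_unitary_category
begin

declare mx_left_iso [simp]

lemma rho_Arr [simp]:
  "A \<in> Obj \<U> \<Longrightarrow> rho M A \<in> Arr \<C>" "A \<in> Obj \<U> \<Longrightarrow> Dom \<C> (rho M A) = fobj M (A\<^bold>\<dagger>\<^bsub>\<U>\<^esub>)"
  "A \<in> Obj \<U> \<Longrightarrow> Cod \<C> (rho M A) = (fobj M A)\<^bold>\<dagger>\<^bsub>\<C>\<^esub>"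
  using target.isos_Arr[OF rho_iso] by simp_all

lemma inv_mx_natural_left:
  assumes [simp]: "x \<in> Arr \<C>" "Dom \<C> x = fobj M U" "Cod \<C> x = fobj M V" "U \<in> Obj \<U>" "V \<in> Obj \<U>"
    "B \<in> Obj \<C>"
  shows "(x \<oplus>\<^bsub>\<C>\<^esub> \<one>\<^bsub>\<C>\<^esub> B) \<Zcomp>\<^bsub>\<C>\<^esub> inv\<^bsub>\<C>\<^esub> (mx\<^bsub>\<C>\<^esub> (fobj M V) B) =
    inv\<^bsub>\<C>\<^esub> (mx\<^bsub>\<C>\<^esub> (fobj M U) B) \<Zcomp>\<^bsub>\<C>\<^esub> (x \<otimes>\<^bsub>\<C>\<^esub> \<one>\<^bsub>\<C>\<^esub> B)" (is "?x \<Zcomp>\<^bsub>\<C>\<^esub> inv\<^bsub>\<C>\<^esub> ?n = inv\<^bsub>\<C>\<^esub> ?m \<Zcomp>\<^bsub>\<C>\<^esub> ?y")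
proof (rule target.iso_cancel_left)
  show "?m \<in> isos \<C> (fobj M U \<^bold>\<otimes>\<^bsub>\<C>\<^esub> B) (fobj M U \<^bold>\<oplus>\<^bsub>\<C>\<^esub> B)" by simp
  have "?m \<Zcomp>\<^bsub>\<C>\<^esub> (?x \<Zcomp>\<^bsub>\<C>\<^esub> inv\<^bsub>\<C>\<^esub> ?n) = (?m \<Zcomp>\<^bsub>\<C>\<^esub> ?x) \<Zcomp>\<^bsub>\<C>\<^esub> inv\<^bsub>\<C>\<^esub> ?n" by simp
  also have "\<dots> = (?y \<Zcomp>\<^bsub>\<C>\<^esub> ?n) \<Zcomp>\<^bsub>\<C>\<^esub> inv\<^bsub>\<C>\<^esub> ?n"
    using target.mx_natural_left[of x B] by simp
  finally show "?m \<Zcomp>\<^bsub>\<C>\<^esub> (?x \<Zcomp>\<^bsub>\<C>\<^esub> inv\<^bsub>\<C>\<^esub> ?n) = ?m \<Zcomp>\<^bsub>\<C>\<^esub> (inv\<^bsub>\<C>\<^esub> ?m \<Zcomp>\<^bsub>\<C>\<^esub> ?y)" by simp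
qed simp_all

text \<open>The test runs through the ancilla twice, once as \<open>M(\<alpha>)\<close> and once as its dagger, with
  \<open>M(\<phi>)\<close> and the preservator in between. Naturality brings the two copies together, where unitarity
  of \<open>\<alpha>\<close> absorbs them.\<close>

lemma kraus_test_unitary:
  assumes [simp]: "\<alpha> \<in> Arr \<U>" "Dom \<U> \<alpha> = U" "Cod \<U> \<alpha> = V"
    and unitary: "\<alpha> \<Zcomp>\<^bsub>\<U>\<^esub> (\<phi>\<^bsub>\<U>\<^esub> V \<Zcomp>\<^bsub>\<U>\<^esub> \<alpha>\<dagger>\<^bsub>\<U>\<^esub>) = \<phi>\<^bsub>\<U>\<^esub> U"
    and [simp]: "f \<in> Arr \<C>" "Dom \<C> f = A" "Cod \<C> f = fobj M U \<^bold>\<oplus>\<^bsub>\<C>\<^esub> B" "B \<in> Obj \<C>"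
    and [simp]: "C \<in> Obj \<C>" "W \<in> Obj \<U>" "h \<in> Arr \<C>" "Dom \<C> h = B \<^bold>\<otimes>\<^bsub>\<C>\<^esub> C" "Cod \<C> h = fobj M W"
  shows "kraus_test \<U> \<C> M A B C W h (f \<Zcomp>\<^bsub>\<C>\<^esub> (farr M \<alpha> \<oplus>\<^bsub>\<C>\<^esub> \<one>\<^bsub>\<C>\<^esub> B), V) =
    kraus_test \<U> \<C> M A B C W h (f, U)"
proof -
  have [simp]: "U \<in> Obj \<U>" "V \<in> Obj \<U>" "A \<in> Obj \<C>"
    using source.Dom_Cod_Obj[of \<alpha>] target.Dom_Cod_Obj[of f] by simp_all
  let ?P = "fobj M U" and ?Q = "fobj M V" and ?W = "fobj M W" and ?x = "farr M \<alpha>"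
  define k where "k = h\<dagger>\<^bsub>\<C>\<^esub> \<Zcomp>\<^bsub>\<C>\<^esub> inv\<^bsub>\<C>\<^esub> (\<lambda>\<^sub>\<oplus>\<^bsub>\<C>\<^esub> B C)"
  have k [simp]: "k \<in> Arr \<C>" "Dom \<C> k = ?W\<^bold>\<dagger>\<^bsub>\<C>\<^esub>" "Cod \<C> k = B\<^bold>\<dagger>\<^bsub>\<C>\<^esub> \<^bold>\<oplus>\<^bsub>\<C>\<^esub> C\<^bold>\<dagger>\<^bsub>\<C>\<^esub>"
    by (simp_all add: k_def)
  define head where "head = (f \<otimes>\<^bsub>\<C>\<^esub> \<one>\<^bsub>\<C>\<^esub> C) \<Zcomp>\<^bsub>\<C>\<^esub> \<partial>\<^sup>R\<^bsub>\<C>\<^esub> ?P B C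
    \<Zcomp>\<^bsub>\<C>\<^esub> (\<one>\<^bsub>\<C>\<^esub> ?P \<oplus>\<^bsub>\<C>\<^esub> h) \<Zcomp>\<^bsub>\<C>\<^esub> inv\<^bsub>\<C>\<^esub> (mx\<^bsub>\<C>\<^esub> ?P ?W)"
  have head [simp]: "head \<in> Arr \<C>" "Cod \<C> head = ?P \<^bold>\<otimes>\<^bsub>\<C>\<^esub> ?W"
    by (simp_all add: head_def)
  define tail where "tail = \<partial>\<^sup>L\<^bsub>\<C>\<^esub> (?P\<^bold>\<dagger>\<^bsub>\<C>\<^esub>) (B\<^bold>\<dagger>\<^bsub>\<C>\<^esub>) (C\<^bold>\<dagger>\<^bsub>\<C>\<^esub>)
    \<Zcomp>\<^bsub>\<C>\<^esub> (\<lambda>\<^sub>\<otimes>\<^bsub>\<C>\<^esub> ?P B \<oplus>\<^bsub>\<C>\<^esub> \<one>\<^bsub>\<C>\<^esub> (C\<^bold>\<dagger>\<^bsub>\<C>\<^esub>)) \<Zcomp>\<^bsub>\<C>\<^esub> (f\<dagger>\<^bsub>\<C>\<^esub> \<oplus>\<^bsub>\<C>\<^esub> \<one>\<^bsub>\<C>\<^esub> (C\<^bold>\<dagger>\<^bsub>\<C>\<^esub>)) \<Zcomp>\<^bsub>\<C>\<^esub> \<lambda>\<^sub>\<oplus>\<^bsub>\<C>\<^esub> A C"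
  have tail [simp]: "tail \<in> Arr \<C>" "Dom \<C> tail = ?P\<^bold>\<dagger>\<^bsub>\<C>\<^esub> \<^bold>\<otimes>\<^bsub>\<C>\<^esub> (B\<^bold>\<dagger>\<^bsub>\<C>\<^esub> \<^bold>\<oplus>\<^bsub>\<C>\<^esub> C\<^bold>\<dagger>\<^bsub>\<C>\<^esub>)"
    by (simp_all add: tail_def)
  let ?f = "f \<Zcomp>\<^bsub>\<C>\<^esub> (?x \<oplus>\<^bsub>\<C>\<^esub> \<one>\<^bsub>\<C>\<^esub> B)"
  \<comment> \<open>Naturality of the distributor and of the mix map brings \<open>M(\<alpha>)\<close> to the middle.\<close>
  have head_V: "(?f \<otimes>\<^bsub>\<C>\<^esub> \<one>\<^bsub>\<C>\<^esub> C) \<Zcomp>\<^bsub>\<C>\<^esub> \<partial>\<^sup>R\<^bsub>\<C>\<^esub> ?Q B C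
      \<Zcomp>\<^bsub>\<C>\<^esub> (\<one>\<^bsub>\<C>\<^esub> ?Q \<oplus>\<^bsub>\<C>\<^esub> h) \<Zcomp>\<^bsub>\<C>\<^esub> inv\<^bsub>\<C>\<^esub> (mx\<^bsub>\<C>\<^esub> ?Q ?W)
    = head \<Zcomp>\<^bsub>\<C>\<^esub> (?x \<otimes>\<^bsub>\<C>\<^esub> \<one>\<^bsub>\<C>\<^esub> ?W)" (is "?l = _")
  proof -
    have "?l = (f \<otimes>\<^bsub>\<C>\<^esub> \<one>\<^bsub>\<C>\<^esub> C) \<Zcomp>\<^bsub>\<C>\<^esub> (((?x \<oplus>\<^bsub>\<C>\<^esub> \<one>\<^bsub>\<C>\<^esub> B) \<otimes>\<^bsub>\<C>\<^esub> \<one>\<^bsub>\<C>\<^esub> C) \<Zcomp>\<^bsub>\<C>\<^esub> \<partial>\<^sup>R\<^bsub>\<C>\<^esub> ?Q B C)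
      \<Zcomp>\<^bsub>\<C>\<^esub> (\<one>\<^bsub>\<C>\<^esub> ?Q \<oplus>\<^bsub>\<C>\<^esub> h) \<Zcomp>\<^bsub>\<C>\<^esub> inv\<^bsub>\<C>\<^esub> (mx\<^bsub>\<C>\<^esub> ?Q ?W)" by simp
    also have "\<dots> = (f \<otimes>\<^bsub>\<C>\<^esub> \<one>\<^bsub>\<C>\<^esub> C) \<Zcomp>\<^bsub>\<C>\<^esub> (\<partial>\<^sup>R\<^bsub>\<C>\<^esub> ?P B C \<Zcomp>\<^bsub>\<C>\<^esub> (?x \<oplus>\<^bsub>\<C>\<^esub> \<one>\<^bsub>\<C>\<^esub> (B \<^bold>\<otimes>\<^bsub>\<C>\<^esub> C)))
      \<Zcomp>\<^bsub>\<C>\<^esub> (\<one>\<^bsub>\<C>\<^esub> ?Q \<oplus>\<^bsub>\<C>\<^esub> h) \<Zcomp>\<^bsub>\<C>\<^esub> inv\<^bsub>\<C>\<^esub> (mx\<^bsub>\<C>\<^esub> ?Q ?W)"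
      by (simp only: target.distR_natural_Arr[of ?x "\<one>\<^bsub>\<C>\<^esub> B" "\<one>\<^bsub>\<C>\<^esub> C", simplified])
    also have "\<dots> = (f \<otimes>\<^bsub>\<C>\<^esub> \<one>\<^bsub>\<C>\<^esub> C) \<Zcomp>\<^bsub>\<C>\<^esub> \<partial>\<^sup>R\<^bsub>\<C>\<^esub> ?P B C \<Zcomp>\<^bsub>\<C>\<^esub> (\<one>\<^bsub>\<C>\<^esub> ?P \<oplus>\<^bsub>\<C>\<^esub> h)
      \<Zcomp>\<^bsub>\<C>\<^esub> ((?x \<oplus>\<^bsub>\<C>\<^esub> \<one>\<^bsub>\<C>\<^esub> ?W) \<Zcomp>\<^bsub>\<C>\<^esub> inv\<^bsub>\<C>\<^esub> (mx\<^bsub>\<C>\<^esub> ?Q ?W))" by simp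
    also have "\<dots> = head \<Zcomp>\<^bsub>\<C>\<^esub> (?x \<otimes>\<^bsub>\<C>\<^esub> \<one>\<^bsub>\<C>\<^esub> ?W)"
      using inv_mx_natural_left[of ?x U V ?W] by (simp add: head_def)
    finally show ?thesis .
  qed
  \<comment> \<open>Dually, the dagger of \<open>M(\<alpha>)\<close> comes to the middle from the other end.\<close>
  have tail_V: "\<partial>\<^sup>L\<^bsub>\<C>\<^esub> (?Q\<^bold>\<dagger>\<^bsub>\<C>\<^esub>) (B\<^bold>\<dagger>\<^bsub>\<C>\<^esub>) (C\<^bold>\<dagger>\<^bsub>\<C>\<^esub>)
      \<Zcomp>\<^bsub>\<C>\<^esub> (\<lambda>\<^sub>\<otimes>\<^bsub>\<C>\<^esub> ?Q B \<oplus>\<^bsub>\<C>\<^esub> \<one>\<^bsub>\<C>\<^esub> (C\<^bold>\<dagger>\<^bsub>\<C>\<^esub>)) \<Zcomp>\<^bsub>\<C>\<^esub> (?f\<dagger>\<^bsub>\<C>\<^esub> \<oplus>\<^bsub>\<C>\<^esub> \<one>\<^bsub>\<C>\<^esub> (C\<^bold>\<dagger>\<^bsub>\<C>\<^esub>)) \<Zcomp>\<^bsub>\<C>\<^esub> \<lambda>\<^sub>\<oplus>\<^bsub>\<C>\<^esub> A C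
    = (?x\<dagger>\<^bsub>\<C>\<^esub> \<otimes>\<^bsub>\<C>\<^esub> \<one>\<^bsub>\<C>\<^esub> (B\<^bold>\<dagger>\<^bsub>\<C>\<^esub> \<^bold>\<oplus>\<^bsub>\<C>\<^esub> C\<^bold>\<dagger>\<^bsub>\<C>\<^esub>)) \<Zcomp>\<^bsub>\<C>\<^esub> tail" (is "?l = _")
  proof -
    let ?d = "\<partial>\<^sup>L\<^bsub>\<C>\<^esub> (?Q\<^bold>\<dagger>\<^bsub>\<C>\<^esub>) (B\<^bold>\<dagger>\<^bsub>\<C>\<^esub>) (C\<^bold>\<dagger>\<^bsub>\<C>\<^esub>)"
      and ?e = "(f\<dagger>\<^bsub>\<C>\<^esub> \<oplus>\<^bsub>\<C>\<^esub> \<one>\<^bsub>\<C>\<^esub> (C\<^bold>\<dagger>\<^bsub>\<C>\<^esub>)) \<Zcomp>\<^bsub>\<C>\<^esub> \<lambda>\<^sub>\<oplus>\<^bsub>\<C>\<^esub> A C"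
    have "?l = ?d \<Zcomp>\<^bsub>\<C>\<^esub> ((\<lambda>\<^sub>\<otimes>\<^bsub>\<C>\<^esub> ?Q B \<Zcomp>\<^bsub>\<C>\<^esub> (?x \<oplus>\<^bsub>\<C>\<^esub> \<one>\<^bsub>\<C>\<^esub> B)\<dagger>\<^bsub>\<C>\<^esub>) \<oplus>\<^bsub>\<C>\<^esub> \<one>\<^bsub>\<C>\<^esub> (C\<^bold>\<dagger>\<^bsub>\<C>\<^esub>)) \<Zcomp>\<^bsub>\<C>\<^esub> ?e"
      by simp
    also have "\<dots> = ?d \<Zcomp>\<^bsub>\<C>\<^esub> (((?x\<dagger>\<^bsub>\<C>\<^esub> \<otimes>\<^bsub>\<C>\<^esub> \<one>\<^bsub>\<C>\<^esub> (B\<^bold>\<dagger>\<^bsub>\<C>\<^esub>)) \<Zcomp>\<^bsub>\<C>\<^esub> \<lambda>\<^sub>\<otimes>\<^bsub>\<C>\<^esub> ?P B) \<oplus>\<^bsub>\<C>\<^esub> \<one>\<^bsub>\<C>\<^esub> (C\<^bold>\<dagger>\<^bsub>\<C>\<^esub>)) \<Zcomp>\<^bsub>\<C>\<^esub> ?e"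
      using target.lam_tensor_natural_Arr[of ?x "\<one>\<^bsub>\<C>\<^esub> B"] by simp
    also have "\<dots> = (?d \<Zcomp>\<^bsub>\<C>\<^esub> ((?x\<dagger>\<^bsub>\<C>\<^esub> \<otimes>\<^bsub>\<C>\<^esub> \<one>\<^bsub>\<C>\<^esub> (B\<^bold>\<dagger>\<^bsub>\<C>\<^esub>)) \<oplus>\<^bsub>\<C>\<^esub> \<one>\<^bsub>\<C>\<^esub> (C\<^bold>\<dagger>\<^bsub>\<C>\<^esub>)))
        \<Zcomp>\<^bsub>\<C>\<^esub> (\<lambda>\<^sub>\<otimes>\<^bsub>\<C>\<^esub> ?P B \<oplus>\<^bsub>\<C>\<^esub> \<one>\<^bsub>\<C>\<^esub> (C\<^bold>\<dagger>\<^bsub>\<C>\<^esub>)) \<Zcomp>\<^bsub>\<C>\<^esub> ?e"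
      by simp
    also have "\<dots> = ((?x\<dagger>\<^bsub>\<C>\<^esub> \<otimes>\<^bsub>\<C>\<^esub> \<one>\<^bsub>\<C>\<^esub> (B\<^bold>\<dagger>\<^bsub>\<C>\<^esub> \<^bold>\<oplus>\<^bsub>\<C>\<^esub> C\<^bold>\<dagger>\<^bsub>\<C>\<^esub>)) \<Zcomp>\<^bsub>\<C>\<^esub> \<partial>\<^sup>L\<^bsub>\<C>\<^esub> (?P\<^bold>\<dagger>\<^bsub>\<C>\<^esub>) (B\<^bold>\<dagger>\<^bsub>\<C>\<^esub>) (C\<^bold>\<dagger>\<^bsub>\<C>\<^esub>))
        \<Zcomp>\<^bsub>\<C>\<^esub> (\<lambda>\<^sub>\<otimes>\<^bsub>\<C>\<^esub> ?P B \<oplus>\<^bsub>\<C>\<^esub> \<one>\<^bsub>\<C>\<^esub> (C\<^bold>\<dagger>\<^bsub>\<C>\<^esub>)) \<Zcomp>\<^bsub>\<C>\<^esub> ?e"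
      by (simp only: target.distL_natural_Arr[of "?x\<dagger>\<^bsub>\<C>\<^esub>" "\<one>\<^bsub>\<C>\<^esub> (B\<^bold>\<dagger>\<^bsub>\<C>\<^esub>)" "\<one>\<^bsub>\<C>\<^esub> (C\<^bold>\<dagger>\<^bsub>\<C>\<^esub>)", simplified])
    also have "\<dots> = (?x\<dagger>\<^bsub>\<C>\<^esub> \<otimes>\<^bsub>\<C>\<^esub> \<one>\<^bsub>\<C>\<^esub> (B\<^bold>\<dagger>\<^bsub>\<C>\<^esub> \<^bold>\<oplus>\<^bsub>\<C>\<^esub> C\<^bold>\<dagger>\<^bsub>\<C>\<^esub>)) \<Zcomp>\<^bsub>\<C>\<^esub> tail"
      by (simp add: tail_def)
    finally show ?thesis .
  qed
  \<comment> \<open>Naturality of the preservator reduces the middle to unitarity of \<open>\<alpha>\<close>.\<close>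
  have middle: "?x \<Zcomp>\<^bsub>\<C>\<^esub> (farr M (\<phi>\<^bsub>\<U>\<^esub> V) \<Zcomp>\<^bsub>\<C>\<^esub> (rho M V \<Zcomp>\<^bsub>\<C>\<^esub> ?x\<dagger>\<^bsub>\<C>\<^esub>)) = farr M (\<phi>\<^bsub>\<U>\<^esub> U) \<Zcomp>\<^bsub>\<C>\<^esub> rho M U"
  proof -
    have "?x \<Zcomp>\<^bsub>\<C>\<^esub> (farr M (\<phi>\<^bsub>\<U>\<^esub> V) \<Zcomp>\<^bsub>\<C>\<^esub> (rho M V \<Zcomp>\<^bsub>\<C>\<^esub> ?x\<dagger>\<^bsub>\<C>\<^esub>))
        = ?x \<Zcomp>\<^bsub>\<C>\<^esub> (farr M (\<phi>\<^bsub>\<U>\<^esub> V) \<Zcomp>\<^bsub>\<C>\<^esub> (farr M (\<alpha>\<dagger>\<^bsub>\<U>\<^esub>) \<Zcomp>\<^bsub>\<C>\<^esub> rho M U))"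
      using rho_natural[of \<alpha> U V] by simp
    also have "\<dots> = farr M (\<alpha> \<Zcomp>\<^bsub>\<U>\<^esub> (\<phi>\<^bsub>\<U>\<^esub> V \<Zcomp>\<^bsub>\<U>\<^esub> \<alpha>\<dagger>\<^bsub>\<U>\<^esub>)) \<Zcomp>\<^bsub>\<C>\<^esub> rho M U" by simp
    finally show ?thesis by (simp only: unitary)
  qed
  let ?q = "farr M (\<phi>\<^bsub>\<U>\<^esub> W) \<Zcomp>\<^bsub>\<C>\<^esub> (rho M W \<Zcomp>\<^bsub>\<C>\<^esub> k)"
  have "kraus_test \<U> \<C> M A B C W h (?f, V) =
    ((?f \<otimes>\<^bsub>\<C>\<^esub> \<one>\<^bsub>\<C>\<^esub> C) \<Zcomp>\<^bsub>\<C>\<^esub> \<partial>\<^sup>R\<^bsub>\<C>\<^esub> ?Q B C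
      \<Zcomp>\<^bsub>\<C>\<^esub> (\<one>\<^bsub>\<C>\<^esub> ?Q \<oplus>\<^bsub>\<C>\<^esub> h) \<Zcomp>\<^bsub>\<C>\<^esub> inv\<^bsub>\<C>\<^esub> (mx\<^bsub>\<C>\<^esub> ?Q ?W))
    \<Zcomp>\<^bsub>\<C>\<^esub> (((farr M (\<phi>\<^bsub>\<U>\<^esub> V) \<Zcomp>\<^bsub>\<C>\<^esub> rho M V) \<otimes>\<^bsub>\<C>\<^esub> ?q) \<Zcomp>\<^bsub>\<C>\<^esub>
      (\<partial>\<^sup>L\<^bsub>\<C>\<^esub> (?Q\<^bold>\<dagger>\<^bsub>\<C>\<^esub>) (B\<^bold>\<dagger>\<^bsub>\<C>\<^esub>) (C\<^bold>\<dagger>\<^bsub>\<C>\<^esub>)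
      \<Zcomp>\<^bsub>\<C>\<^esub> (\<lambda>\<^sub>\<otimes>\<^bsub>\<C>\<^esub> ?Q B \<oplus>\<^bsub>\<C>\<^esub> \<one>\<^bsub>\<C>\<^esub> (C\<^bold>\<dagger>\<^bsub>\<C>\<^esub>)) \<Zcomp>\<^bsub>\<C>\<^esub> (?f\<dagger>\<^bsub>\<C>\<^esub> \<oplus>\<^bsub>\<C>\<^esub> \<one>\<^bsub>\<C>\<^esub> (C\<^bold>\<dagger>\<^bsub>\<C>\<^esub>)) \<Zcomp>\<^bsub>\<C>\<^esub> \<lambda>\<^sub>\<oplus>\<^bsub>\<C>\<^esub> A C))"
    unfolding kraus_test_def k_def[symmetric] by simp
  also have "\<dots> = head \<Zcomp>\<^bsub>\<C>\<^esub> (((?x \<Zcomp>\<^bsub>\<C>\<^esub> (farr M (\<phi>\<^bsub>\<U>\<^esub> V) \<Zcomp>\<^bsub>\<C>\<^esub> (rho M V \<Zcomp>\<^bsub>\<C>\<^esub> ?x\<dagger>\<^bsub>\<C>\<^esub>))) \<otimes>\<^bsub>\<C>\<^esub> ?q) \<Zcomp>\<^bsub>\<C>\<^esub> tail)"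
    unfolding head_V tail_V by simp
  also have "\<dots> = head \<Zcomp>\<^bsub>\<C>\<^esub> (((farr M (\<phi>\<^bsub>\<U>\<^esub> U) \<Zcomp>\<^bsub>\<C>\<^esub> rho M U) \<otimes>\<^bsub>\<C>\<^esub> ?q) \<Zcomp>\<^bsub>\<C>\<^esub> tail)"
    by (simp only: middle)
  also have "\<dots> = kraus_test \<U> \<C> M A B C W h (f, U)"
    unfolding kraus_test_def k_def[symmetric] head_def tail_def by simp
  finally show ?thesis .
qed

end

section \<open>Denotations of Kraus maps in an environment structure\<close>

context strict_isomix_functor
begin

text \<open>An identity can only be typed as a comparison map if its source and target agree.\<close>

lemma strict_Obj [simp]:
  "A \<in> Obj \<C> \<Longrightarrow> B \<in> Obj \<C> \<Longrightarrow> fobj F (A \<^bold>\<otimes>\<^bsub>\<C>\<^esub> B) = fobj F A \<^bold>\<otimes>\<^bsub>\<D>\<^esub> fobj F B"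
  "A \<in> Obj \<C> \<Longrightarrow> B \<in> Obj \<C> \<Longrightarrow> fobj F (A \<^bold>\<oplus>\<^bsub>\<C>\<^esub> B) = fobj F A \<^bold>\<oplus>\<^bsub>\<D>\<^esub> fobj F B"
  "fobj F \<top>\<^bsub>\<C>\<^esub> = \<top>\<^bsub>\<D>\<^esub>" "fobj F \<bottom>\<^bsub>\<C>\<^esub> = \<bottom>\<^bsub>\<D>\<^esub>"
  using m_tensor_hom[of A B] n_par_hom[of A B] m_top_hom n_bot_hom
  by (simp_all add: m_tensor_strict n_par_strict m_top_strict n_bot_strict)

lemma strict_farr [simp]:
  "f \<in> Arr \<C> \<Longrightarrow> g \<in> Arr \<C> \<Longrightarrow> farr F (f \<otimes>\<^bsub>\<C>\<^esub> g) = farr F f \<otimes>\<^bsub>\<D>\<^esub> farr F g"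
  "f \<in> Arr \<C> \<Longrightarrow> g \<in> Arr \<C> \<Longrightarrow> farr F (f \<oplus>\<^bsub>\<C>\<^esub> g) = farr F f \<oplus>\<^bsub>\<D>\<^esub> farr F g"
  using m_tensor_natural[of f "Dom \<C> f" "Cod \<C> f" g "Dom \<C> g" "Cod \<C> g"]
    n_par_natural[of f "Dom \<C> f" "Cod \<C> f" g "Dom \<C> g" "Cod \<C> g"]
  by (simp_all add: m_tensor_strict n_par_strict)

lemma strict_structure [simp]:
  "A \<in> Obj \<C> \<Longrightarrow> farr F (u\<^sub>\<otimes>\<^sup>L\<^bsub>\<C>\<^esub> A) = u\<^sub>\<otimes>\<^sup>L\<^bsub>\<D>\<^esub> (fobj F A)"
  "A \<in> Obj \<C> \<Longrightarrow> farr F (u\<^sub>\<otimes>\<^sup>R\<^bsub>\<C>\<^esub> A) = u\<^sub>\<otimes>\<^sup>R\<^bsub>\<D>\<^esub> (fobj F A)"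
  "A \<in> Obj \<C> \<Longrightarrow> farr F (u\<^sub>\<oplus>\<^sup>L\<^bsub>\<C>\<^esub> A) = u\<^sub>\<oplus>\<^sup>L\<^bsub>\<D>\<^esub> (fobj F A)"
  "A \<in> Obj \<C> \<Longrightarrow> farr F (u\<^sub>\<oplus>\<^sup>R\<^bsub>\<C>\<^esub> A) = u\<^sub>\<oplus>\<^sup>R\<^bsub>\<D>\<^esub> (fobj F A)"
  "A \<in> Obj \<C> \<Longrightarrow> B \<in> Obj \<C> \<Longrightarrow> C \<in> Obj \<C> \<Longrightarrow>
    farr F (a\<^sub>\<otimes>\<^bsub>\<C>\<^esub> A B C) = a\<^sub>\<otimes>\<^bsub>\<D>\<^esub> (fobj F A) (fobj F B) (fobj F C)"
  "A \<in> Obj \<C> \<Longrightarrow> B \<in> Obj \<C> \<Longrightarrow> C \<in> Obj \<C> \<Longrightarrow>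
    farr F (a\<^sub>\<oplus>\<^bsub>\<C>\<^esub> A B C) = a\<^sub>\<oplus>\<^bsub>\<D>\<^esub> (fobj F A) (fobj F B) (fobj F C)"
  "A \<in> Obj \<C> \<Longrightarrow> B \<in> Obj \<C> \<Longrightarrow> C \<in> Obj \<C> \<Longrightarrow>
    farr F (\<partial>\<^sup>L\<^bsub>\<C>\<^esub> A B C) = \<partial>\<^sup>L\<^bsub>\<D>\<^esub> (fobj F A) (fobj F B) (fobj F C)"
  "A \<in> Obj \<C> \<Longrightarrow> B \<in> Obj \<C> \<Longrightarrow> C \<in> Obj \<C> \<Longrightarrow>
    farr F (\<partial>\<^sup>R\<^bsub>\<C>\<^esub> A B C) = \<partial>\<^sup>R\<^bsub>\<D>\<^esub> (fobj F A) (fobj F B) (fobj F C)"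
  "farr F \<m>\<^bsub>\<C>\<^esub> = \<m>\<^bsub>\<D>\<^esub>"
  using m_tensor_uL[of A] m_tensor_uR[of A] n_par_uL[of A] n_par_uR[of A] m_tensor_assoc[of A B C]
    n_par_assoc[of A B C] frobenius_L[of A B C] frobenius_R[of A B C] farr_mix
  by (simp_all add: m_tensor_strict n_par_strict m_top_strict n_bot_strict)

lemma strict_inv [simp]:
  "A \<in> Obj \<C> \<Longrightarrow> farr F (inv\<^bsub>\<C>\<^esub> (u\<^sub>\<oplus>\<^sup>L\<^bsub>\<C>\<^esub> A)) = inv\<^bsub>\<D>\<^esub> (u\<^sub>\<oplus>\<^sup>L\<^bsub>\<D>\<^esub> (fobj F A))"
  "A \<in> Obj \<C> \<Longrightarrow> farr F (inv\<^bsub>\<C>\<^esub> (u\<^sub>\<oplus>\<^sup>R\<^bsub>\<C>\<^esub> A)) = inv\<^bsub>\<D>\<^esub> (u\<^sub>\<oplus>\<^sup>R\<^bsub>\<D>\<^esub> (fobj F A))"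
  "A \<in> Obj \<C> \<Longrightarrow> B \<in> Obj \<C> \<Longrightarrow> C \<in> Obj \<C> \<Longrightarrow>
    farr F (inv\<^bsub>\<C>\<^esub> (a\<^sub>\<oplus>\<^bsub>\<C>\<^esub> A B C)) = inv\<^bsub>\<D>\<^esub> (a\<^sub>\<oplus>\<^bsub>\<D>\<^esub> (fobj F A) (fobj F B) (fobj F C))"
  by (simp_all flip: farr_isos(2)[OF source.par.uL_iso] farr_isos(2)[OF source.par.uR_iso]
      farr_isos(2)[OF source.par.a_iso])

end

lemma kraus_maps_iff [simp]:
  "(f, U) \<in> kraus_maps \<U> \<C> M A B \<longleftrightarrow>
    U \<in> Obj \<U> \<and> f \<in> Arr \<C> \<and> Dom \<C> f = A \<and> Cod \<C> f = fobj M U \<^bold>\<oplus>\<^bsub>\<C>\<^esub> B"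
  by (simp add: kraus_maps_def)

context mixed_unitary_category
begin

declare n_par_iso [simp] n_bot_iso [simp]

lemma n_Arr [simp]:
  "A \<in> Obj \<U> \<Longrightarrow> B \<in> Obj \<U> \<Longrightarrow> n_par M A B \<in> Arr \<C>"
  "A \<in> Obj \<U> \<Longrightarrow> B \<in> Obj \<U> \<Longrightarrow> Dom \<C> (n_par M A B) = fobj M (A \<^bold>\<oplus>\<^bsub>\<U>\<^esub> B)"
  "A \<in> Obj \<U> \<Longrightarrow> B \<in> Obj \<U> \<Longrightarrow> Cod \<C> (n_par M A B) = fobj M A \<^bold>\<oplus>\<^bsub>\<C>\<^esub> fobj M B"
  "n_bot M \<in> Arr \<C>" "Dom \<C> (n_bot M) = fobj M \<bottom>\<^bsub>\<U>\<^esub>" "Cod \<C> (n_bot M) = \<bottom>\<^bsub>\<C>\<^esub>"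
  using target.isos_Arr[OF n_par_iso] target.isos_Arr[OF n_bot_iso] by simp_all

text \<open>The change of ancilla is the inverse of the right unitor, which is unitary since the unitor is.\<close>

lemma kraus_equiv_add_bottom:
  assumes k: "(f, U) \<in> kraus_maps \<U> \<C> M A B" and B [simp]: "B \<in> Obj \<C>"
  defines "f' \<equiv> f \<Zcomp>\<^bsub>\<C>\<^esub> (farr M (inv\<^bsub>\<U>\<^esub> (u\<^sub>\<oplus>\<^sup>R\<^bsub>\<U>\<^esub> U)) \<oplus>\<^bsub>\<C>\<^esub> \<one>\<^bsub>\<C>\<^esub> B)"
  shows "(f', U \<^bold>\<oplus>\<^bsub>\<U>\<^esub> \<bottom>\<^bsub>\<U>\<^esub>) \<in> kraus_maps \<U> \<C> M A B"
    "kraus_equiv \<U> \<C> M A B (f, U) (f', U \<^bold>\<oplus>\<^bsub>\<U>\<^esub> \<bottom>\<^bsub>\<U>\<^esub>)"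
proof -
  let ?u = "u\<^sub>\<oplus>\<^sup>R\<^bsub>\<U>\<^esub> U"
  have f [simp]: "U \<in> Obj \<U>" "f \<in> Arr \<C>" "Dom \<C> f = A" "Cod \<C> f = fobj M U \<^bold>\<oplus>\<^bsub>\<C>\<^esub> B"
    using k by simp_all
  show "(f', U \<^bold>\<oplus>\<^bsub>\<U>\<^esub> \<bottom>\<^bsub>\<U>\<^esub>) \<in> kraus_maps \<U> \<C> M A B"
    by (simp add: f'_def)
  have "inv\<^bsub>\<U>\<^esub> ?u \<Zcomp>\<^bsub>\<U>\<^esub> (\<phi>\<^bsub>\<U>\<^esub> (U \<^bold>\<oplus>\<^bsub>\<U>\<^esub> \<bottom>\<^bsub>\<U>\<^esub>) \<Zcomp>\<^bsub>\<U>\<^esub> (inv\<^bsub>\<U>\<^esub> ?u)\<dagger>\<^bsub>\<U>\<^esub>)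
      = \<phi>\<^bsub>\<U>\<^esub> U \<Zcomp>\<^bsub>\<U>\<^esub> (?u\<dagger>\<^bsub>\<U>\<^esub> \<Zcomp>\<^bsub>\<U>\<^esub> (inv\<^bsub>\<U>\<^esub> ?u)\<dagger>\<^bsub>\<U>\<^esub>)"
    by (simp add: source.par_uR_unitary)
  also have "\<dots> = \<phi>\<^bsub>\<U>\<^esub> U"
    using source.dag_Comp_Arr[of "inv\<^bsub>\<U>\<^esub> ?u" ?u, symmetric] by (simp del: source.dag_Comp_Arr)
  finally show "kraus_equiv \<U> \<C> M A B (f, U) (f', U \<^bold>\<oplus>\<^bsub>\<U>\<^esub> \<bottom>\<^bsub>\<U>\<^esub>)"
    unfolding kraus_equiv_def f'_def by (simp add: kraus_test_unitary)
qed

end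

context environment_structure
begin

lemma discard_Arr [simp]:
  assumes "U \<in> Obj \<U>"
  shows "d U \<in> Arr \<D>" "Dom \<D> (d U) = fobj F (fobj M U)" "Cod \<D> (d U) = \<bottom>\<^bsub>\<D>\<^esub>"
  using discard_hom[OF assms] by simp_all

definition denote :: "'o \<Rightarrow> 'a \<times> 'u \<Rightarrow> 'b" where
  "denote B = (\<lambda>(f, U). farr F f \<Zcomp>\<^bsub>\<D>\<^esub> (d U \<oplus>\<^bsub>\<D>\<^esub> \<one>\<^bsub>\<D>\<^esub> (fobj F B)) \<Zcomp>\<^bsub>\<D>\<^esub> u\<^sub>\<oplus>\<^sup>L\<^bsub>\<D>\<^esub> (fobj F B))"

lemma denote_Arr:
  assumes "k \<in> kraus_maps \<U> \<C> M A B" "B \<in> Obj \<C>"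
  shows "denote B k \<in> Arr \<D>" "Dom \<D> (denote B k) = fobj F A" "Cod \<D> (denote B k) = fobj F B"
  using assms by (cases k; simp add: denote_def)+

text \<open>The second environment axiom up to the invertible unitor at the end of a denotation.\<close>

lemma kraus_equiv_iff_denote:
  assumes k: "k \<in> kraus_maps \<U> \<C> M A B" and l: "l \<in> kraus_maps \<U> \<C> M A B"
    and A [simp]: "A \<in> Obj \<C>" and B [simp]: "B \<in> Obj \<C>"
  shows "kraus_equiv \<U> \<C> M A B k l \<longleftrightarrow> denote B k = denote B l"
proof -
  obtain f U g V where kl [simp]: "k = (f, U)" "l = (g, V)" by (cases k, cases l)
  define x where "x = farr F f \<Zcomp>\<^bsub>\<D>\<^esub> (d U \<oplus>\<^bsub>\<D>\<^esub> \<one>\<^bsub>\<D>\<^esub> (fobj F B))"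
  define y where "y = farr F g \<Zcomp>\<^bsub>\<D>\<^esub> (d V \<oplus>\<^bsub>\<D>\<^esub> \<one>\<^bsub>\<D>\<^esub> (fobj F B))"
  have xy [simp]: "x \<in> Arr \<D>" "Cod \<D> x = \<bottom>\<^bsub>\<D>\<^esub> \<^bold>\<oplus>\<^bsub>\<D>\<^esub> fobj F B"
    "y \<in> Arr \<D>" "Cod \<D> y = \<bottom>\<^bsub>\<D>\<^esub> \<^bold>\<oplus>\<^bsub>\<D>\<^esub> fobj F B"
    using k l by (simp_all add: x_def y_def)
  have "kraus_equiv \<U> \<C> M A B k l \<longleftrightarrow> x = y"
    using env_kraus[of A B f U g V] k l by (simp add: x_def y_def env.n_par_strict)
  also have "\<dots> \<longleftrightarrow> x \<Zcomp>\<^bsub>\<D>\<^esub> u\<^sub>\<oplus>\<^sup>L\<^bsub>\<D>\<^esub> (fobj F B) = y \<Zcomp>\<^bsub>\<D>\<^esub> u\<^sub>\<oplus>\<^sup>L\<^bsub>\<D>\<^esub> (fobj F B)"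
    using env.target.iso_cancel_right[OF env.target.par.uL_iso, of "fobj F B" x y] by auto
  also have "\<dots> \<longleftrightarrow> denote B k = denote B l"
    by (simp only: denote_def x_def y_def kl prod.case)
  finally show ?thesis .
qed

lemma discard_par:
  assumes [simp]: "U \<in> Obj \<U>" "V \<in> Obj \<U>"
  shows "farr F (n_par M U V) \<Zcomp>\<^bsub>\<D>\<^esub> ((d U \<oplus>\<^bsub>\<D>\<^esub> d V) \<Zcomp>\<^bsub>\<D>\<^esub> u\<^sub>\<oplus>\<^sup>L\<^bsub>\<D>\<^esub> \<bottom>\<^bsub>\<D>\<^esub>) = d (U \<^bold>\<oplus>\<^bsub>\<U>\<^esub> V)"
  using env_par[of U V] by (simp add: isomix_fun_comp_def env.n_par_strict)

lemma inv_n_par_discard: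
  assumes [simp]: "U \<in> Obj \<U>" "V \<in> Obj \<U>"
  shows "farr F (inv\<^bsub>\<C>\<^esub> (n_par M U V)) \<Zcomp>\<^bsub>\<D>\<^esub> d (U \<^bold>\<oplus>\<^bsub>\<U>\<^esub> V) = (d U \<oplus>\<^bsub>\<D>\<^esub> d V) \<Zcomp>\<^bsub>\<D>\<^esub> u\<^sub>\<oplus>\<^sup>L\<^bsub>\<D>\<^esub> \<bottom>\<^bsub>\<D>\<^esub>"
proof -
  let ?n = "n_par M U V"
  have "farr F (inv\<^bsub>\<C>\<^esub> ?n) \<Zcomp>\<^bsub>\<D>\<^esub> d (U \<^bold>\<oplus>\<^bsub>\<U>\<^esub> V)
      = farr F (inv\<^bsub>\<C>\<^esub> ?n \<Zcomp>\<^bsub>\<C>\<^esub> ?n) \<Zcomp>\<^bsub>\<D>\<^esub> ((d U \<oplus>\<^bsub>\<D>\<^esub> d V) \<Zcomp>\<^bsub>\<D>\<^esub> u\<^sub>\<oplus>\<^sup>L\<^bsub>\<D>\<^esub> \<bottom>\<^bsub>\<D>\<^esub>)"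
    unfolding discard_par[OF assms, symmetric]
    by (simp del: target.inv_arr_Arr(5) target.inv_arr_cancel)
  then show ?thesis by simp
qed

text \<open>Enlarging an ancilla by \<open>\<bottom>\<close> before discarding it costs a factor, an arrow \<open>\<bottom> \<rightarrow> \<bottom>\<close> that does
  not depend on the ancilla. The axiom for par splits off the discard map of \<open>\<bottom>\<close>, and the unit law
  of \<open>M\<close> identifies the factor.\<close>

lemma discard_add_bottom:
  assumes [simp]: "U \<in> Obj \<U>"
  shows "farr F (farr M (inv\<^bsub>\<U>\<^esub> (u\<^sub>\<oplus>\<^sup>R\<^bsub>\<U>\<^esub> U))) \<Zcomp>\<^bsub>\<D>\<^esub> d (U \<^bold>\<oplus>\<^bsub>\<U>\<^esub> \<bottom>\<^bsub>\<U>\<^esub>) =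
    d U \<Zcomp>\<^bsub>\<D>\<^esub> (farr F (inv\<^bsub>\<C>\<^esub> (n_bot M)) \<Zcomp>\<^bsub>\<D>\<^esub> d \<bottom>\<^bsub>\<U>\<^esub>)"
proof -
  let ?P = "fobj M U" and ?n = "n_par M U \<bottom>\<^bsub>\<U>\<^esub>" and ?b = "n_bot M"
  let ?v = "farr M (inv\<^bsub>\<U>\<^esub> (u\<^sub>\<oplus>\<^sup>R\<^bsub>\<U>\<^esub> U))"
  define e where "e = farr F (inv\<^bsub>\<C>\<^esub> ?b) \<Zcomp>\<^bsub>\<D>\<^esub> d \<bottom>\<^bsub>\<U>\<^esub>"
  have e [simp]: "e \<in> Arr \<D>" "Dom \<D> e = \<bottom>\<^bsub>\<D>\<^esub>" "Cod \<D> e = \<bottom>\<^bsub>\<D>\<^esub>" by (simp_all add: e_def)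
  \<comment> \<open>The unit law of the comonoidal structure of \<open>M\<close>, solved for the inverse unitor.\<close>
  have vn: "?v \<Zcomp>\<^bsub>\<C>\<^esub> ?n = inv\<^bsub>\<C>\<^esub> (u\<^sub>\<oplus>\<^sup>R\<^bsub>\<C>\<^esub> ?P) \<Zcomp>\<^bsub>\<C>\<^esub> (\<one>\<^bsub>\<C>\<^esub> ?P \<oplus>\<^bsub>\<C>\<^esub> inv\<^bsub>\<C>\<^esub> ?b)"
  proof -
    have "?v \<Zcomp>\<^bsub>\<C>\<^esub> ?n = ?v \<Zcomp>\<^bsub>\<C>\<^esub> (?n \<Zcomp>\<^bsub>\<C>\<^esub> (\<one>\<^bsub>\<C>\<^esub> ?P \<oplus>\<^bsub>\<C>\<^esub> ?b) \<Zcomp>\<^bsub>\<C>\<^esub> u\<^sub>\<oplus>\<^sup>R\<^bsub>\<C>\<^esub> ?P)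
        \<Zcomp>\<^bsub>\<C>\<^esub> (inv\<^bsub>\<C>\<^esub> (u\<^sub>\<oplus>\<^sup>R\<^bsub>\<C>\<^esub> ?P) \<Zcomp>\<^bsub>\<C>\<^esub> (\<one>\<^bsub>\<C>\<^esub> ?P \<oplus>\<^bsub>\<C>\<^esub> inv\<^bsub>\<C>\<^esub> ?b))"
      by simp
    also have "\<dots> = ?v \<Zcomp>\<^bsub>\<C>\<^esub> farr M (u\<^sub>\<oplus>\<^sup>R\<^bsub>\<U>\<^esub> U)
        \<Zcomp>\<^bsub>\<C>\<^esub> (inv\<^bsub>\<C>\<^esub> (u\<^sub>\<oplus>\<^sup>R\<^bsub>\<C>\<^esub> ?P) \<Zcomp>\<^bsub>\<C>\<^esub> (\<one>\<^bsub>\<C>\<^esub> ?P \<oplus>\<^bsub>\<C>\<^esub> inv\<^bsub>\<C>\<^esub> ?b))"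
      by (simp only: n_par_uR assms)
    also have "\<dots> = farr M (inv\<^bsub>\<U>\<^esub> (u\<^sub>\<oplus>\<^sup>R\<^bsub>\<U>\<^esub> U) \<Zcomp>\<^bsub>\<U>\<^esub> u\<^sub>\<oplus>\<^sup>R\<^bsub>\<U>\<^esub> U)
        \<Zcomp>\<^bsub>\<C>\<^esub> (inv\<^bsub>\<C>\<^esub> (u\<^sub>\<oplus>\<^sup>R\<^bsub>\<C>\<^esub> ?P) \<Zcomp>\<^bsub>\<C>\<^esub> (\<one>\<^bsub>\<C>\<^esub> ?P \<oplus>\<^bsub>\<C>\<^esub> inv\<^bsub>\<C>\<^esub> ?b))"
      by (simp del: source.inv_arr_Arr(5) source.inv_arr_cancel)
    finally show ?thesis by simp
  qed
  have "farr F ?v \<Zcomp>\<^bsub>\<D>\<^esub> d (U \<^bold>\<oplus>\<^bsub>\<U>\<^esub> \<bottom>\<^bsub>\<U>\<^esub>)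
      = farr F (?v \<Zcomp>\<^bsub>\<C>\<^esub> ?n) \<Zcomp>\<^bsub>\<D>\<^esub> ((d U \<oplus>\<^bsub>\<D>\<^esub> d \<bottom>\<^bsub>\<U>\<^esub>) \<Zcomp>\<^bsub>\<D>\<^esub> u\<^sub>\<oplus>\<^sup>L\<^bsub>\<D>\<^esub> \<bottom>\<^bsub>\<D>\<^esub>)"
    using discard_par[of U "\<bottom>\<^bsub>\<U>\<^esub>", symmetric] by simp
  also have "\<dots> = inv\<^bsub>\<D>\<^esub> (u\<^sub>\<oplus>\<^sup>R\<^bsub>\<D>\<^esub> (fobj F ?P)) \<Zcomp>\<^bsub>\<D>\<^esub> (d U \<oplus>\<^bsub>\<D>\<^esub> \<one>\<^bsub>\<D>\<^esub> \<bottom>\<^bsub>\<D>\<^esub>)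
      \<Zcomp>\<^bsub>\<D>\<^esub> ((\<one>\<^bsub>\<D>\<^esub> \<bottom>\<^bsub>\<D>\<^esub> \<oplus>\<^bsub>\<D>\<^esub> e) \<Zcomp>\<^bsub>\<D>\<^esub> u\<^sub>\<oplus>\<^sup>L\<^bsub>\<D>\<^esub> \<bottom>\<^bsub>\<D>\<^esub>)"
    unfolding vn by (simp add: e_def)
  also have "\<dots> = inv\<^bsub>\<D>\<^esub> (u\<^sub>\<oplus>\<^sup>R\<^bsub>\<D>\<^esub> (fobj F ?P)) \<Zcomp>\<^bsub>\<D>\<^esub> (d U \<oplus>\<^bsub>\<D>\<^esub> \<one>\<^bsub>\<D>\<^esub> \<bottom>\<^bsub>\<D>\<^esub>)
      \<Zcomp>\<^bsub>\<D>\<^esub> (u\<^sub>\<oplus>\<^sup>R\<^bsub>\<D>\<^esub> \<bottom>\<^bsub>\<D>\<^esub> \<Zcomp>\<^bsub>\<D>\<^esub> e)"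
    using env.target.par.uL_natural_Arr[of e] by (simp add: env.target.par.uL_unit_eq_uR_unit)
  also have "\<dots> = inv\<^bsub>\<D>\<^esub> (u\<^sub>\<oplus>\<^sup>R\<^bsub>\<D>\<^esub> (fobj F ?P))
      \<Zcomp>\<^bsub>\<D>\<^esub> ((d U \<oplus>\<^bsub>\<D>\<^esub> \<one>\<^bsub>\<D>\<^esub> \<bottom>\<^bsub>\<D>\<^esub>) \<Zcomp>\<^bsub>\<D>\<^esub> u\<^sub>\<oplus>\<^sup>R\<^bsub>\<D>\<^esub> \<bottom>\<^bsub>\<D>\<^esub>) \<Zcomp>\<^bsub>\<D>\<^esub> e"
    by simp
  also have "\<dots> = inv\<^bsub>\<D>\<^esub> (u\<^sub>\<oplus>\<^sup>R\<^bsub>\<D>\<^esub> (fobj F ?P)) \<Zcomp>\<^bsub>\<D>\<^esub> (u\<^sub>\<oplus>\<^sup>R\<^bsub>\<D>\<^esub> (fobj F ?P) \<Zcomp>\<^bsub>\<D>\<^esub> d U) \<Zcomp>\<^bsub>\<D>\<^esub> e"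
    by (simp only: env.target.par.uR_natural_Arr[of "d U", simplified])
  also have "\<dots> = d U \<Zcomp>\<^bsub>\<D>\<^esub> e" by simp
  finally show ?thesis by (simp only: e_def)
qed

lemma denote_comp:
  assumes k: "k \<in> kraus_maps \<U> \<C> M A B" and l: "l \<in> kraus_maps \<U> \<C> M B C"
    and [simp]: "B \<in> Obj \<C>" "C \<in> Obj \<C>"
  shows "kraus_comp \<U> \<C> M C k l \<in> kraus_maps \<U> \<C> M A C"
    "denote C (kraus_comp \<U> \<C> M C k l) = denote B k \<Zcomp>\<^bsub>\<D>\<^esub> denote C l"
proof -
  obtain f U g V where kl: "k = (f, U)" "l = (g, V)" by (cases k, cases l)
  have [simp]: "U \<in> Obj \<U>" "f \<in> Arr \<C>" "Dom \<C> f = A" "Cod \<C> f = fobj M U \<^bold>\<oplus>\<^bsub>\<C>\<^esub> B"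
    "V \<in> Obj \<U>" "g \<in> Arr \<C>" "Dom \<C> g = B" "Cod \<C> g = fobj M V \<^bold>\<oplus>\<^bsub>\<C>\<^esub> C"
    using k l by (simp_all add: kl)
  show "kraus_comp \<U> \<C> M C k l \<in> kraus_maps \<U> \<C> M A C"
    by (simp add: kraus_comp_def kl)
  have "denote C (kraus_comp \<U> \<C> M C k l) = farr F f
      \<Zcomp>\<^bsub>\<D>\<^esub> (\<one>\<^bsub>\<D>\<^esub> (fobj F (fobj M U)) \<oplus>\<^bsub>\<D>\<^esub> farr F g)
      \<Zcomp>\<^bsub>\<D>\<^esub> a\<^sub>\<oplus>\<^bsub>\<D>\<^esub> (fobj F (fobj M U)) (fobj F (fobj M V)) (fobj F C)
      \<Zcomp>\<^bsub>\<D>\<^esub> ((farr F (inv\<^bsub>\<C>\<^esub> (n_par M U V)) \<Zcomp>\<^bsub>\<D>\<^esub> d (U \<^bold>\<oplus>\<^bsub>\<U>\<^esub> V)) \<oplus>\<^bsub>\<D>\<^esub> \<one>\<^bsub>\<D>\<^esub> (fobj F C))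
      \<Zcomp>\<^bsub>\<D>\<^esub> u\<^sub>\<oplus>\<^sup>L\<^bsub>\<D>\<^esub> (fobj F C)"
    by (simp add: denote_def kraus_comp_def kl)
  also have "\<dots> = denote B k \<Zcomp>\<^bsub>\<D>\<^esub> denote C l"
    unfolding inv_n_par_discard[OF \<open>U \<in> Obj \<U>\<close> \<open>V \<in> Obj \<U>\<close>] denote_def kl prod.case
    by (rule env.target.par.comp_discard) simp_all
  finally show "denote C (kraus_comp \<U> \<C> M C k l) = denote B k \<Zcomp>\<^bsub>\<D>\<^esub> denote C l" .
qed

end

context symmetric_environment_structure
begin

lemma farr_sym [simp]:
  assumes "A \<in> Obj \<C>" "B \<in> Obj \<C>"
  shows "farr F (c\<^sub>\<otimes>\<^bsub>\<S>\<^esub> A B) = c\<^sub>\<otimes>\<^bsub>\<T>\<^esub> (fobj F A) (fobj F B)"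
    "farr F (c\<^sub>\<oplus>\<^bsub>\<S>\<^esub> A B) = c\<^sub>\<oplus>\<^bsub>\<T>\<^esub> (fobj F A) (fobj F B)"
  using env.m_tensor_sym[OF assms] env.n_par_sym[OF assms] assms
  by (simp_all add: env.m_tensor_strict env.n_par_strict)

lemma farr_tensor_shuffle:
  assumes "X \<in> Obj \<C>" "A \<in> Obj \<C>" "Y \<in> Obj \<C>" "B \<in> Obj \<C>"
  shows "farr F (tensor_shuffle \<C> \<S> X A Y B) =
    tensor_shuffle \<D> \<T> (fobj F X) (fobj F A) (fobj F Y) (fobj F B)"
  using assms by (simp add: tensor_shuffle_def)

lemma farr_par_shuffle:
  assumes "X \<in> Obj \<C>" "A \<in> Obj \<C>" "Y \<in> Obj \<C>" "B \<in> Obj \<C>"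
  shows "farr F (par_shuffle \<C> \<S> X A Y B) =
    par_shuffle \<D> \<T> (fobj F X) (fobj F A) (fobj F Y) (fobj F B)"
  using assms by (simp add: par_shuffle_def)

lemma denote_tensor:
  assumes k: "k \<in> kraus_maps \<U> \<C> M A A'" and l: "l \<in> kraus_maps \<U> \<C> M B B'"
    and [simp]: "A' \<in> Obj \<C>" "B' \<in> Obj \<C>"
  shows "kraus_tensor \<U> \<C> \<S> M A' B' k l
      \<in> kraus_maps \<U> \<C> M (A \<^bold>\<otimes>\<^bsub>\<C>\<^esub> B) (A' \<^bold>\<otimes>\<^bsub>\<C>\<^esub> B')" (is ?typed)
    "denote (A' \<^bold>\<otimes>\<^bsub>\<C>\<^esub> B') (kraus_tensor \<U> \<C> \<S> M A' B' k l) = denote A' k \<otimes>\<^bsub>\<D>\<^esub> denote B' l" (is ?eq)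
proof -
  obtain f U g V where kl: "k = (f, U)" "l = (g, V)" by (cases k, cases l)
  have [simp]: "U \<in> Obj \<U>" "f \<in> Arr \<C>" "Dom \<C> f = A" "Cod \<C> f = fobj M U \<^bold>\<oplus>\<^bsub>\<C>\<^esub> A'"
    "V \<in> Obj \<U>" "g \<in> Arr \<C>" "Dom \<C> g = B" "Cod \<C> g = fobj M V \<^bold>\<oplus>\<^bsub>\<C>\<^esub> B'"
    using k l by (simp_all add: kl)
  show ?typed by (simp add: kraus_tensor_def kl)
  let ?AB = "fobj F A' \<^bold>\<otimes>\<^bsub>\<D>\<^esub> fobj F B'"
  have "denote (A' \<^bold>\<otimes>\<^bsub>\<C>\<^esub> B') (kraus_tensor \<U> \<C> \<S> M A' B' k l) = (farr F f \<otimes>\<^bsub>\<D>\<^esub> farr F g)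
      \<Zcomp>\<^bsub>\<D>\<^esub> (tensor_shuffle \<D> \<T> (fobj F (fobj M U)) (fobj F A') (fobj F (fobj M V)) (fobj F B')
      \<Zcomp>\<^bsub>\<D>\<^esub> (((farr F (inv\<^bsub>\<C>\<^esub> (n_par M U V)) \<Zcomp>\<^bsub>\<D>\<^esub> d (U \<^bold>\<oplus>\<^bsub>\<U>\<^esub> V)) \<oplus>\<^bsub>\<D>\<^esub> \<one>\<^bsub>\<D>\<^esub> ?AB)
      \<Zcomp>\<^bsub>\<D>\<^esub> u\<^sub>\<oplus>\<^sup>L\<^bsub>\<D>\<^esub> ?AB))"
    by (simp add: denote_def kraus_tensor_def kl farr_tensor_shuffle)
  also have "\<dots> = (farr F f \<otimes>\<^bsub>\<D>\<^esub> farr F g)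
      \<Zcomp>\<^bsub>\<D>\<^esub> (((d U \<oplus>\<^bsub>\<D>\<^esub> \<one>\<^bsub>\<D>\<^esub> (fobj F A')) \<Zcomp>\<^bsub>\<D>\<^esub> u\<^sub>\<oplus>\<^sup>L\<^bsub>\<D>\<^esub> (fobj F A'))
        \<otimes>\<^bsub>\<D>\<^esub> ((d V \<oplus>\<^bsub>\<D>\<^esub> \<one>\<^bsub>\<D>\<^esub> (fobj F B')) \<Zcomp>\<^bsub>\<D>\<^esub> u\<^sub>\<oplus>\<^sup>L\<^bsub>\<D>\<^esub> (fobj F B')))"
    using env.target.tensor_shuffle_discard[of "d U" "d V" "fobj F A'" "fobj F B'"]
    by (simp add: inv_n_par_discard)
  also have "\<dots> = denote A' k \<otimes>\<^bsub>\<D>\<^esub> denote B' l"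
    by (simp add: denote_def kl)
  finally show ?eq .
qed

lemma denote_par:
  assumes k: "k \<in> kraus_maps \<U> \<C> M A A'" and l: "l \<in> kraus_maps \<U> \<C> M B B'"
    and [simp]: "A' \<in> Obj \<C>" "B' \<in> Obj \<C>"
  shows "kraus_par \<U> \<C> \<S> M A' B' k l
      \<in> kraus_maps \<U> \<C> M (A \<^bold>\<oplus>\<^bsub>\<C>\<^esub> B) (A' \<^bold>\<oplus>\<^bsub>\<C>\<^esub> B')" (is ?typed)
    "denote (A' \<^bold>\<oplus>\<^bsub>\<C>\<^esub> B') (kraus_par \<U> \<C> \<S> M A' B' k l) = denote A' k \<oplus>\<^bsub>\<D>\<^esub> denote B' l" (is ?eq)
proof -
  obtain f U g V where kl: "k = (f, U)" "l = (g, V)" by (cases k, cases l)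
  have [simp]: "U \<in> Obj \<U>" "f \<in> Arr \<C>" "Dom \<C> f = A" "Cod \<C> f = fobj M U \<^bold>\<oplus>\<^bsub>\<C>\<^esub> A'"
    "V \<in> Obj \<U>" "g \<in> Arr \<C>" "Dom \<C> g = B" "Cod \<C> g = fobj M V \<^bold>\<oplus>\<^bsub>\<C>\<^esub> B'"
    using k l by (simp_all add: kl)
  show ?typed by (simp add: kraus_par_def kl)
  let ?AB = "fobj F A' \<^bold>\<oplus>\<^bsub>\<D>\<^esub> fobj F B'"
  have "denote (A' \<^bold>\<oplus>\<^bsub>\<C>\<^esub> B') (kraus_par \<U> \<C> \<S> M A' B' k l) = (farr F f \<oplus>\<^bsub>\<D>\<^esub> farr F g)
      \<Zcomp>\<^bsub>\<D>\<^esub> (par_shuffle \<D> \<T> (fobj F (fobj M U)) (fobj F A') (fobj F (fobj M V)) (fobj F B')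
      \<Zcomp>\<^bsub>\<D>\<^esub> (((farr F (inv\<^bsub>\<C>\<^esub> (n_par M U V)) \<Zcomp>\<^bsub>\<D>\<^esub> d (U \<^bold>\<oplus>\<^bsub>\<U>\<^esub> V)) \<oplus>\<^bsub>\<D>\<^esub> \<one>\<^bsub>\<D>\<^esub> ?AB)
      \<Zcomp>\<^bsub>\<D>\<^esub> u\<^sub>\<oplus>\<^sup>L\<^bsub>\<D>\<^esub> ?AB))"
    by (simp add: denote_def kraus_par_def kl farr_par_shuffle)
  also have "\<dots> = (farr F f \<oplus>\<^bsub>\<D>\<^esub> farr F g)
      \<Zcomp>\<^bsub>\<D>\<^esub> (((d U \<oplus>\<^bsub>\<D>\<^esub> \<one>\<^bsub>\<D>\<^esub> (fobj F A')) \<Zcomp>\<^bsub>\<D>\<^esub> u\<^sub>\<oplus>\<^sup>L\<^bsub>\<D>\<^esub> (fobj F A'))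
        \<oplus>\<^bsub>\<D>\<^esub> ((d V \<oplus>\<^bsub>\<D>\<^esub> \<one>\<^bsub>\<D>\<^esub> (fobj F B')) \<Zcomp>\<^bsub>\<D>\<^esub> u\<^sub>\<oplus>\<^sup>L\<^bsub>\<D>\<^esub> (fobj F B')))"
    using env.target.par_shuffle_discard[of "d U" "d V" "fobj F A'" "fobj F B'"]
    by (simp add: inv_n_par_discard)
  also have "\<dots> = denote A' k \<oplus>\<^bsub>\<D>\<^esub> denote B' l"
    by (simp add: denote_def kl)
  finally show ?eq .
qed

end

section \<open>Arrows as sets of purifications\<close>

locale purified_environment_structure = environment_structure \<U> \<C> M \<D> F d
  for \<U> :: "('u, 'm, 'x) unitary_data_scheme" and \<C> :: "('o, 'a, 'y) dagger_data_scheme"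
    and M :: "('u, 'm, 'o, 'a, 'z) dagger_fun_data_scheme"
    and \<D> :: "('p, 'b, 'w) isomix_data_scheme"
    and F :: "('o, 'a, 'p, 'b, 'v) isomix_fun_data_scheme"
    and d :: "'u \<Rightarrow> 'b" +
  assumes purification: "has_purification \<U> \<C> M \<D> F d"
begin

lemma fobj_bij: "bij_betw (fobj F) (Obj \<C>) (Obj \<D>)"
  using purification by (simp add: has_purification_def)

lemma denote_surj:
  assumes "g \<in> Arr \<D>" "Dom \<D> g = fobj F A" "Cod \<D> g = fobj F B" and [simp]: "A \<in> Obj \<C>" "B \<in> Obj \<C>"
  shows "\<exists>k \<in> kraus_maps \<U> \<C> M A B. denote B k = g"
proof -
  have "g \<in> hom \<D> (fobj F A) (fobj F B)" using assms by simp
  then obtain f U where k: "(f, U) \<in> kraus_maps \<U> \<C> M A B"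
    and g: "g = farr F f \<Zcomp>\<^bsub>\<D>\<^esub> n_par F (fobj M U) B \<Zcomp>\<^bsub>\<D>\<^esub> (d U \<oplus>\<^bsub>\<D>\<^esub> \<one>\<^bsub>\<D>\<^esub> (fobj F B)) \<Zcomp>\<^bsub>\<D>\<^esub> u\<^sub>\<oplus>\<^sup>L\<^bsub>\<D>\<^esub> (fobj F B)"
    using purification assms(4,5) unfolding has_purification_def by blast
  have "denote B (f, U) = g"
    using k unfolding g by (simp add: denote_def env.n_par_strict)
  with k show ?thesis by blast
qed

text \<open>A purification of the identity of \<open>\<bottom>\<close> may have its ancilla enlarged by \<open>\<bottom>\<close> without changing
  its class, so by the preceding computation the identity equals itself composed with the factor
  that measures how far the discard map of \<open>\<bottom>\<close> is from being canonical.\<close>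

lemma discard_bottom: "d \<bottom>\<^bsub>\<U>\<^esub> = farr F (n_bot M)"
proof -
  define e where "e = farr F (inv\<^bsub>\<C>\<^esub> (n_bot M)) \<Zcomp>\<^bsub>\<D>\<^esub> d \<bottom>\<^bsub>\<U>\<^esub>"
  have e [simp]: "e \<in> Arr \<D>" "Dom \<D> e = \<bottom>\<^bsub>\<D>\<^esub>" "Cod \<D> e = \<bottom>\<^bsub>\<D>\<^esub>" by (simp_all add: e_def)
  \<comment> \<open>Purify the identity of \<open>\<bottom>\<close> and compare with the version whose ancilla is \<open>U \<oplus> \<bottom>\<close>.\<close>
  obtain g U where k: "(g, U) \<in> kraus_maps \<U> \<C> M \<bottom>\<^bsub>\<C>\<^esub> \<bottom>\<^bsub>\<C>\<^esub>"
    and g: "denote \<bottom>\<^bsub>\<C>\<^esub> (g, U) = \<one>\<^bsub>\<D>\<^esub> \<bottom>\<^bsub>\<D>\<^esub>"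
    using denote_surj[of "\<one>\<^bsub>\<D>\<^esub> \<bottom>\<^bsub>\<D>\<^esub>" "\<bottom>\<^bsub>\<C>\<^esub>" "\<bottom>\<^bsub>\<C>\<^esub>"] by force
  have [simp]: "U \<in> Obj \<U>" "g \<in> Arr \<C>" "Dom \<C> g = \<bottom>\<^bsub>\<C>\<^esub>" "Cod \<C> g = fobj M U \<^bold>\<oplus>\<^bsub>\<C>\<^esub> \<bottom>\<^bsub>\<C>\<^esub>"
    using k by simp_all
  let ?v = "farr M (inv\<^bsub>\<U>\<^esub> (u\<^sub>\<oplus>\<^sup>R\<^bsub>\<U>\<^esub> U))" and ?b = "\<bottom>\<^bsub>\<D>\<^esub>"
  let ?k = "(g \<Zcomp>\<^bsub>\<C>\<^esub> (?v \<oplus>\<^bsub>\<C>\<^esub> \<one>\<^bsub>\<C>\<^esub> \<bottom>\<^bsub>\<C>\<^esub>), U \<^bold>\<oplus>\<^bsub>\<U>\<^esub> \<bottom>\<^bsub>\<U>\<^esub>)"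
  have "\<one>\<^bsub>\<D>\<^esub> ?b = denote \<bottom>\<^bsub>\<C>\<^esub> ?k"
    unfolding g[symmetric]
    using kraus_equiv_add_bottom[OF k] kraus_equiv_iff_denote[OF k, of ?k] by simp
  also have "\<dots> = farr F g \<Zcomp>\<^bsub>\<D>\<^esub> ((farr F ?v \<Zcomp>\<^bsub>\<D>\<^esub> d (U \<^bold>\<oplus>\<^bsub>\<U>\<^esub> \<bottom>\<^bsub>\<U>\<^esub>)) \<oplus>\<^bsub>\<D>\<^esub> \<one>\<^bsub>\<D>\<^esub> ?b) \<Zcomp>\<^bsub>\<D>\<^esub> u\<^sub>\<oplus>\<^sup>L\<^bsub>\<D>\<^esub> ?b"
    by (simp add: denote_def)
  also have "\<dots> = farr F g \<Zcomp>\<^bsub>\<D>\<^esub> ((d U \<Zcomp>\<^bsub>\<D>\<^esub> e) \<oplus>\<^bsub>\<D>\<^esub> \<one>\<^bsub>\<D>\<^esub> ?b) \<Zcomp>\<^bsub>\<D>\<^esub> u\<^sub>\<oplus>\<^sup>L\<^bsub>\<D>\<^esub> ?b"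
    by (simp only: discard_add_bottom e_def \<open>U \<in> Obj \<U>\<close>)
  also have "\<dots> = farr F g \<Zcomp>\<^bsub>\<D>\<^esub> (d U \<oplus>\<^bsub>\<D>\<^esub> \<one>\<^bsub>\<D>\<^esub> ?b) \<Zcomp>\<^bsub>\<D>\<^esub> ((e \<oplus>\<^bsub>\<D>\<^esub> \<one>\<^bsub>\<D>\<^esub> ?b) \<Zcomp>\<^bsub>\<D>\<^esub> u\<^sub>\<oplus>\<^sup>L\<^bsub>\<D>\<^esub> ?b)"
    by simp
  also have "\<dots> = farr F g \<Zcomp>\<^bsub>\<D>\<^esub> (d U \<oplus>\<^bsub>\<D>\<^esub> \<one>\<^bsub>\<D>\<^esub> ?b) \<Zcomp>\<^bsub>\<D>\<^esub> (u\<^sub>\<oplus>\<^sup>L\<^bsub>\<D>\<^esub> ?b \<Zcomp>\<^bsub>\<D>\<^esub> e)"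
    using env.target.par.uR_natural_Arr[of e] by (simp add: env.target.par.uL_unit_eq_uR_unit)
  also have "\<dots> = denote \<bottom>\<^bsub>\<C>\<^esub> (g, U) \<Zcomp>\<^bsub>\<D>\<^esub> e"
    by (simp add: denote_def)
  also have "\<dots> = e" using g by simp
  finally have "e = \<one>\<^bsub>\<D>\<^esub> ?b" by (rule sym)
  then have "farr F (n_bot M) \<Zcomp>\<^bsub>\<D>\<^esub> e = farr F (n_bot M)" by simp
  moreover have "farr F (n_bot M) \<Zcomp>\<^bsub>\<D>\<^esub> e = farr F (n_bot M \<Zcomp>\<^bsub>\<C>\<^esub> inv\<^bsub>\<C>\<^esub> (n_bot M)) \<Zcomp>\<^bsub>\<D>\<^esub> d \<bottom>\<^bsub>\<U>\<^esub>"
    unfolding e_def by (simp del: target.inv_arr_Arr(4) target.inv_arr_cancel)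
  ultimately show ?thesis by simp
qed

text \<open>The ancilla \<open>\<bottom>\<close> that \<open>Q\<close> adds is removed again by the discard map, as the latter is canonical.\<close>

lemma denote_Q:
  assumes [simp]: "f \<in> Arr \<C>"
  defines "k \<equiv> (f \<Zcomp>\<^bsub>\<C>\<^esub> inv\<^bsub>\<C>\<^esub> (u\<^sub>\<oplus>\<^sup>L\<^bsub>\<C>\<^esub> (Cod \<C> f)) \<Zcomp>\<^bsub>\<C>\<^esub> (inv\<^bsub>\<C>\<^esub> (n_bot M) \<oplus>\<^bsub>\<C>\<^esub> \<one>\<^bsub>\<C>\<^esub> (Cod \<C> f)), \<bottom>\<^bsub>\<U>\<^esub>)"
  shows "k \<in> kraus_maps \<U> \<C> M (Dom \<C> f) (Cod \<C> f)" "denote (Cod \<C> f) k = farr F f"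
proof -
  show "k \<in> kraus_maps \<U> \<C> M (Dom \<C> f) (Cod \<C> f)" by (simp add: k_def)
  have "farr F (inv\<^bsub>\<C>\<^esub> (n_bot M)) \<Zcomp>\<^bsub>\<D>\<^esub> d \<bottom>\<^bsub>\<U>\<^esub> = farr F (inv\<^bsub>\<C>\<^esub> (n_bot M) \<Zcomp>\<^bsub>\<C>\<^esub> n_bot M)"
    unfolding discard_bottom by (simp del: target.inv_arr_Arr(5))
  then show "denote (Cod \<C> f) k = farr F f" by (simp add: denote_def k_def)
qed

definition object_name :: "'p \<Rightarrow> 'o" where
  "object_name = inv_into (Obj \<C>) (fobj F)"

lemma object_name [simp]:
  "X \<in> Obj \<D> \<Longrightarrow> object_name X \<in> Obj \<C>"
  "X \<in> Obj \<D> \<Longrightarrow> fobj F (object_name X) = X"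
  "A \<in> Obj \<C> \<Longrightarrow> object_name (fobj F A) = A"
  using bij_betw_imp_surj_on[OF fobj_bij] bij_betw_imp_inj_on[OF fobj_bij]
  by (auto simp: object_name_def inv_into_into f_inv_into_f)

lemma object_name_eq: "A \<in> Obj \<C> \<Longrightarrow> X = fobj F A \<Longrightarrow> object_name X = A"
  by simp

definition purifications :: "'o \<Rightarrow> 'o \<Rightarrow> 'b \<Rightarrow> ('a \<times> 'u) set" where
  "purifications A B g = {k \<in> kraus_maps \<U> \<C> M A B. denote B k = g}"

text \<open>The inverse of denotation, with the value already in the tagged form in which \<open>CP\<^sup>\<infinity>\<close> presents its
  arrows. The objects are read off through the inverse of the bijection \<open>F\<close>.\<close>

definition purify :: "'b \<Rightarrow> ('u, 'o, 'a) cp_arr" where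
  "purify g = (object_name (Dom \<D> g), object_name (Cod \<D> g),
    purifications (object_name (Dom \<D> g)) (object_name (Cod \<D> g)) g)"

lemma purifications_nonempty:
  "g \<in> Arr \<D> \<Longrightarrow> purifications (object_name (Dom \<D> g)) (object_name (Cod \<D> g)) g \<noteq> {}"
  using denote_surj[of g "object_name (Dom \<D> g)" "object_name (Cod \<D> g)"]
  by (auto simp: purifications_def simp del: kraus_maps_iff)

lemma kraus_class_eq:
  assumes "k \<in> kraus_maps \<U> \<C> M A B" "A \<in> Obj \<C>" "B \<in> Obj \<C>"
  shows "kraus_class \<U> \<C> M A B k = purifications A B (denote B k)"
  using kraus_equiv_iff_denote[OF assms(1)] assms by (auto simp: kraus_class_def purifications_def)

lemma cp_arrow_eq:
  assumes "k \<in> kraus_maps \<U> \<C> M A B" "A \<in> Obj \<C>" "B \<in> Obj \<C>"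
  shows "cp_arrow \<U> \<C> M A B k = purify (denote B k)"
  using denote_Arr[OF assms(1,3)] assms by (simp add: cp_arrow_def purify_def kraus_class_eq)

lemma cp_Q_eq: "f \<in> Arr \<C> \<Longrightarrow> cp_Q \<U> \<C> M f = purify (farr F f)"
  using cp_arrow_eq[OF denote_Q(1)[of f]] denote_Q(2)[of f] by (simp add: cp_Q_def)

text \<open>If all values of \<open>op\<close> have the same denotation, the classes in the union defining the lift
  coincide; non-emptiness of \<open>K\<close> and \<open>L\<close> ensures that the union is this common class.\<close>

lemma cp_lift_eq:
  assumes "K \<noteq> {}" "L \<noteq> {}" and [simp]: "A \<in> Obj \<C>" "B \<in> Obj \<C>"
    and op: "\<And>k l. k \<in> K \<Longrightarrow> l \<in> L \<Longrightarrow> op k l \<in> kraus_maps \<U> \<C> M A B \<and> denote B (op k l) = h"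
  shows "cp_lift \<U> \<C> M A B op K L = purify h"
proof -
  have "kraus_class \<U> \<C> M A B (op k l) = purifications A B h" if "k \<in> K" "l \<in> L" for k l
    using op[OF that] by (simp add: kraus_class_eq)
  then have "(\<Union>k \<in> K. \<Union>l \<in> L. kraus_class \<U> \<C> M A B (op k l)) = purifications A B h"
    using assms(1,2) by auto
  moreover obtain k where "k \<in> kraus_maps \<U> \<C> M A B" "denote B k = h"
    using assms(1,2) op by fastforce
  ultimately show ?thesis using denote_Arr[of k A B] by (auto simp: cp_lift_def purify_def)
qed

lemma cp_comp_eq:
  assumes [simp]: "f \<in> Arr \<D>" "g \<in> Arr \<D>" and eq: "Cod \<D> f = Dom \<D> g"
  shows "cp_comp \<U> \<C> M (purify f) (purify g) = purify (f \<Zcomp>\<^bsub>\<D>\<^esub> g)"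
proof -
  let ?A = "object_name (Dom \<D> f)" and ?B = "object_name (Cod \<D> f)" and ?C = "object_name (Cod \<D> g)"
  have "cp_lift \<U> \<C> M ?A ?C (kraus_comp \<U> \<C> M ?C) (purifications ?A ?B f) (purifications ?B ?C g)
      = purify (f \<Zcomp>\<^bsub>\<D>\<^esub> g)"
  proof (rule cp_lift_eq)
    show "purifications ?A ?B f \<noteq> {}" "purifications ?B ?C g \<noteq> {}"
      using purifications_nonempty[of f] purifications_nonempty[of g] by (simp_all add: eq)
    show "kraus_comp \<U> \<C> M ?C k l \<in> kraus_maps \<U> \<C> M ?A ?C \<and>
        denote ?C (kraus_comp \<U> \<C> M ?C k l) = f \<Zcomp>\<^bsub>\<D>\<^esub> g"
      if "k \<in> purifications ?A ?B f" "l \<in> purifications ?B ?C g" for k l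
      using denote_comp[of k ?A ?B l ?C] that by (simp add: purifications_def)
  qed simp_all
  then show ?thesis by (simp add: cp_comp_def purify_def eq)
qed

lemma purify_inj:
  assumes "f \<in> Arr \<D>" "g \<in> Arr \<D>" "purify f = purify g"
  shows "f = g"
proof -
  let ?A = "object_name (Dom \<D> f)" and ?B = "object_name (Cod \<D> f)"
  have eq: "purifications ?A ?B f = purifications ?A ?B g"
    using assms(3) unfolding purify_def prod.inject by metis
  obtain k where k: "k \<in> purifications ?A ?B f"
    using purifications_nonempty[OF assms(1)] by blast
  have "denote ?B k = f" using k by (simp add: purifications_def)
  moreover have "denote ?B k = g" using k[unfolded eq] by (simp add: purifications_def)
  ultimately show ?thesis by (rule subst)
qed

lemma CP_isomorphism:
  fixes R :: "('p, 'b, 'o, ('u, 'o, 'a) cp_arr, 'r) fun_data_scheme"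
  assumes [simp]: "fobj R = object_name" "farr R = purify"
  shows "category_isomorphism \<D> (CP_category \<U> \<C> M) R"
proof
  show "bij_betw (fobj R) (Obj \<D>) (Obj (CP_category \<U> \<C> M))"
    unfolding assms
    by (rule bij_betw_byWitness[where f' = "fobj F"]) (auto simp: CP_category_def)
  have "purify g \<in> Arr (CP_category \<U> \<C> M)" if g: "g \<in> Arr \<D>" for g
  proof -
    let ?A = "object_name (Dom \<D> g)" and ?B = "object_name (Cod \<D> g)"
    obtain k where k: "k \<in> kraus_maps \<U> \<C> M ?A ?B" "denote ?B k = g"
      using purifications_nonempty[OF g] unfolding purifications_def by blast
    have AB: "?A \<in> Obj \<C>" "?B \<in> Obj \<C>" using g by simp_all
    have "purify g = cp_arrow \<U> \<C> M ?A ?B k" using cp_arrow_eq[OF k(1) AB] k(2) by simp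
    then show ?thesis unfolding CP_category_def cat.simps using k(1) AB by blast
  qed
  moreover have "h \<in> purify ` Arr \<D>" if "h \<in> Arr (CP_category \<U> \<C> M)" for h
  proof -
    obtain A B k where "A \<in> Obj \<C>" "B \<in> Obj \<C>" "k \<in> kraus_maps \<U> \<C> M A B"
      "h = cp_arrow \<U> \<C> M A B k"
      using \<open>h \<in> Arr (CP_category \<U> \<C> M)\<close> unfolding CP_category_def cat.simps by blast
    then show ?thesis using cp_arrow_eq[of k A B] denote_Arr[of k A B] by blast
  qed
  ultimately have "purify ` Arr \<D> = Arr (CP_category \<U> \<C> M)" by blast
  then show "bij_betw (farr R) (Arr \<D>) (Arr (CP_category \<U> \<C> M))"
    unfolding bij_betw_def assms using purify_inj by (blast intro: inj_onI)
  show "\<one>\<^bsub>CP_category \<U> \<C> M\<^esub> (fobj R A) = farr R (\<one>\<^bsub>\<D>\<^esub> A)" if "A \<in> Obj \<D>" for A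
    using cp_Q_eq[of "\<one>\<^bsub>\<C>\<^esub> (object_name A)"] that by (simp add: CP_category_def cp_Q_def)
  show "Dom (CP_category \<U> \<C> M) (farr R f) = fobj R (Dom \<D> f)"
    "Cod (CP_category \<U> \<C> M) (farr R f) = fobj R (Cod \<D> f)" for f
    by (simp_all add: CP_category_def purify_def)
  show "farr R f \<Zcomp>\<^bsub>CP_category \<U> \<C> M\<^esub> farr R g = farr R (f \<Zcomp>\<^bsub>\<D>\<^esub> g)"
    if "f \<in> Arr \<D>" "g \<in> Arr \<D>" "Cod \<D> f = Dom \<D> g" for f g
    using that by (simp add: CP_category_def cp_comp_eq)
qed

lemma isomorphic_CP_category: "isomorphic_categories \<D> (CP_category \<U> \<C> M)"
proof -
  define R :: "('p, 'b, 'o, ('u, 'o, 'a) cp_arr) fun_data"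
    where "R = \<lparr>fobj = object_name, farr = purify\<rparr>"
  define R' :: "('o, ('u, 'o, 'a) cp_arr, 'p, 'b) fun_data"
    where "R' = \<lparr>fobj = fobj F, farr = inv_into (Arr \<D>) purify\<rparr>"
  interpret R: category_isomorphism \<D> "CP_category \<U> \<C> M" R
    by (rule CP_isomorphism) (simp_all add: R_def)
  have "farr R' (farr R f) = f" if "f \<in> Arr \<D>" for f
    using that purify_inj by (auto simp: R_def R'_def intro!: inv_into_f_f inj_onI)
  then have inverse: "category_isomorphism (CP_category \<U> \<C> M) \<D> R'"
    "mutually_inverse \<D> (CP_category \<U> \<C> M) R R'"
    using R.inverse_isomorphism[of R'] by (simp_all add: R_def R'_def)
  have "functor_on \<D> (CP_category \<U> \<C> M) R" by (rule R.functor_on)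
  moreover have "functor_on (CP_category \<U> \<C> M) \<D> R'"
    using category_isomorphism.functor_on[OF inverse(1)] .
  ultimately show ?thesis using inverse(2) unfolding isomorphic_categories_def by blast
qed

end

locale purified_symmetric_environment_structure =
  symmetric_environment_structure \<U> \<R> \<C> \<S> M \<D> \<T> F d + purified_environment_structure \<U> \<C> M \<D> F d
  for \<U> :: "('u, 'm, 'x) unitary_data_scheme" and \<R> :: "('u, 'm) symmetry"
    and \<C> :: "('o, 'a, 'y) dagger_data_scheme" and \<S> :: "('o, 'a) symmetry"
    and M :: "('u, 'm, 'o, 'a, 'z) dagger_fun_data_scheme"
    and \<D> :: "('p, 'b, 'w) isomix_data_scheme" and \<T> :: "('p, 'b) symmetry"
    and F :: "('o, 'a, 'p, 'b, 'v) isomix_fun_data_scheme"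
    and d :: "'u \<Rightarrow> 'b"
begin

lemma cp_tensor_eq:
  assumes [simp]: "f \<in> Arr \<D>" "g \<in> Arr \<D>"
  shows "cp_tensor \<U> \<C> \<S> M (purify f) (purify g) = purify (f \<otimes>\<^bsub>\<D>\<^esub> g)"
proof -
  let ?A = "object_name (Dom \<D> f)" and ?A' = "object_name (Cod \<D> f)"
    and ?B = "object_name (Dom \<D> g)" and ?B' = "object_name (Cod \<D> g)"
  have "cp_lift \<U> \<C> M (?A \<^bold>\<otimes>\<^bsub>\<C>\<^esub> ?B) (?A' \<^bold>\<otimes>\<^bsub>\<C>\<^esub> ?B') (kraus_tensor \<U> \<C> \<S> M ?A' ?B')
      (purifications ?A ?A' f) (purifications ?B ?B' g) = purify (f \<otimes>\<^bsub>\<D>\<^esub> g)"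
  proof (rule cp_lift_eq)
    show "purifications ?A ?A' f \<noteq> {}" "purifications ?B ?B' g \<noteq> {}"
      by (simp_all add: purifications_nonempty)
    show "kraus_tensor \<U> \<C> \<S> M ?A' ?B' k l \<in> kraus_maps \<U> \<C> M (?A \<^bold>\<otimes>\<^bsub>\<C>\<^esub> ?B) (?A' \<^bold>\<otimes>\<^bsub>\<C>\<^esub> ?B') \<and>
        denote (?A' \<^bold>\<otimes>\<^bsub>\<C>\<^esub> ?B') (kraus_tensor \<U> \<C> \<S> M ?A' ?B' k l) = f \<otimes>\<^bsub>\<D>\<^esub> g"
      if "k \<in> purifications ?A ?A' f" "l \<in> purifications ?B ?B' g" for k l
      using denote_tensor[of k ?A ?A' l ?B ?B'] that by (simp add: purifications_def)
  qed simp_all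
  then show ?thesis by (simp add: cp_tensor_def purify_def)
qed

lemma cp_par_eq:
  assumes [simp]: "f \<in> Arr \<D>" "g \<in> Arr \<D>"
  shows "cp_par \<U> \<C> \<S> M (purify f) (purify g) = purify (f \<oplus>\<^bsub>\<D>\<^esub> g)"
proof -
  let ?A = "object_name (Dom \<D> f)" and ?A' = "object_name (Cod \<D> f)"
    and ?B = "object_name (Dom \<D> g)" and ?B' = "object_name (Cod \<D> g)"
  have "cp_lift \<U> \<C> M (?A \<^bold>\<oplus>\<^bsub>\<C>\<^esub> ?B) (?A' \<^bold>\<oplus>\<^bsub>\<C>\<^esub> ?B') (kraus_par \<U> \<C> \<S> M ?A' ?B')
      (purifications ?A ?A' f) (purifications ?B ?B' g) = purify (f \<oplus>\<^bsub>\<D>\<^esub> g)"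
  proof (rule cp_lift_eq)
    show "purifications ?A ?A' f \<noteq> {}" "purifications ?B ?B' g \<noteq> {}"
      by (simp_all add: purifications_nonempty)
    show "kraus_par \<U> \<C> \<S> M ?A' ?B' k l \<in> kraus_maps \<U> \<C> M (?A \<^bold>\<oplus>\<^bsub>\<C>\<^esub> ?B) (?A' \<^bold>\<oplus>\<^bsub>\<C>\<^esub> ?B') \<and>
        denote (?A' \<^bold>\<oplus>\<^bsub>\<C>\<^esub> ?B') (kraus_par \<U> \<C> \<S> M ?A' ?B' k l) = f \<oplus>\<^bsub>\<D>\<^esub> g"
      if "k \<in> purifications ?A ?A' f" "l \<in> purifications ?B ?B' g" for k l
      using denote_par[of k ?A ?A' l ?B ?B'] that by (simp add: purifications_def)
  qed simp_all
  then show ?thesis by (simp add: cp_par_def purify_def)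
qed

lemma object_name_structure [simp]:
  "X \<in> Obj \<D> \<Longrightarrow> Y \<in> Obj \<D> \<Longrightarrow> object_name (X \<^bold>\<otimes>\<^bsub>\<D>\<^esub> Y) = object_name X \<^bold>\<otimes>\<^bsub>\<C>\<^esub> object_name Y"
  "X \<in> Obj \<D> \<Longrightarrow> Y \<in> Obj \<D> \<Longrightarrow> object_name (X \<^bold>\<oplus>\<^bsub>\<D>\<^esub> Y) = object_name X \<^bold>\<oplus>\<^bsub>\<C>\<^esub> object_name Y"
  "object_name \<top>\<^bsub>\<D>\<^esub> = \<top>\<^bsub>\<C>\<^esub>" "object_name \<bottom>\<^bsub>\<D>\<^esub> = \<bottom>\<^bsub>\<C>\<^esub>"
  by (rule object_name_eq; simp)+

lemma CP_symmetric_isomix_isomorphism: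
  "symmetric_isomix_isomorphism \<D> \<T> (CP_isomix \<U> \<C> \<S> M) (CP_symmetry \<U> \<C> \<S> M)
    (strict_functor (CP_isomix \<U> \<C> \<S> M) object_name purify)"
proof -
  interpret R: category_isomorphism \<D> "CP_isomix \<U> \<C> \<S> M"
    "strict_functor (CP_isomix \<U> \<C> \<S> M) object_name purify"
    using CP_isomorphism[of "strict_functor (CP_isomix \<U> \<C> \<S> M) object_name purify"]
    by (simp add: category_isomorphism_def category_isomorphism_axioms_def CP_isomix_def)
  show ?thesis
    by unfold_locales
      (simp_all add: CP_isomix_def CP_symmetry_def cp_Q_eq cp_tensor_eq cp_par_eq)
qed

end

section \<open>The isomorphism\<close>

lemma symmetric_isomix_isomorphism_imp_isomorphic:
  fixes \<C> :: "('o, 'a) isomix_data" and \<E> :: "('p, 'b) isomix_data"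
    and R :: "('o, 'a, 'p, 'b) isomix_fun_data"
  assumes "symmetric_isomix_isomorphism \<C> \<S> \<E> \<T> R"
  shows "isomorphic_symmetric_isomix \<C> \<S> \<E> \<T>"
proof -
  interpret R: symmetric_isomix_isomorphism \<C> \<S> \<E> \<T> R by (rule assms)
  let ?\<psi> = "inv_into (Obj \<C>) (fobj R)" and ?\<Psi> = "inv_into (Arr \<C>) (farr R)"
  have obj: "?\<psi> (fobj R A) = A" if "A \<in> Obj \<C>" for A
    using bij_betw_imp_inj_on[OF R.fobj_bij] that by simp
  have arr: "?\<Psi> (farr R f) = f" if "f \<in> Arr \<C>" for f
    using bij_betw_imp_inj_on[OF R.farr_bij] that by simp
  let ?R' = "strict_functor \<C> ?\<psi> ?\<Psi>"
  interpret R': symmetric_isomix_isomorphism \<E> \<T> \<C> \<S> ?R'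
    by (rule R.inverse_symmetric_isomix_isomorphism) (fact obj arr)+
  have "mutually_inverse \<C> \<E> R ?R'"
    by (rule R.inverse_isomorphism) (simp_all add: obj arr)
  then show ?thesis
    unfolding isomorphic_symmetric_isomix_def
    using R.strict_isomix_functor R.symmetric_isomix_functor R'.strict_isomix_functor
      R'.symmetric_isomix_functor by blast
qed

theorem corollary6p6:
  fixes \<U> :: "('u, 'm) unitary_data" and \<C> :: "('o, 'a) dagger_data"
    and M :: "('u, 'm, 'o, 'a) dagger_fun_data" and \<D> :: "('p, 'b) isomix_data"
    and F :: "('o, 'a, 'p, 'b) isomix_fun_data" and d :: "'u \<Rightarrow> 'b"
  assumes "mixed_unitary_category \<U> \<C> M"
    and "environment_structure \<U> \<C> M \<D> F d"
    and "has_purification \<U> \<C> M \<D> F d"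
  shows "isomorphic_categories \<D> (CP_category \<U> \<C> M) \<and>
    (\<forall>(\<R> :: ('u, 'm) symmetry) (\<S> :: ('o, 'a) symmetry) (\<T> :: ('p, 'b) symmetry).
       symmetric_environment_structure \<U> \<R> \<C> \<S> M \<D> \<T> F d \<longrightarrow>
       isomorphic_symmetric_isomix \<D> \<T> (CP_isomix \<U> \<C> \<S> M) (CP_symmetry \<U> \<C> \<S> M))"
proof (intro conjI allI impI)
  interpret environment_structure \<U> \<C> M \<D> F d by (rule assms(2))
  interpret purified_environment_structure \<U> \<C> M \<D> F d
    by unfold_locales (rule assms(3))
  show "isomorphic_categories \<D> (CP_category \<U> \<C> M)" by (rule isomorphic_CP_category)
  fix \<R> :: "('u, 'm) symmetry" and \<S> :: "('o, 'a) symmetry" and \<T> :: "('p, 'b) symmetry"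
  assume "symmetric_environment_structure \<U> \<R> \<C> \<S> M \<D> \<T> F d"
  then interpret sym: purified_symmetric_environment_structure \<U> \<R> \<C> \<S> M \<D> \<T> F d
    by (intro purified_symmetric_environment_structure.intro purified_environment_structure_axioms)
  show "isomorphic_symmetric_isomix \<D> \<T> (CP_isomix \<U> \<C> \<S> M) (CP_symmetry \<U> \<C> \<S> M)"
    using sym.CP_symmetric_isomix_isomorphism
    by (rule symmetric_isomix_isomorphism_imp_isomorphic)
qed

end
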